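(* Let $\Gamma$ be a quiver of type ADE (its underlying graph is a simply laced Dynkin diagram), let $\nu\in P_+$, $\lambda\in P$, and let $w$ be an element of the Weyl group of $\mathfrak g(\Gamma)$. Then $$n(\nu,w\cdot\lambda,q)=(-1)^{l(w)}n(\nu,\lambda,q),$$ where $w\cdot\lambda=w(\lambda+\rho)-\rho$ and $l(w)$ is the length of $w$.
   Context: $I$ is the set of vertices of $\Gamma$, $\mathfrak g=\mathfrak g(\Gamma)$ the corresponding simple Lie algebra with Cartan subalgebra $\mathfrak h$, $\alpha_i$ ($i\in I$) the simple roots, $(-,-)$ the standard symmetric bilinear form on $\mathfrak h^\vee$, normalized by $(\alpha_i,\alpha_i)=2$ (so $(\alpha_i,\alpha_j)$ is the Cartan matrix). $Q=\bigoplus_i\mathbb Z\alpha_i$, $Q_+=\bigoplus_i\mathbb N\alpha_i$; write $\alpha=\sum_i\alpha^i\alpha_i$ and identify $Q$ with $\mathbb Z^I$. $P$ is the weight lattice; for $\nu\in P$ put $\nu_i=(\nu,\alpha_i)\in\mathbb Z$; $P_+=\{\nu\in P:\nu_i\ge0\ \forall i\}$. Elements of $Q$ are also regarded as elements of $P$. $T(\alpha)=\frac12(\alpha,\alpha)$. $\rho\in P$ is the weight with $\rho_i=1$ for all $i$. For $n\in\mathbb Z$, $m\in\mathbb N$: $[n,m]=\prod_{k=1}^m\frac{1-q^{n+k}}{1-q^k}\in\mathbb Q(q)$; for $\nu\in P$, $\alpha\in Q_+$: $[\nu,\alpha]=\prod_i[\nu_i,\alpha^i]$. $\mathcal P$ is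 the set of partitions $(\tau_1\ge\tau_2\ge\dots\ge0)$, eventually zero. For $\tau=(\tau^i)_{i\in I}\in\mathcal P^I$ put $\tau_k=(\tau^i_k)_{i\in I}\in\mathbb N^I=Q_+$, $|\tau|=\sum_{k\ge1}\tau_k$. For $\nu,\lambda\in P$ the fermionic form is $$n(\nu,\lambda,q)=\sum_{\tau\in\mathcal P^I,\ |\tau|=\nu-\lambda}q^{-(\nu,\tau_1)}\prod_{k\ge1}q^{T(\tau_k)}\Big[\nu-\sum_{l=1}^k\tau_l,\ \tau_k-\tau_{k+1}\Big]$$ (zero unless $\nu-\lambda\in Q_+$). *)

theory Defs
  imports
    "HOL-Analysis.Finite_Cartesian_Product"
    "HOL-Library.Groups_Big_Fun"
    "HOL-Computational_Algebra.Polynomial"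
    "HOL-Computational_Algebra.Fraction_Field"
    "Graph_Theory.Digraph"
begin

section \<open>Quivers of type ADE\<close>

text \<open>Edge sets of the simply laced Dynkin diagrams on the vertices \<open>1, \<dots>, n\<close>,
  in the Bourbaki labelling.\<close>

definition A_edges :: "nat \<Rightarrow> nat set set" where
  "A_edges n = {{k, Suc k} | k. 1 \<le> k \<and> k < n}"

definition D_edges :: "nat \<Rightarrow> nat set set" where
  "D_edges n = {{k, Suc k} | k. 1 \<le> k \<and> Suc k < n} \<union> {{n - 2, n}}"

definition E_edges :: "nat \<Rightarrow> nat set set" where
  "E_edges n = {{1, 3}, {2, 4}} \<union> {{k, Suc k} | k. 3 \<le> k \<and> k < n}"

inductive simply_laced_dynkin :: "nat \<Rightarrow> nat set set \<Rightarrow> bool" where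
  A: "n \<ge> 1 \<Longrightarrow> simply_laced_dynkin n (A_edges n)"
| D: "n \<ge> 4 \<Longrightarrow> simply_laced_dynkin n (D_edges n)"
| E: "n \<in> {6, 7, 8} \<Longrightarrow> simply_laced_dynkin n (E_edges n)"

text \<open>The number of edges between two vertices in the underlying graph of a quiver
  (for \<open>i = j\<close>, the number of loops).\<close>

definition edge_mult :: "('i, 'a) pre_digraph \<Rightarrow> 'i \<Rightarrow> 'i \<Rightarrow> nat" where
  "edge_mult \<Gamma> i j = card {a \<in> arcs \<Gamma>. {tail \<Gamma> a, head \<Gamma> a} = {i, j}}"

text \<open>The set \<open>I\<close> of vertices is a whole finite type, so that \<open>I\<close>-indexed vectors are
  available. The bijection \<open>f\<close> is an isomorphism from the underlying graph to a diagram;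
  as no diagram contains a singleton edge, there are no loops.\<close>

definition ADE_quiver :: "('i::finite, 'a) pre_digraph \<Rightarrow> bool" where
  "ADE_quiver \<Gamma> \<longleftrightarrow> fin_digraph \<Gamma> \<and> verts \<Gamma> = UNIV \<and>
     (\<exists>n E f. simply_laced_dynkin n E \<and> bij_betw f UNIV {1..n} \<and>
        (\<forall>i j. edge_mult \<Gamma> i j = (if {f i, f j} \<in> E then 1 else 0)))"


section \<open>Roots, weights and the Weyl group\<close>

text \<open>The dual Cartan space \<open>\<hh>\<^sup>\<or>\<close> is \<open>complex ^ 'i\<close>, in coordinates with respect to
  the basis of simple roots.\<close>

definition simple_root :: "'i \<Rightarrow> complex ^ 'i::finite" where
  "simple_root i = (\<chi> j. if j = i then 1 else 0)"

definition cartan_matrix :: "('i, 'a) pre_digraph \<Rightarrow> 'i \<Rightarrow> 'i \<Rightarrow> int" where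
  "cartan_matrix \<Gamma> i j = (if i = j then 2 else - int (edge_mult \<Gamma> i j))"

definition form ::
  "('i::finite, 'a) pre_digraph \<Rightarrow> complex ^ 'i \<Rightarrow> complex ^ 'i \<Rightarrow> complex" where
  "form \<Gamma> x y = (\<Sum>i\<in>UNIV. \<Sum>j\<in>UNIV. x $ i * of_int (cartan_matrix \<Gamma> i j) * y $ j)"

definition weight_lattice :: "('i::finite, 'a) pre_digraph \<Rightarrow> (complex ^ 'i) set" where
  "weight_lattice \<Gamma> = {x. \<forall>i. form \<Gamma> x (simple_root i) \<in> \<int>}"

text \<open>The integer represented by a complex number; used for elements of \<open>\<int>\<close> only.\<close>

definition int_of :: "complex \<Rightarrow> int" where
  "int_of z = \<lfloor>Re z\<rfloor>"

text \<open>The integer \<open>\<nu>\<^sub>i = (\<nu>, \<alpha>\<^sub>i)\<close>.\<close>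

definition weight_coord :: "('i::finite, 'a) pre_digraph \<Rightarrow> complex ^ 'i \<Rightarrow> 'i \<Rightarrow> int" where
  "weight_coord \<Gamma> x i = int_of (form \<Gamma> x (simple_root i))"

definition dominant_weights :: "('i::finite, 'a) pre_digraph \<Rightarrow> (complex ^ 'i) set" where
  "dominant_weights \<Gamma> = {x \<in> weight_lattice \<Gamma>. \<forall>i. weight_coord \<Gamma> x i \<ge> 0}"

definition rho :: "('i::finite, 'a) pre_digraph \<Rightarrow> complex ^ 'i" where
  "rho \<Gamma> = (THE x. x \<in> weight_lattice \<Gamma> \<and> (\<forall>i. weight_coord \<Gamma> x i = 1))"

text \<open>The inclusion of \<open>Q\<^sub>+ = \<nat>\<^sup>I\<close> into \<open>\<hh>\<^sup>\<or>\<close>.\<close>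

definition of_root :: "nat ^ 'i::finite \<Rightarrow> complex ^ 'i" where
  "of_root \<alpha> = (\<Sum>i\<in>UNIV. of_nat (\<alpha> $ i) *s simple_root i)"

definition simple_reflection ::
  "('i::finite, 'a) pre_digraph \<Rightarrow> 'i \<Rightarrow> complex ^ 'i \<Rightarrow> complex ^ 'i" where
  "simple_reflection \<Gamma> i x = x - form \<Gamma> x (simple_root i) *s simple_root i"

definition reflection_word ::
  "('i::finite, 'a) pre_digraph \<Rightarrow> 'i list \<Rightarrow> complex ^ 'i \<Rightarrow> complex ^ 'i" where
  "reflection_word \<Gamma> is = foldr (\<lambda>i w. simple_reflection \<Gamma> i \<circ> w) is id"

text \<open>The group generated by the simple reflections; these are involutions, so words
  without inverses suffice.\<close>

definition weyl_group ::
  "('i::finite, 'a) pre_digraph \<Rightarrow> (complex ^ 'i \<Rightarrow> complex ^ 'i) set" where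
  "weyl_group \<Gamma> = range (reflection_word \<Gamma>)"

definition weyl_length ::
  "('i::finite, 'a) pre_digraph \<Rightarrow> (complex ^ 'i \<Rightarrow> complex ^ 'i) \<Rightarrow> nat" where
  "weyl_length \<Gamma> w = (LEAST l. \<exists>is. length is = l \<and> reflection_word \<Gamma> is = w)"

definition dot_action ::
  "('i::finite, 'a) pre_digraph \<Rightarrow> (complex ^ 'i \<Rightarrow> complex ^ 'i) \<Rightarrow> complex ^ 'i \<Rightarrow> complex ^ 'i"
where
  "dot_action \<Gamma> w x = w (x + rho \<Gamma>) - rho \<Gamma>"


section \<open>Fermionic forms\<close>

text \<open>The field \<open>\<rat>(q)\<close> and its generator.\<close>

type_synonym ratfun = "rat poly fract"

definition qvar :: ratfun where
  "qvar = Fract [:0, 1:] 1"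

definition qbracket :: "int \<Rightarrow> nat \<Rightarrow> ratfun" where
  "qbracket n m = (\<Prod>k=1..m. (1 - qvar powi (n + int k)) / (1 - qvar ^ k))"

definition weight_bracket ::
  "('i::finite, 'a) pre_digraph \<Rightarrow> complex ^ 'i \<Rightarrow> nat ^ 'i \<Rightarrow> ratfun" where
  "weight_bracket \<Gamma> \<nu> \<alpha> = (\<Prod>i\<in>UNIV. qbracket (weight_coord \<Gamma> \<nu> i) (\<alpha> $ i))"

definition tits_form :: "('i::finite, 'a) pre_digraph \<Rightarrow> complex ^ 'i \<Rightarrow> complex" where
  "tits_form \<Gamma> x = form \<Gamma> x x / 2"

text \<open>Partitions as sequences indexed from 0: \<open>t k\<close> is the part \<open>\<tau>\<^sub>k\<^sub>+\<^sub>1\<close>.\<close>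

definition partitions :: "(nat \<Rightarrow> nat) set" where
  "partitions = {t. antimono t \<and> (\<exists>N. \<forall>k\<ge>N. t k = 0)}"

text \<open>For a family \<open>\<tau>\<close> of partitions, \<open>part \<tau> k\<close> is the vector \<open>\<tau>\<^sub>k\<^sub>+\<^sub>1\<close>.\<close>

definition part :: "('i \<Rightarrow> nat \<Rightarrow> nat) \<Rightarrow> nat \<Rightarrow> nat ^ 'i::finite" where
  "part \<tau> k = (\<chi> i. \<tau> i k)"

text \<open>In both definitions below all but finitely many terms, respectively factors, are
  trivial. The sum over \<open>\<tau>\<close> is finite, as there are only finitely many families of
  partitions of a given total size. The natural number subtraction in \<open>fermionic_form\<close>
  never truncates, since partitions are decreasing.\<close>

definition total_size :: "('i \<Rightarrow> nat \<Rightarrow> nat) \<Rightarrow> nat ^ 'i::finite" where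
  "total_size \<tau> = Sum_any (part \<tau>)"

definition fermionic_form ::
  "('i::finite, 'a) pre_digraph \<Rightarrow> complex ^ 'i \<Rightarrow> complex ^ 'i \<Rightarrow> ratfun" where
  "fermionic_form \<Gamma> \<nu> \<mu> =
     (\<Sum>\<tau> \<in> {\<tau>. (\<forall>i. \<tau> i \<in> partitions) \<and> of_root (total_size \<tau>) = \<nu> - \<mu>}.
        qvar powi (- int_of (form \<Gamma> \<nu> (of_root (part \<tau> 0)))) *
        Prod_any (\<lambda>k. qvar powi int_of (tits_form \<Gamma> (of_root (part \<tau> k))) *
          weight_bracket \<Gamma> (\<nu> - (\<Sum>l\<le>k. of_root (part \<tau> l))) (part \<tau> k - part \<tau> (Suc k))))"

end

theory Submission
  imports Defs "HOL-Analysis.Cartesian_Space" "HOL-Computational_Algebra.Formal_Power_Series"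
    "HOL-Library.FuncSet"
begin

text \<open>It suffices to show that \<open>\<lambda> \<mapsto> s\<^sub>i \<cdot> \<lambda>\<close> changes the sign of the fermionic form, for every simple
  reflection. The expansion of \<open>[n, m]\<close> as the sum over \<open>s + t = m\<close> of \<open>q\<^sup>n\<^sup>s / ((q\<^sup>-\<^sup>1)\<^sub>s (q)\<^sub>t)\<close> turns the sum over
  families \<open>\<tau>\<close> into a sum over pairs \<open>\<pi> + \<sigma> = \<tau>\<close> in which \<open>\<pi>\<close> and \<open>\<sigma>\<close> are decoupled: the generating
  function of the fermionic forms is the product \<open>r\<^sub>\<nu>(q) r\<^sub>0(q\<^sup>-\<^sup>1)\<close> of two sums of Hua's type.

  Now fix a vertex \<open>i\<close> and all partitions at the other vertices, and let only \<open>\<pi>\<^sup>i\<close> and \<open>\<sigma>\<^sup>i\<close> vary. Each of the two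
  inner sums is then a generating function for homomorphisms into a fixed torsion module \<open>W\<close> (the modules at the
  neighbouring vertices and, for \<open>\<pi>\<close>, the framing \<open>\<nu>\<^sub>i\<close>), namely \<open>F\<^sub>W(x) E(x)\<close>, where \<open>F\<^sub>W\<close> counts the
  submodules of \<open>W\<close> by length and \<open>E\<close> does not depend on \<open>W\<close>. By duality \<open>F\<^sub>W\<close> is a palindromic polynomial
  whose degree is the length of \<open>W\<close>. Since \<open>E(x; q) E(x; q\<^sup>-\<^sup>1) = 1 - x\<close>, the product of the two inner sums is
  \<open>1 - x\<close> times a palindromic polynomial, hence antisymmetric, and its centre is fixed by the dot action
  of \<open>s\<^sub>i\<close>.\<close>

unbundle fps_syntax and no vec_syntax

section \<open>Power series\<close>

text \<open>The module counts are only a guide. So E is pinned down by the difference equation E(pX)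
  = (1 - pX) E(X), and F_W by two recursions that remove a box or a whole row from the diagram of W.
  Both come from splitting one factor, \<open>qtail\<close>, in two ways. Infinitely many columns
  are avoided twice: \<open>qtail\<close> sums in closed form all columns beyond the support of W,
  and each coefficient is computed with a cutoff L that bounds the sizes involved. The centre arises
  as follows. Off i only the total sizes \<alpha>_j are fixed, and the lengths of the two modules
  add up to d = n_i + sum_j e_ij \<alpha>_j for every choice of partitions. The factor 1 - x raises
  the degree to d + 1, and the dot action of s_i sends \<alpha>_i to d + 1 - \<alpha>_i. If this is
  negative, both fermionic forms vanish.\<close>

definition qpoch :: "'a::field \<Rightarrow> nat \<Rightarrow> 'a" where
  "qpoch p n = (\<Prod>k=1..n. 1 - p ^ k)"

lemma qpoch_0 [simp]: "qpoch p 0 = 1"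
  by (simp add: qpoch_def)

lemma qpoch_Suc: "qpoch p (Suc n) = (1 - p ^ Suc n) * qpoch p n"
  by (simp add: qpoch_def)

definition fps_linfactor :: "'a::field \<Rightarrow> 'a fps" where
  "fps_linfactor c = 1 - fps_const c * fps_X"

text \<open>The substitution X -> cX.\<close>

definition fps_scale :: "'a::field fps \<Rightarrow> 'a \<Rightarrow> 'a fps" where
  "fps_scale f c = Abs_fps (\<lambda>n. c ^ n * f $ n)"

lemma fps_scale_nth [simp]: "fps_scale f c $ n = c ^ n * f $ n"
  by (simp add: fps_scale_def)

lemma fps_scale_mult: "fps_scale (f * g) c = fps_scale f c * fps_scale g c"
proof (rule fps_ext)
  fix n
  have "c ^ n * (f $ i * g $ (n - i)) = c ^ i * f $ i * (c ^ (n - i) * g $ (n - i))" if "i \<le> n" for i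
    using that by (metis (no_types, opaque_lifting) le_add_diff_inverse mult.assoc mult.left_commute power_add)
  then show "fps_scale (f * g) c $ n = (fps_scale f c * fps_scale g c) $ n"
    by (auto simp: fps_mult_nth sum_distrib_left intro: sum.cong)
qed

lemma fps_scale_scale: "fps_scale (fps_scale f c) d = fps_scale f (c * d)"
  by (simp add: fps_eq_iff power_mult_distrib)

lemma fps_scale_1 [simp]: "fps_scale f 1 = f"
  by (simp add: fps_eq_iff)

lemma fps_scale_one [simp]: "fps_scale 1 c = 1"
  by (simp add: fps_eq_iff)

lemma fps_scale_const [simp]: "fps_scale (fps_const a) c = fps_const a"
  by (simp add: fps_eq_iff)

lemma fps_scale_X: "fps_scale fps_X c = fps_const c * fps_X"
  by (auto simp: fps_eq_iff fps_X_def)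

lemma fps_scale_X_power: "fps_scale (fps_X ^ n) c = fps_const (c ^ n) * fps_X ^ n"
  by (auto simp: fps_eq_iff fps_X_power_nth)

lemma fps_scale_diff: "fps_scale (f - g) c = fps_scale f c - fps_scale g c"
  by (simp add: fps_eq_iff algebra_simps)

lemma fps_scale_sum: "fps_scale (\<Sum>x\<in>A. f x) c = (\<Sum>x\<in>A. fps_scale (f x) c)"
  by (simp add: fps_eq_iff fps_sum_nth sum_distrib_left)

lemma fps_scale_linfactor: "fps_scale (fps_linfactor a) c = fps_linfactor (a * c)"
  by (auto simp: fps_linfactor_def fps_scale_diff fps_scale_mult fps_scale_X mult_ac simp flip: fps_const_mult)

lemma fps_linfactor_nth_0 [simp]: "fps_linfactor c $ 0 = 1"
  by (simp add: fps_linfactor_def)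

lemma fps_linfactor_nonzero [simp]: "fps_linfactor c \<noteq> 0"
  by (metis fps_linfactor_nth_0 fps_zero_nth zero_neq_one)

text \<open>The sum of \<open>X\<^sup>s * h s\<close> over all \<open>s\<close>.\<close>

definition fps_sumX :: "(nat \<Rightarrow> 'a::field fps) \<Rightarrow> 'a fps" where
  "fps_sumX h = Abs_fps (\<lambda>n. \<Sum>s\<le>n. h s $ (n - s))"

lemma fps_sumX_nth: "fps_sumX h $ n = (\<Sum>s\<le>n. h s $ (n - s))"
  by (simp add: fps_sumX_def)

lemma fps_sumX_add: "fps_sumX (\<lambda>s. f s + g s) = fps_sumX f + fps_sumX g"
  by (simp add: fps_eq_iff fps_sumX_nth sum.distrib)

lemma fps_sumX_shift:
  assumes "h 0 = 0"
  shows "fps_sumX h = fps_X * fps_sumX (\<lambda>s. h (Suc s))"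
proof (rule fps_ext)
  fix n show "fps_sumX h $ n = (fps_X * fps_sumX (\<lambda>s. h (Suc s))) $ n"
  proof (cases n)
    case (Suc m)
    then show ?thesis
      using assms by (simp add: fps_sumX_nth sum.atMost_Suc_shift del: sum.atMost_Suc)
  qed (use assms in \<open>simp add: fps_sumX_nth\<close>)
qed

lemma fps_sumX_nth_trunc:
  assumes "n \<le> N"
  shows "fps_sumX h $ n = (\<Sum>s\<le>N. fps_X ^ s * h s) $ n"
proof -
  have "(\<Sum>s\<le>N. fps_X ^ s * h s) $ n = (\<Sum>s\<le>N. if s \<le> n then h s $ (n - s) else 0)"
    by (auto simp: fps_sum_nth fps_X_power_mult_nth intro: sum.cong)
  also have "\<dots> = (\<Sum>s\<le>n. h s $ (n - s))"
    using assms by (intro sum.mono_neutral_cong_right) auto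
  finally show ?thesis
    by (simp add: fps_sumX_nth)
qed

lemma fps_sumX_mult: "fps_sumX (\<lambda>s. g * h s) = g * fps_sumX h"
proof (rule fps_ext)
  fix n
  have "fps_sumX (\<lambda>s. g * h s) $ n = (\<Sum>s\<le>n. fps_X ^ s * (g * h s)) $ n"
    by (rule fps_sumX_nth_trunc) simp
  also have "(\<Sum>s\<le>n. fps_X ^ s * (g * h s)) = g * (\<Sum>s\<le>n. fps_X ^ s * h s)"
    by (simp add: sum_distrib_left mult.left_commute)
  also have "\<dots> $ n = (g * fps_sumX h) $ n"
    unfolding fps_mult_nth by (intro sum.cong refl arg_cong2[where f = "(*)"])
      (simp add: fps_sumX_nth_trunc[where N = n])
  finally show "fps_sumX (\<lambda>s. g * h s) $ n = (g * fps_sumX h) $ n" .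
qed

lemma fps_sumX_scale: "fps_scale (fps_sumX h) c = fps_sumX (\<lambda>s. fps_const (c ^ s) * fps_scale (h s) c)"
  by (simp add: fps_eq_iff fps_sumX_nth sum_distrib_left flip: power_add mult.assoc)

section \<open>Sums over one partition\<close>

text \<open>The conditions are stable under \<open>p\<close> -> \<open>inverse p\<close>, so both
  Hua sums live in the same locale.\<close>

locale qparam =
  fixes p :: "'a::field"
  assumes p_nonzero: "p \<noteq> 0" and p_not_root: "k \<ge> 1 \<Longrightarrow> p ^ k \<noteq> 1"
begin

lemma qpoch_nonzero [simp]: "qpoch p n \<noteq> 0"
  using p_not_root by (auto simp: qpoch_def)

text \<open>This is (p;p)_t (cpX;p)_t. Keeping the denominator separate lets
  \<open>qtail_cross\<close> reduce identities between inverses to identities between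
  products.\<close>

definition qtail_denom :: "'a \<Rightarrow> nat \<Rightarrow> 'a fps" where
  "qtail_denom c t = fps_const (qpoch p t) * (\<Prod>k=1..t. fps_linfactor (c * p ^ k))"

text \<open>\<open>qtail c t\<close> sums the contributions of the columns \<open>t \<ge> \<tau>\<^sub>1 \<ge> \<tau>\<^sub>2 \<ge> \<dots>\<close> of all partitions below a
  column \<open>t\<close>, with \<open>X\<close> rescaled by \<open>c\<close>: it is the fixed point of the operator \<open>step c 0\<close> that sums over one
  column (lemma \<open>step_qtail\<close>, a form of Cauchy's identity).\<close>

definition qtail :: "'a \<Rightarrow> nat \<Rightarrow> 'a fps" where
  "qtail c t = inverse (qtail_denom c t)"

lemma qtail_denom_nth_0: "qtail_denom c t $ 0 \<noteq> 0"
proof -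
  have "(\<Prod>k=1..t. fps_linfactor (c * p ^ k)) $ 0 = 1"
    by (induction t) simp_all
  then show ?thesis
    by (simp add: qtail_denom_def)
qed

lemma qtail_denom_tail: "qtail_denom c t * qtail c t = 1"
  unfolding qtail_def by (rule inverse_mult_eq_1'[OF qtail_denom_nth_0])

lemma qtail_nth_0: "qtail c t $ 0 = 1 / qpoch p t"
proof -
  have "(\<Prod>k=1..t. fps_linfactor (c * p ^ k)) $ 0 = 1"
    by (induction t) simp_all
  then show ?thesis
    by (simp add: qtail_def qtail_denom_def inverse_eq_divide)
qed

lemma qtail_0 [simp]: "qtail c 0 = 1"
  by (simp add: qtail_def qtail_denom_def)

lemma qtail_cross:
  assumes "qtail_denom c' t' * A = qtail_denom c t * B"
  shows "A * qtail c t = B * qtail c' t'"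
proof -
  have "A * qtail c t = A * qtail c t * (qtail_denom c' t' * qtail c' t')"
    by (simp add: qtail_denom_tail)
  also have "\<dots> = (qtail_denom c t * qtail c t) * (B * qtail c' t')"
    using assms by (metis (no_types, lifting) mult.assoc mult.commute)
  finally show ?thesis
    by (simp add: qtail_denom_tail)
qed

lemma qtail_denom_Suc:
  "qtail_denom c (Suc t) = fps_const (1 - p ^ Suc t) * fps_linfactor (c * p ^ Suc t) * qtail_denom c t"
  by (simp add: qtail_denom_def qpoch_Suc mult_ac flip: fps_const_mult)

lemma qtail_scale: "qtail c t = fps_scale (qtail 1 t) c"
proof -
  have "fps_scale (qtail_denom 1 t) c = qtail_denom c t"
  proof (induction t)
    case 0
    then show ?case by (simp add: qtail_denom_def)
  next
    case (Suc t)
    then show ?case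
      by (simp add: qtail_denom_Suc fps_scale_mult fps_scale_linfactor mult_ac)
  qed
  then show ?thesis
    using qtail_cross[of 1 t 1 1 t 1] qtail_denom_tail[of c t]
      arg_cong[OF qtail_denom_tail[of 1 t], of "\<lambda>f. fps_scale f c"]
    by (simp add: fps_scale_mult) (metis fps_scale_mult mult.left_commute mult_1_right)
qed

text \<open>Replacing c by c/p moves the window of linear factors by one place: the factor at
  \<open>c\<close> enters and the one at \<open>c * p ^ t\<close> leaves. With
  \<open>qtail_shift_down\<close>, which drops the first factor and lowers t, this is the source of
  all later functional equations.\<close>

lemma qtail_shift_up: "fps_linfactor (c * p ^ t) * qtail c t = fps_linfactor c * qtail (c / p) t"
proof (rule qtail_cross)
  show "qtail_denom (c / p) t * fps_linfactor (c * p ^ t) = qtail_denom c t * fps_linfactor c"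
  proof (induction t)
    case 0
    then show ?case by (simp add: qtail_denom_def)
  next
    case (Suc t)
    have "c / p * p ^ Suc t = c * p ^ t"
      using p_nonzero by simp
    then show ?case
      using Suc by (simp add: qtail_denom_Suc mult_ac)
  qed
qed

lemma qtail_shift_down:
  "fps_const (1 - p ^ Suc t) * fps_linfactor (c * p) * qtail c (Suc t) = qtail (c * p) t"
proof -
  have "qtail_denom c (Suc t) = fps_const (1 - p ^ Suc t) * fps_linfactor (c * p) * qtail_denom (c * p) t"
  proof (induction t)
    case 0
    then show ?case by (simp add: qtail_denom_def qpoch_def)
  next
    case (Suc t)
    have "qtail_denom c (Suc (Suc t)) = fps_const (1 - p ^ Suc (Suc t)) *
        fps_linfactor (c * p ^ Suc (Suc t)) * qtail_denom c (Suc t)"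
      by (rule qtail_denom_Suc)
    also note Suc
    finally show ?case
      by (subst (2) qtail_denom_Suc) (simp only: mult_ac power_Suc)
  qed
  then show ?thesis
    using qtail_cross[of "c * p" t "fps_const (1 - p ^ Suc t) * fps_linfactor (c * p)" c "Suc t" 1]
    by (simp add: mult_ac)
qed

text \<open>The factors come from the automorphism group of a torsion module V over a field of size
  1/p: for column heights s_k, 1/|Aut V| is the product of p^(s_k^2) / (p;p)_(s_k - s_(k+1)), and
  p^(-w s) is the contribution of one column to |Hom(V, W)|. The scalar \<open>y\<close> carries
  rescalings of X.\<close>

definition step :: "'a \<Rightarrow> nat \<Rightarrow> (nat \<Rightarrow> 'a fps) \<Rightarrow> nat \<Rightarrow> 'a fps" where
  "step y w f t = (\<Sum>s\<le>t. fps_const ((y / p ^ w) ^ s * p ^ s\<^sup>2 / qpoch p (t - s)) * fps_X ^ s * f s)"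

lemma step_0 [simp]: "step y w f 0 = f 0"
  by (simp add: step_def)

lemma step_shift:
  assumes "f 0 = 0" and "\<And>t. f (Suc t) = g t"
  shows "step y w f (Suc t) = fps_const (y * p / p ^ w) * fps_X * step (y * p\<^sup>2) w g t"
proof -
  have e: "(y / p ^ w) ^ Suc s * p ^ (Suc s)\<^sup>2 = (y * p / p ^ w) * ((y * p\<^sup>2 / p ^ w) ^ s * p ^ s\<^sup>2)" for s
    by (simp add: power2_eq_square power_mult_distrib power_add field_simps p_nonzero flip: power_mult)
  have "step y w f (Suc t) =
      (\<Sum>s\<le>t. fps_const ((y / p ^ w) ^ Suc s * p ^ (Suc s)\<^sup>2 / qpoch p (t - s)) * fps_X ^ Suc s * g s)"
    unfolding step_def by (subst sum.atMost_Suc_shift) (simp add: assms)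
  also have "\<dots> = fps_const (y * p / p ^ w) * fps_X * step (y * p\<^sup>2) w g t"
    unfolding step_def sum_distrib_left e times_divide_eq_right[symmetric]
    by (intro sum.cong refl) (simp only: mult_ac fps_const_mult[symmetric] power_Suc)
  finally show ?thesis .
qed

text \<open>Combinatorially, a partition with parts at most t is cut along its Durfee square of side
  s. The induction on t is for all c at once, because its second use is at
  \<open>c * p\<close>.\<close>

lemma step_qtail: "step c 0 (qtail c) t = qtail c t"
proof (induction t arbitrary: c)
  case 0
  then show ?case by simp
next
  case (Suc t)
  let ?f = "\<lambda>s. fps_const (1 - p ^ s) * qtail c s"
  \<comment> \<open>This is 1 - p^(t+1) = (1 - p^(t+1-s)) + p^(t+1-s) (1 - p^s), as in the q-Pascal
    rule. The first part cancels a factor of the denominator and gives the sum for t.\<close>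
  have coeff: "(1 - p ^ Suc t) * (a / qpoch p (Suc t - s)) =
      (if s \<le> t then a / qpoch p (t - s) else 0) + p ^ (Suc t - s) * (1 - p ^ s) * (a / qpoch p (Suc t - s))"
    if "s \<le> Suc t" for s a
  proof (cases "s = Suc t")
    case False
    then obtain d where d: "t = s + d"
      using \<open>s \<le> Suc t\<close> by (metis le_Suc_eq nat_le_iff_add)
    have "1 - p ^ Suc d \<noteq> 0"
      using p_not_root[of "Suc d"] by simp
    moreover have "(1 - p ^ Suc t) = (1 - p ^ Suc d) + p ^ Suc d * (1 - p ^ s)"
      unfolding d by (simp add: power_add algebra_simps)
    moreover have "Suc t - s = Suc d" "t - s = d" "s \<le> t"
      by (simp_all add: d)
    moreover have "(P + r) * (a / (P * Q)) = a / Q + r * (a / (P * Q))" if "P \<noteq> 0" "Q \<noteq> 0" for P Q r :: 'a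
      using that by (simp add: field_simps)
    ultimately show ?thesis
      by (simp only: qpoch_Suc if_True qpoch_nonzero not_False_eq_True)
  qed simp
  have pw: "(c::'a) ^ s * p ^ s\<^sup>2 * p ^ (Suc t - s) = p ^ Suc t * ((c / p) ^ s * p ^ s\<^sup>2)" if "s \<le> Suc t" for c s
    using that p_nonzero by (simp add: power_divide power_diff)
  have "fps_const (1 - p ^ Suc t) * step c 0 (qtail c) (Suc t) =
      (\<Sum>s\<le>Suc t. fps_const (if s \<le> t then c ^ s * p ^ s\<^sup>2 / qpoch p (t - s) else 0) * fps_X ^ s * qtail c s) +
      (\<Sum>s\<le>Suc t. fps_const (p ^ (Suc t - s) * (1 - p ^ s) * (c ^ s * p ^ s\<^sup>2 / qpoch p (Suc t - s))) * fps_X ^ s * qtail c s)"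
    unfolding step_def sum_distrib_left sum.distrib[symmetric]
  proof (intro sum.cong refl)
    fix s assume "s \<in> {..Suc t}"
    then have "s \<le> Suc t" by simp
    have "fps_const (1 - p ^ Suc t) * (fps_const ((c / p ^ 0) ^ s * p ^ s\<^sup>2 / qpoch p (Suc t - s)) * fps_X ^ s * qtail c s)
      = fps_const ((1 - p ^ Suc t) * (c ^ s * p ^ s\<^sup>2 / qpoch p (Suc t - s))) * fps_X ^ s * qtail c s"
      unfolding fps_const_mult[symmetric] by (simp only: mult_ac power_0 div_by_1)
    then show "fps_const (1 - p ^ Suc t) * (fps_const ((c / p ^ 0) ^ s * p ^ s\<^sup>2 / qpoch p (Suc t - s)) * fps_X ^ s * qtail c s)
      = fps_const (if s \<le> t then c ^ s * p ^ s\<^sup>2 / qpoch p (t - s) else 0) * fps_X ^ s * qtail c s +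
      fps_const (p ^ (Suc t - s) * (1 - p ^ s) * (c ^ s * p ^ s\<^sup>2 / qpoch p (Suc t - s))) * fps_X ^ s * qtail c s"
      unfolding coeff[OF \<open>s \<le> Suc t\<close>, of "c ^ s * p ^ s\<^sup>2"]
      by (simp only: distrib_right fps_const_add[symmetric])
  qed
  also have "(\<Sum>s\<le>Suc t. fps_const (if s \<le> t then c ^ s * p ^ s\<^sup>2 / qpoch p (t - s) else 0) * fps_X ^ s * qtail c s)
     = step c 0 (qtail c) t"
    unfolding step_def sum.atMost_Suc by simp
  also have "(\<Sum>s\<le>Suc t. fps_const (p ^ (Suc t - s) * (1 - p ^ s) * (c ^ s * p ^ s\<^sup>2 / qpoch p (Suc t - s))) * fps_X ^ s * qtail c s)
     = fps_const (p ^ Suc t) * step (c / p) 0 ?f (Suc t)"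
    unfolding step_def sum_distrib_left
  proof (intro sum.cong refl)
    fix s assume "s \<in> {..Suc t}"
    then have "s \<le> Suc t" by simp
    have "p ^ (Suc t - s) * (1 - p ^ s) * (c ^ s * p ^ s\<^sup>2 / qpoch p (Suc t - s)) =
        p ^ Suc t * ((c / p / p ^ 0) ^ s * p ^ s\<^sup>2 / qpoch p (Suc t - s)) * (1 - p ^ s)"
      using pw[OF \<open>s \<le> Suc t\<close>, of c] by (simp add: mult_ac)
    then show "fps_const (p ^ (Suc t - s) * (1 - p ^ s) * (c ^ s * p ^ s\<^sup>2 / qpoch p (Suc t - s))) * fps_X ^ s * qtail c s
      = fps_const (p ^ Suc t) * (fps_const ((c / p / p ^ 0) ^ s * p ^ s\<^sup>2 / qpoch p (Suc t - s)) *
          fps_X ^ s * (fps_const (1 - p ^ s) * qtail c s))"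
      by (simp only: mult_ac fps_const_mult[symmetric])
  qed
  finally have 1: "fps_const (1 - p ^ Suc t) * step c 0 (qtail c) (Suc t) =
      qtail c t + fps_const (p ^ Suc t) * step (c / p) 0 ?f (Suc t)"
    using Suc.IH[of c] by simp
  \<comment> \<open>The factor 1 - p^s removes s = 0. Shifting s by one turns c/p into c/p * p^2 =
    cp, which is where the induction hypothesis applies again.\<close>
  have "step (c / p) 0 (\<lambda>s. fps_linfactor (c * p) * ?f s) (Suc t) =
     fps_const (c / p * p / p ^ 0) * fps_X * step (c / p * p\<^sup>2) 0 (qtail (c * p)) t"
    by (rule step_shift) (simp_all only: power_0 diff_self fps_const_0_eq_0 mult_zero_left mult_zero_right
        qtail_shift_down[symmetric] mult_ac)
  also have "step (c / p * p\<^sup>2) 0 (qtail (c * p)) t = qtail (c * p) t"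
    using Suc.IH[of "c * p"] p_nonzero by (simp add: power2_eq_square)
  also have "step (c / p) 0 (\<lambda>s. fps_linfactor (c * p) * ?f s) (Suc t) = fps_linfactor (c * p) * step (c / p) 0 ?f (Suc t)"
    unfolding step_def sum_distrib_left by (simp only: mult_ac)
  finally have 2: "fps_linfactor (c * p) * step (c / p) 0 ?f (Suc t) = fps_const c * fps_X * qtail (c * p) t"
    using p_nonzero by simp
  have "fps_const (1 - p ^ Suc t) * fps_linfactor (c * p) * step c 0 (qtail c) (Suc t)
     = fps_linfactor (c * p) * (fps_const (1 - p ^ Suc t) * step c 0 (qtail c) (Suc t))"
    by (simp only: mult_ac)
  also have "\<dots> = fps_linfactor (c * p) * qtail c t + fps_const (p ^ Suc t) * (fps_const c * fps_X * qtail (c * p) t)"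
    unfolding 1 2[symmetric] by (simp only: distrib_left mult_ac)
  also have "fps_linfactor (c * p) * qtail c t = fps_linfactor (c * p ^ Suc t) * qtail (c * p) t"
    using qtail_shift_up[of "c * p" t] p_nonzero by (simp add: mult_ac)
  also have "fps_linfactor (c * p ^ Suc t) * qtail (c * p) t + fps_const (p ^ Suc t) * (fps_const c * fps_X * qtail (c * p) t)
    = qtail (c * p) t"
    unfolding fps_linfactor_def fps_const_mult[symmetric]
    by (simp only: left_diff_distrib mult_1_left mult.assoc)
      (simp only: mult.left_commute diff_add_cancel)
  also have "\<dots> = fps_const (1 - p ^ Suc t) * fps_linfactor (c * p) * qtail c (Suc t)"
    by (rule qtail_shift_down[symmetric])
  finally show ?case
    using p_not_root[of "Suc t"] by (simp add: fps_const_eq_0_iff)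
qed

section \<open>Iterating over finitely many columns\<close>

definition steps :: "'a \<Rightarrow> nat list \<Rightarrow> (nat \<Rightarrow> 'a fps) \<Rightarrow> nat \<Rightarrow> 'a fps" where
  "steps y ws B = foldr (step y) ws B"

lemma steps_Nil [simp]: "steps y [] B = B"
  and steps_Cons [simp]: "steps y (w # ws) B = step y w (steps y ws B)"
  and steps_append: "steps y (us @ vs) B = steps y us (steps y vs B)"
  by (simp_all add: steps_def)

lemma step_add: "step y w (\<lambda>s. f s + g s) t = step y w f t + step y w g t"
  by (simp add: step_def sum.distrib algebra_simps)

lemma step_mult: "step y w (\<lambda>s. a * f s) t = a * step y w f t"
  by (simp add: step_def sum_distrib_left mult_ac)

lemma steps_add: "steps y ws (\<lambda>s. f s + g s) = (\<lambda>t. steps y ws f t + steps y ws g t)"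
  by (induction ws) (simp_all add: step_add[abs_def])

lemma steps_mult: "steps y ws (\<lambda>s. a * f s) = (\<lambda>t. a * steps y ws f t)"
  by (induction ws) (simp_all add: step_mult[abs_def])

lemma step_scale: "fps_scale (step y w f t) c = step (y * c) w (\<lambda>s. fps_scale (f s) c) t"
  unfolding step_def fps_scale_sum fps_scale_mult fps_scale_const fps_scale_X_power
proof (intro sum.cong refl)
  fix s
  have "(y * c / p ^ w) ^ s * p ^ s\<^sup>2 / qpoch p (t - s) = ((y / p ^ w) ^ s * p ^ s\<^sup>2 / qpoch p (t - s)) * c ^ s"
    by (simp add: power_mult_distrib power_divide)
  then show "fps_const ((y / p ^ w) ^ s * p ^ s\<^sup>2 / qpoch p (t - s)) * (fps_const (c ^ s) * fps_X ^ s) * fps_scale (f s) c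
     = fps_const ((y * c / p ^ w) ^ s * p ^ s\<^sup>2 / qpoch p (t - s)) * fps_X ^ s * fps_scale (f s) c"
    unfolding fps_const_mult[symmetric] by (simp only: mult_ac fps_const_mult[symmetric])
qed

lemma steps_scale: "fps_scale (steps y ws B t) c = steps (y * c) ws (\<lambda>s. fps_scale (B s) c) t"
  by (induction ws arbitrary: t) (simp_all add: step_scale)

lemma step_map_Suc: "step y (Suc w) = step (y / p) w"
  by (simp add: step_def fun_eq_iff divide_divide_eq_left)

lemma steps_map_Suc: "steps y (map Suc ws) B = steps (y / p) ws B"
  by (induction ws) (simp_all add: step_map_Suc)

lemma step_lower: "step y w f = step (y / p) w (\<lambda>s. fps_const (p ^ s) * f s)"
proof
  fix t
  have e: "(y / p / p ^ w) ^ s * p ^ s\<^sup>2 / qpoch p (t - s) * p ^ s = (y / p ^ w) ^ s * p ^ s\<^sup>2 / qpoch p (t - s)" for s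
    using p_nonzero by (simp add: power_divide power_mult_distrib)
  show "step y w f t = step (y / p) w (\<lambda>s. fps_const (p ^ s) * f s) t"
    unfolding step_def
    by (intro sum.cong refl, subst e[symmetric]) (simp only: fps_const_mult[symmetric] mult_ac)
qed

text \<open>Raising every entry amounts to dividing y by p. For the last entry, which is not raised,
  the surplus p^(-s) is cancelled by a factor p^s in the bottom series.\<close>

lemma steps_lower:
  "steps y (map Suc us @ [w]) B = steps (y / p) (us @ [w]) (\<lambda>s. fps_const (p ^ s) * B s)"
  by (simp add: steps_append steps_map_Suc step_lower[of y])

text \<open>If the bottom series vanishes at 0, no column can be empty, and each can lose one box.
  Since (s + 1)^2 = s^2 + 2s + 1, this multiplies y by p^2 and leaves a factor yp / p^w and one X
  per column.\<close>

lemma steps_shift: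
  assumes "B 0 = 0" and "\<And>t. B (Suc t) = C t"
  shows "steps y ws B 0 = 0"
    and "steps y ws B (Suc t) =
      fps_const ((y * p) ^ length ws / p ^ sum_list ws) * fps_X ^ length ws * steps (y * p\<^sup>2) ws C t"
proof -
  show z: "steps y ws B 0 = 0" for ws
    by (induction ws) (simp_all add: assms)
  show "steps y ws B (Suc t) =
      fps_const ((y * p) ^ length ws / p ^ sum_list ws) * fps_X ^ length ws * steps (y * p\<^sup>2) ws C t"
  proof (induction ws arbitrary: t)
    case (Cons w ws)
    let ?k = "fps_const ((y * p) ^ length ws / p ^ sum_list ws) * fps_X ^ length ws"
    have "steps y (w # ws) B (Suc t) = fps_const (y * p / p ^ w) * fps_X *
        step (y * p\<^sup>2) w (\<lambda>t. ?k * steps (y * p\<^sup>2) ws C t) t"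
      unfolding steps_Cons by (rule step_shift) (simp_all add: z Cons.IH)
    also have "\<dots> = (fps_const (y * p / p ^ w) * fps_const ((y * p) ^ length ws / p ^ sum_list ws)) *
        fps_X ^ Suc (length ws) * steps (y * p\<^sup>2) (w # ws) C t"
      unfolding step_mult steps_Cons by (simp only: mult_ac power_Suc)
    also have "fps_const (y * p / p ^ w) * fps_const ((y * p) ^ length ws / p ^ sum_list ws) =
        fps_const ((y * p) ^ length (w # ws) / p ^ sum_list (w # ws))"
      by (simp add: power_add)
    finally show ?case
      by simp
  qed (simp add: assms)
qed

text \<open>In contrast to \<open>steps\<close>, the first column is unbounded, as if \<open>t = \<infinity>\<close> and without the
  denominator \<open>qpoch p (t - s)\<close>. The value on the empty list is junk.\<close>

fun total :: "'a \<Rightarrow> nat list \<Rightarrow> (nat \<Rightarrow> 'a fps) \<Rightarrow> 'a fps" where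
  "total y [] B = 0"
| "total y (w # ws) B = fps_sumX (\<lambda>s. fps_const ((y / p ^ w) ^ s * p ^ s\<^sup>2) * steps y ws B s)"

lemma total_add: "total y ws (\<lambda>s. f s + g s) = total y ws f + total y ws g"
  by (cases ws) (simp_all add: steps_add distrib_left fps_sumX_add)

lemma total_mult: "total y ws (\<lambda>s. a * f s) = a * total y ws f"
  by (cases ws) (simp_all add: steps_mult mult.left_commute[of _ a] fps_sumX_mult)

lemma total_append: "us \<noteq> [] \<Longrightarrow> total y (us @ vs) B = total y us (steps y vs B)"
  by (cases us) (simp_all add: steps_append)

lemma total_scale: "fps_scale (total y ws B) c = total (y * c) ws (\<lambda>s. fps_scale (B s) c)"
proof (cases ws)
  case (Cons w us)
  have eq: "fps_const (c ^ s) * (fps_const ((y / p ^ w) ^ s * p ^ s\<^sup>2) * f) =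
      fps_const ((y * c / p ^ w) ^ s * p ^ s\<^sup>2) * f" for s f
  proof -
    have "(y * c / p ^ w) ^ s * p ^ s\<^sup>2 = c ^ s * ((y / p ^ w) ^ s * p ^ s\<^sup>2)"
      by (simp add: power_mult_distrib power_divide)
    then show ?thesis
      by (simp only: mult.assoc fps_const_mult[symmetric])
  qed
  then show ?thesis
    unfolding Cons total.simps fps_sumX_scale fps_scale_mult fps_scale_const steps_scale by presburger
qed (simp add: fps_eq_iff)

lemma total_map_Suc: "total y (map Suc ws) B = total (y / p) ws B"
  by (cases ws) (simp_all add: steps_map_Suc divide_divide_eq_left)

lemma total_lower:
  "total y (map Suc us @ [w]) B = total (y / p) (us @ [w]) (\<lambda>s. fps_const (p ^ s) * B s)"
proof (cases us)
  case Nil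
  have e: "(y / p / p ^ w) ^ s * p ^ s\<^sup>2 * p ^ s = (y / p ^ w) ^ s * p ^ s\<^sup>2" for s
    using p_nonzero by (simp add: power_divide power_mult_distrib)
  have eq: "fps_const ((y / p / p ^ w) ^ s * p ^ s\<^sup>2) * (fps_const (p ^ s) * f) = fps_const ((y / p ^ w) ^ s * p ^ s\<^sup>2) * f"
    for s f
    by (subst e[symmetric]) (simp only: fps_const_mult[symmetric] mult_ac)
  show ?thesis
    unfolding Nil list.map append_Nil total.simps steps_Nil eq ..
next
  case (Cons u us')
  then show ?thesis
    by (simp add: steps_lower divide_divide_eq_left)
qed

lemma total_shift:
  assumes "B 0 = 0" and "\<And>t. B (Suc t) = C t"
  shows "total y ws B =
      fps_const ((y * p) ^ length ws / p ^ sum_list ws) * fps_X ^ length ws * total (y * p\<^sup>2) ws C"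
proof (cases ws)
  case (Cons w us)
  let ?k = "fps_const ((y * p) ^ length ws / p ^ sum_list ws) * fps_X ^ length us"
  have e: "(y / p ^ w) ^ Suc s * p ^ (Suc s)\<^sup>2 * ((y * p) ^ length us / p ^ sum_list us) =
      (y * p) ^ length ws / p ^ sum_list ws * ((y * p\<^sup>2 / p ^ w) ^ s * p ^ s\<^sup>2)" for s
    by (simp add: Cons power2_eq_square power_mult_distrib power_add field_simps p_nonzero flip: power_mult)
  have e': "fps_const ((y / p ^ w) ^ Suc s * p ^ (Suc s)\<^sup>2) * steps y us B (Suc s) =
      ?k * (fps_const ((y * p\<^sup>2 / p ^ w) ^ s * p ^ s\<^sup>2) * steps (y * p\<^sup>2) us C s)" for s
  proof -
    have "fps_const ((y / p ^ w) ^ Suc s * p ^ (Suc s)\<^sup>2) * steps y us B (Suc s) =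
      fps_const ((y / p ^ w) ^ Suc s * p ^ (Suc s)\<^sup>2 * ((y * p) ^ length us / p ^ sum_list us)) *
        (fps_X ^ length us * steps (y * p\<^sup>2) us C s)"
      unfolding steps_shift(2)[of B C, OF assms] fps_const_mult[symmetric] by (simp only: mult.assoc)
    then show ?thesis
      unfolding e fps_const_mult[symmetric] by (simp only: mult_ac)
  qed
  have "total y ws B = fps_X * fps_sumX (\<lambda>s. fps_const ((y / p ^ w) ^ Suc s * p ^ (Suc s)\<^sup>2) * steps y us B (Suc s))"
    unfolding Cons total.simps
    by (rule fps_sumX_shift) (simp add: steps_shift(1)[of B C, OF assms])
  also have "\<dots> = fps_X * (?k * total (y * p\<^sup>2) ws C)"
    unfolding e' Cons total.simps fps_sumX_mult ..
  finally show ?thesis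
    by (simp add: Cons mult_ac)
qed simp

section \<open>Counting homomorphisms into a torsion module\<close>

text \<open>If \<open>1 / p\<close> is the size of a finite field and \<open>ws\<close> lists the columns of the type of a finite torsion
  \<open>k[[t]]\<close>-module \<open>W\<close>, the coefficient of \<open>X\<^sup>n\<close> is the sum of \<open>|Hom(V, W)| / |Aut V|\<close> over the
  modules \<open>V\<close> of length \<open>n\<close>.\<close>

definition hom_series :: "nat list \<Rightarrow> 'a fps" where
  "hom_series ws = total 1 ws (qtail 1)"

lemma hom_series_scale: "fps_scale (hom_series ws) c = total c ws (qtail c)"
  unfolding hom_series_def total_scale by (simp add: qtail_scale[of c, symmetric])

text \<open>By \<open>step_qtail\<close>, \<open>qtail 1\<close> already contains every column
  beyond the support of W. A nonempty \<open>us\<close> keeps clear of the junk value of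
  \<open>total\<close>.\<close>

lemma hom_series_append_0: "us \<noteq> [] \<Longrightarrow> hom_series (us @ [0]) = hom_series us"
  using ext[of "step 1 0 (qtail 1)" "qtail 1", OF step_qtail] by (simp add: hom_series_def total_append)

lemma hom_series_nth_0: "ws \<noteq> [] \<Longrightarrow> hom_series ws $ 0 = 1"
proof (cases ws)
  case (Cons w us)
  have "steps 1 us (qtail 1) 0 = 1"
    by (induction us) simp_all
  then show ?thesis
    by (simp add: hom_series_def Cons fps_sumX_nth)
qed simp

text \<open>In front of \<open>qtail 1 s\<close>, split 1 = p^s X + (1 - p^s X). The power p^s is
  exactly the correction by which \<open>total_lower\<close> leaves the last column unraised, and
  \<open>qtail_shift_up\<close> trades the other factor for a rescaling of X.\<close>

lemma hom_series_up:
  "hom_series (map Suc (us @ [w])) = fps_X * hom_series (map Suc us @ [w]) + fps_linfactor 1 * fps_scale (hom_series (us @ [w])) (1 / p)"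
proof -
  have eq: "qtail 1 s = fps_X * (fps_const (p ^ s) * qtail 1 s) + fps_linfactor 1 * qtail (1 / p) s" for s
  proof -
    have "qtail 1 s = fps_X * (fps_const (p ^ s) * qtail 1 s) + fps_linfactor (1 * p ^ s) * qtail 1 s"
      by (simp add: fps_linfactor_def algebra_simps)
    then show ?thesis
      unfolding qtail_shift_up .
  qed
  have "hom_series (map Suc (us @ [w])) = total (1 / p) (us @ [w])
      (\<lambda>s. fps_X * (fps_const (p ^ s) * qtail 1 s) + fps_linfactor 1 * qtail (1 / p) s)"
    unfolding hom_series_def total_map_Suc eq[symmetric] ..
  then show ?thesis
    unfolding total_add total_mult by (simp add: hom_series_def total_lower hom_series_scale[unfolded hom_series_def])
qed

text \<open>Now split 1 = p^s + (1 - p^s). The second part vanishes at s = 0, so every column of V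
  loses a box by \<open>total_shift\<close>, and \<open>qtail_shift_down\<close> identifies the
  rest; multiplying by \<open>fps_linfactor p\<close> clears its denominator. As y = 1/p here, the
  power (yp)^length is 1.\<close>

lemma hom_series_down:
  "fps_linfactor p * hom_series (map Suc (us @ [w])) = fps_linfactor p * hom_series (map Suc us @ [w]) +
     fps_const (1 / p ^ sum_list (us @ [w])) * fps_X ^ Suc (length us) * fps_scale (hom_series (us @ [w])) p"
proof -
  let ?B = "\<lambda>s. fps_linfactor p * (fps_const (1 - p ^ s) * qtail 1 s)"
  have eq: "fps_linfactor p * qtail 1 s = fps_linfactor p * (fps_const (p ^ s) * qtail 1 s) + ?B s" for s
    by (simp add: algebra_simps flip: fps_const_sub)
  have "fps_linfactor p * hom_series (map Suc (us @ [w])) = total (1 / p) (us @ [w]) (\<lambda>s. fps_linfactor p * qtail 1 s)"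
    unfolding hom_series_def total_map_Suc total_mult ..
  also have "\<dots> = fps_linfactor p * hom_series (map Suc us @ [w]) + total (1 / p) (us @ [w]) ?B"
    unfolding eq total_add by (simp add: total_mult hom_series_def total_lower)
  also have "total (1 / p) (us @ [w]) ?B = fps_const ((1 / p * p) ^ length (us @ [w]) / p ^ sum_list (us @ [w])) *
      fps_X ^ length (us @ [w]) * total (1 / p * p\<^sup>2) (us @ [w]) (qtail p)"
    by (rule total_shift) (use qtail_shift_down[of _ 1] in \<open>simp_all add: mult_ac\<close>)
  finally show ?thesis
    using p_nonzero by (simp add: hom_series_scale power2_eq_square)
qed

text \<open>The series E of the overview, which sums 1/|Aut V|. The module W = 0 is listed as
  \<open>[0]\<close>, since \<open>total\<close> has no meaningful value on the empty list.\<close>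

definition aut_series :: "'a fps" where
  "aut_series = hom_series [0]"

lemma aut_series_nth_0 [simp]: "aut_series $ 0 = 1"
  by (simp add: aut_series_def hom_series_nth_0)

lemma aut_series_scale_p: "fps_scale aut_series p = fps_linfactor p * aut_series"
proof -
  \<comment> \<open>The defect of the claimed equation, with X rescaled by 1/p. Eliminating
    \<open>hom_series [1]\<close> between the two recursions gives (1 - pX) h(X) = -X h(pX), so the
    constant term of h is 0 and each further coefficient is a multiple of the preceding one.\<close>
  define h where "h = fps_linfactor 1 * fps_scale aut_series (1 / p) - aut_series"
  have 1: "hom_series [1] = fps_X * aut_series + fps_linfactor 1 * fps_scale aut_series (1 / p)"
    using hom_series_up[of "[]" 0] by (simp add: aut_series_def)
  have 2: "fps_linfactor p * hom_series [1] = fps_linfactor p * aut_series + fps_X * fps_scale aut_series p"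
    using hom_series_down[of "[]" 0] by (simp add: aut_series_def)
  have 3: "fps_scale h p = fps_linfactor p * aut_series - fps_scale aut_series p"
    using p_nonzero by (simp add: h_def fps_scale_diff fps_scale_mult fps_scale_scale fps_scale_linfactor)
  have "fps_linfactor p * h = - (fps_X * fps_scale h p)"
    unfolding 3 using 1 2 by (simp add: h_def algebra_simps)
  then have 4: "h = fps_X * (fps_const p * h - fps_scale h p)"
    by (simp add: fps_linfactor_def algebra_simps)
  have "h $ n = 0" for n
  proof (induction n)
    case 0
    then show ?case
      by (subst 4) simp
  next
    case (Suc n)
    then show ?case
      by (subst 4) simp
  qed
  then have "h = 0"
    by (simp add: fps_eq_iff)
  then show ?thesis
    using 3 by (simp add: fps_eq_iff)
qed

end

section \<open>Submodule counts and their symmetry\<close>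

context qparam
begin

text \<open>In the same interpretation the coefficient of \<open>X\<^sup>n\<close> counts the submodules of \<open>W\<close> of length \<open>n\<close>,
  since every homomorphism factors through its image. Lemmas \<open>submodule_series_up\<close> and \<open>submodule_series_down\<close>
  distinguish submodules by whether they contain the socle of a cyclic summand of maximal length, respectively
  by the dual condition; they are exchanged by duality, which gives the palindromicity.\<close>

definition submodule_series :: "nat list \<Rightarrow> 'a fps" where
  "submodule_series ws = hom_series ws * inverse aut_series"

lemma submodule_series_mult_aut_series: "submodule_series ws * aut_series = hom_series ws"
  using inverse_mult_eq_1[of aut_series] by (simp add: submodule_series_def mult.assoc)

lemma aut_series_nonzero [simp]: "aut_series \<noteq> 0"
  by (metis aut_series_nth_0 fps_zero_nth zero_neq_one)

text \<open>In this form the difference equation absorbs the factor 1 - X of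
  \<open>hom_series_up\<close> when E is divided out.\<close>

lemma aut_series_scale_inverse_p: "fps_linfactor 1 * fps_scale aut_series (1 / p) = aut_series"
proof -
  have "fps_scale (fps_scale aut_series p) (1 / p) = fps_scale (fps_linfactor p * aut_series) (1 / p)"
    by (simp add: aut_series_scale_p)
  then show ?thesis
    using p_nonzero by (simp add: fps_scale_mult fps_scale_scale fps_scale_linfactor)
qed

lemma submodule_series_up: "submodule_series (map Suc (us @ [w])) = fps_X * submodule_series (map Suc us @ [w]) + fps_scale (submodule_series (us @ [w])) (1 / p)"
proof -
  have "submodule_series (map Suc (us @ [w])) * aut_series = fps_X * (submodule_series (map Suc us @ [w]) * aut_series) +
      fps_linfactor 1 * fps_scale (submodule_series (us @ [w]) * aut_series) (1 / p)"
    unfolding submodule_series_mult_aut_series by (rule hom_series_up)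
  also have "\<dots> = fps_X * submodule_series (map Suc us @ [w]) * aut_series +
      fps_scale (submodule_series (us @ [w])) (1 / p) * (fps_linfactor 1 * fps_scale aut_series (1 / p))"
    unfolding fps_scale_mult by (simp only: mult_ac)
  also have "\<dots> = (fps_X * submodule_series (map Suc us @ [w]) + fps_scale (submodule_series (us @ [w])) (1 / p)) * aut_series"
    unfolding aut_series_scale_inverse_p by (rule distrib_right[symmetric])
  finally show ?thesis
    by (simp only: mult_right_cancel[OF aut_series_nonzero])
qed

lemma submodule_series_down: "submodule_series (map Suc (us @ [w])) = submodule_series (map Suc us @ [w]) +
    fps_const (1 / p ^ sum_list (us @ [w])) * fps_X ^ Suc (length us) * fps_scale (submodule_series (us @ [w])) p"
proof -
  let ?k = "fps_const (1 / p ^ sum_list (us @ [w])) * fps_X ^ Suc (length us)"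
  have "submodule_series (map Suc (us @ [w])) * (fps_linfactor p * aut_series) = fps_linfactor p * (submodule_series (map Suc (us @ [w])) * aut_series)"
    by (simp only: mult_ac)
  also have "\<dots> = fps_linfactor p * (submodule_series (map Suc us @ [w]) * aut_series) + ?k * fps_scale (submodule_series (us @ [w]) * aut_series) p"
    unfolding submodule_series_mult_aut_series by (rule hom_series_down)
  also have "\<dots> = (submodule_series (map Suc us @ [w]) + ?k * fps_scale (submodule_series (us @ [w])) p) * (fps_linfactor p * aut_series)"
    unfolding fps_scale_mult aut_series_scale_p by (simp only: mult_ac distrib_right distrib_left)
  finally show ?thesis
    by (subst (asm) mult_right_cancel) simp_all
qed

text \<open>Coefficient n from \<open>submodule_series_up\<close> is compared with coefficient N - n
  from \<open>submodule_series_down\<close>. The terms with one box removed match by induction since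
  N = NA + 1, and the terms with a row removed match because X^l p^(-NB) B(pX) is the degree-N
  reversal of B(X/p). Dropping a zero column keeps the sum, so the induction measure also counts the
  length.\<close>

lemma submodule_series_palindrome:
  assumes "ws \<noteq> []" and "sorted_wrt (\<ge>) ws"
  shows "submodule_series ws $ n = (if n \<le> sum_list ws then submodule_series ws $ (sum_list ws - n) else 0)"
  using assms
proof (induction "sum_list ws + length ws" arbitrary: ws n rule: less_induct)
  case less
  from \<open>ws \<noteq> []\<close> obtain us' w' where ws: "ws = us' @ [w']"
    by (metis rev_exhaust)
  show ?case
  proof (cases "w' = 0")
    case True
    show ?thesis
    proof (cases "us' = []")
      case True
      then have "submodule_series ws = 1"
        using inverse_mult_eq_1'[of aut_series] aut_series_nth_0 \<open>w' = 0\<close> by (simp add: submodule_series_def aut_series_def[symmetric] ws)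
      then show ?thesis
        using True \<open>w' = 0\<close> by (simp add: ws)
    next
      case False
      then have "submodule_series ws = submodule_series us'" "sum_list ws = sum_list us'"
        using \<open>w' = 0\<close> by (simp_all add: submodule_series_def ws hom_series_append_0)
      then show ?thesis
        using less.hyps[of us' n] less.prems False by (metis add_Suc_right length_append_singleton lessI sorted_wrt_append ws)
    qed
  next
    case False
    define us where "us = map (\<lambda>x. x - 1) us'"
    define w where "w = w' - 1"
    \<comment> \<open>The ordering makes all columns nonzero once the last one is, so
      \<open>ws\<close> is obtained by raising every entry of a shorter diagram.\<close>
    have "\<forall>x\<in>set us'. w' \<le> x"
      using less.prems by (simp add: ws sorted_wrt_append)
    then have Suc_us: "map Suc us = us'" "Suc w = w'"
      using False by (auto simp: us_def w_def intro!: map_idI)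
    let ?A = "map Suc us @ [w]" and ?B = "us @ [w]" and ?l = "Suc (length us)"
    have ws': "ws = map Suc ?B"
      using Suc_us by (simp add: ws)
    define f where "f = submodule_series ws"
    define fA where "fA = submodule_series ?A"
    define fB where "fB = submodule_series ?B"
    define N where "N = sum_list ws"
    define NA where "NA = sum_list ?A"
    define NB where "NB = sum_list ?B"
    have sum: "N = Suc NA" "N = NB + ?l"
      using sum_list_Suc[of "\<lambda>x. x" us] by (simp_all add: ws' N_def NA_def NB_def)
    have "sorted_wrt (\<ge>) ?A" "sorted_wrt (\<ge>) ?B"
      using less.prems unfolding ws' by (auto simp: sorted_wrt_append sorted_wrt_map)
    then have A: "fA $ m = (if m \<le> NA then fA $ (NA - m) else 0)"
      and B: "fB $ m = (if m \<le> NB then fB $ (NB - m) else 0)" for m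
      unfolding fA_def fB_def NA_def NB_def
      by (intro less.hyps; use sum in \<open>simp add: ws' N_def NA_def NB_def\<close>)+
    have up: "f $ m = (if m = 0 then 0 else fA $ (m - 1)) + (1 / p) ^ m * fB $ m" for m
      unfolding f_def fA_def fB_def ws' submodule_series_up by simp
    have down: "f $ m = fA $ m +
        (if m < ?l then 0 else (1 / p ^ NB) * p ^ (m - ?l) * fB $ (m - ?l))" for m
      unfolding f_def fA_def fB_def NB_def ws' submodule_series_down
      by (simp add: mult.assoc fps_X_power_mult_nth del: power_Suc)
    have "f $ n = (if n \<le> N then f $ (N - n) else 0)"
    proof (cases "n \<le> N")
      case True
      have "fA $ (N - n) = (if n = 0 then 0 else fA $ (n - 1))"
        using A[of "N - n"] True sum(1) by (cases n) auto
      moreover have "(if N - n < ?l then 0 else (1 / p ^ NB) * p ^ (N - n - ?l) * fB $ (N - n - ?l)) =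
          (1 / p) ^ n * fB $ n"
      proof (cases "n \<le> NB")
        case True
        then obtain m where m: "NB = n + m"
          using le_Suc_ex by blast
        then have "N - n - ?l = m" "\<not> N - n < ?l"
          using sum by auto
        moreover have "fB $ n = fB $ m"
          using B[of n] m by simp
        moreover have "1 / p ^ NB * p ^ m = (1 / p) ^ n"
          using p_nonzero by (simp add: m power_add power_divide)
        ultimately show ?thesis
          by simp
      next
        case False
        then show ?thesis
          using B[of n] sum by auto
      qed
      ultimately have "f $ (N - n) = f $ n"
        using up[of n] down[of "N - n"] by simp
      then show ?thesis
        using True by simp
    next
      case False
      then show ?thesis
        using up[of n] A[of "n - 1"] B[of n] sum by simp
    qed
    then show ?thesis
      by (simp only: f_def N_def)
  qed
qed

end

text \<open>The difference equations for p and 1/p combine to (1 - X) P(pX) = (1 - pX) P(X) for the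
  product P. Hence P / (1 - X) is invariant under X -> pX, and it is constant because p is not a
  root of unity.\<close>

lemma aut_series_mult_inverse:
  fixes p :: "'a::field"
  assumes "qparam p"
  shows "qparam.aut_series p * qparam.aut_series (inverse p) = fps_linfactor 1"
proof -
  interpret p: qparam p by fact
  have p': "qparam (inverse p)"
    using p.p_nonzero p.p_not_root by unfold_locales (simp_all add: power_inverse inverse_eq_1_iff)
  interpret p': qparam "inverse p" by fact
  let ?P = "p.aut_series * p'.aut_series"
  have 1: "fps_linfactor 1 * fps_scale ?P p = fps_linfactor p * ?P"
  proof -
    have "fps_linfactor 1 * fps_scale p'.aut_series p = p'.aut_series"
      using p'.aut_series_scale_inverse_p by (simp add: divide_inverse)
    then show ?thesis
      unfolding fps_scale_mult p.aut_series_scale_p by (metis mult.assoc mult.left_commute)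
  qed
  define G where "G = ?P * inverse (fps_linfactor 1)"
  have G: "G * fps_linfactor 1 = ?P"
    using inverse_mult_eq_1[of "fps_linfactor 1 :: 'a fps"] by (simp add: G_def mult.assoc)
  have "fps_scale G p * (fps_linfactor 1 * fps_linfactor p) = G * (fps_linfactor 1 * fps_linfactor p)"
  proof -
    have "fps_scale G p * (fps_linfactor 1 * fps_linfactor p) = fps_linfactor 1 * fps_scale (G * fps_linfactor 1) p"
      by (simp add: fps_scale_mult fps_scale_linfactor mult_ac)
    also have "\<dots> = fps_linfactor p * (G * fps_linfactor 1)"
      unfolding G by (rule 1)
    finally show ?thesis
      by (simp only: mult_ac)
  qed
  then have "fps_scale G p = G"
    by simp
  then have "(p ^ n - 1) * G $ n = 0" for n
    by (metis (no_types) eq_iff_diff_eq_0 fps_scale_nth left_diff_distrib mult_1_left)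
  then have "G $ n = 0" if "n \<ge> 1" for n
    using p.p_not_root[OF that] by (metis eq_iff_diff_eq_0 mult_eq_0_iff)
  moreover have "G $ 0 = 1"
    using arg_cong[OF G, of "\<lambda>f. f $ 0"] by simp
  ultimately have "G = 1"
    by (simp add: fps_eq_iff)
  then show ?thesis
    using G by simp
qed

text \<open>Reversal turns 1 - X into its negative, and the degree grows by one.\<close>

lemma linfactor_mult_antisymmetric:
  fixes f :: "'a::field fps"
  assumes "\<And>n. f $ n = (if n \<le> d then f $ (d - n) else 0)"
  shows "n \<le> Suc d \<Longrightarrow> (fps_linfactor 1 * f) $ (Suc d - n) = - (fps_linfactor 1 * f) $ n"
    and "n > Suc d \<Longrightarrow> (fps_linfactor 1 * f) $ n = 0"
proof -
  have eq: "(fps_linfactor 1 * f) $ n = f $ n - (if n = 0 then 0 else f $ (n - 1))" for n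
    by (simp add: fps_linfactor_def left_diff_distrib)
  have f0: "n > d \<Longrightarrow> f $ n = 0" and f_rev: "n \<le> d \<Longrightarrow> f $ (d - n) = f $ n" for n
    using assms[of n] by simp_all
  show "n > Suc d \<Longrightarrow> (fps_linfactor 1 * f) $ n = 0"
    by (simp add: eq f0)
  assume "n \<le> Suc d"
  then show "(fps_linfactor 1 * f) $ (Suc d - n) = - (fps_linfactor 1 * f) $ n"
  proof (cases n)
    case 0
    then show ?thesis
      using f_rev[of 0] by (simp add: eq f0)
  next
    case (Suc m)
    then show ?thesis
      using \<open>n \<le> Suc d\<close> f_rev[of m] f_rev[of "Suc m"] f0[of "Suc m"]
      by (cases "m = d") (simp_all add: eq)
  qed
qed

lemma palindrome_mult:
  fixes f g :: "'a::field fps"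
  assumes f: "\<And>n. f $ n = (if n \<le> d then f $ (d - n) else 0)"
    and g: "\<And>n. g $ n = (if n \<le> e then g $ (e - n) else 0)"
  shows "(f * g) $ n = (if n \<le> d + e then (f * g) $ (d + e - n) else 0)"
proof -
  have f0: "n > d \<Longrightarrow> f $ n = 0" and g0: "n > e \<Longrightarrow> g $ n = 0"
    and f_rev: "n \<le> d \<Longrightarrow> f $ (d - n) = f $ n" and g_rev: "n \<le> e \<Longrightarrow> g $ (e - n) = g $ n" for n
    using f[of n] g[of n] by simp_all
  have nth: "(f * g) $ n = (\<Sum>(i, j) | i \<le> d \<and> j \<le> e \<and> i + j = n. f $ i * g $ j)" for n
  proof -
    have "(f * g) $ n = (\<Sum>(i, j) | i + j = n. f $ i * g $ j)"
      unfolding fps_mult_nth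
      by (rule sum.reindex_bij_witness[of _ fst "\<lambda>i. (i, n - i)"]) auto
    also have "\<dots> = (\<Sum>(i, j) | i \<le> d \<and> j \<le> e \<and> i + j = n. f $ i * g $ j)"
    proof (rule sum.mono_neutral_right)
      show "finite {(i, j). i + j = n}"
        by (rule finite_subset[of _ "{..n} \<times> {..n}"]) auto
    qed (use f0 g0 in \<open>auto intro: leI\<close>)
    finally show ?thesis .
  qed
  show ?thesis
  proof (cases "n \<le> d + e")
    case True
    have "(f * g) $ n = (f * g) $ (d + e - n)"
      unfolding nth
      by (rule sum.reindex_bij_witness[of _ "\<lambda>(i, j). (d - i, e - j)" "\<lambda>(i, j). (d - i, e - j)"])
        (use True in \<open>auto simp: f_rev g_rev\<close>)
    then show ?thesis
      using True by simp
  next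
    case False
    then show ?thesis
      unfolding nth by (auto intro!: sum.neutral)
  qed
qed

lemma hom_series_mult_antisymmetric:
  fixes p :: "'a::field" and ws vs
  defines "G \<equiv> qparam.hom_series p ws * qparam.hom_series (inverse p) vs" and "d \<equiv> sum_list ws + sum_list vs"
  assumes "qparam p" and "ws \<noteq> []" "sorted_wrt (\<ge>) ws" and "vs \<noteq> []" "sorted_wrt (\<ge>) vs"
  shows "n \<le> Suc d \<Longrightarrow> G $ (Suc d - n) = - G $ n"
    and "n > Suc d \<Longrightarrow> G $ n = 0"
proof -
  interpret p: qparam p by fact
  interpret p': qparam "inverse p"
    using p.p_nonzero p.p_not_root by unfold_locales (simp_all add: power_inverse inverse_eq_1_iff)
  have G: "G = fps_linfactor 1 * (p.submodule_series ws * p'.submodule_series vs)"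
    using p.submodule_series_mult_aut_series[of ws] p'.submodule_series_mult_aut_series[of vs] aut_series_mult_inverse[OF \<open>qparam p\<close>]
    by (metis (no_types, opaque_lifting) G_def mult.assoc mult.commute)
  have "(p.submodule_series ws * p'.submodule_series vs) $ n = (if n \<le> d then (p.submodule_series ws * p'.submodule_series vs) $ (d - n) else 0)" for n
    unfolding d_def by (intro palindrome_mult p.submodule_series_palindrome p'.submodule_series_palindrome assms)
  note * = linfactor_mult_antisymmetric[OF this, folded G]
  show "n \<le> Suc d \<Longrightarrow> G $ (Suc d - n) = - G $ n"
    by (rule *(1))
  show "n > Suc d \<Longrightarrow> G $ n = 0"
    by (rule *(2))
qed

section \<open>Coefficients as sums over partitions\<close>

definition bounded_partitions :: "nat \<Rightarrow> (nat \<Rightarrow> nat) set" where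
  "bounded_partitions L = {a. antimono a \<and> (\<forall>k\<ge>L. a k = 0)}"

text \<open>A partition of n has at most n nonzero entries, so for n \<le> L the cutoff loses
  nothing while all products and lists of columns become finite.\<close>

definition partitions_of :: "nat \<Rightarrow> nat \<Rightarrow> (nat \<Rightarrow> nat) set" where
  "partitions_of L n = {a \<in> bounded_partitions L. (\<Sum>k<L. a k) = n}"

lemma finite_partitions_of: "finite (partitions_of L n)"
proof (rule finite_subset)
  show "partitions_of L n \<subseteq> {a. \<forall>k. (k \<in> {..<L} \<longrightarrow> a k \<in> {..n}) \<and> (k \<notin> {..<L} \<longrightarrow> a k = 0)}"
    by (auto simp: partitions_of_def bounded_partitions_def intro: member_le_sum)
  show "finite {a. \<forall>k. (k \<in> {..<L} \<longrightarrow> a k \<in> {..n}) \<and> (k \<notin> {..<L} \<longrightarrow> a k = (0::nat))}"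
    by (rule finite_set_of_finite_funs) auto
qed

lemma sum_partitions_of_Suc:
  fixes g :: "nat \<Rightarrow> (nat \<Rightarrow> nat) \<Rightarrow> 'b::comm_monoid_add"
  shows "(\<Sum>a\<in>partitions_of (Suc L) n. g (a 0) (\<lambda>k. a (Suc k))) =
    (\<Sum>s\<le>n. \<Sum>b\<in>partitions_of L (n - s). if b 0 \<le> s then g s b else 0)"
proof -
  have "(\<Sum>s\<le>n. \<Sum>b\<in>partitions_of L (n - s). if b 0 \<le> s then g s b else 0) =
      (\<Sum>s\<le>n. \<Sum>b\<in>{b \<in> partitions_of L (n - s). b 0 \<le> s}. g s b)"
    by (simp add: sum.inter_filter finite_partitions_of)
  also have "\<dots> = (\<Sum>(s, b)\<in>(SIGMA s:{..n}. {b \<in> partitions_of L (n - s). b 0 \<le> s}). g s b)"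
    by (rule sum.Sigma) (auto simp: finite_partitions_of)
  also have "\<dots> = (\<Sum>a\<in>partitions_of (Suc L) n. g (a 0) (\<lambda>k. a (Suc k)))"
  proof (rule sum.reindex_bij_witness[of _ "\<lambda>a. (a 0, \<lambda>k. a (Suc k))" "\<lambda>(s, b). case_nat s b"])
    fix a assume a: "a \<in> partitions_of (Suc L) n"
    then have "antimono a" "\<forall>k\<ge>Suc L. a k = 0" "a 0 + (\<Sum>k<L. a (Suc k)) = n"
      by (simp_all add: partitions_of_def bounded_partitions_def sum.lessThan_Suc_shift del: sum.lessThan_Suc)
    then show "(a 0, \<lambda>k. a (Suc k)) \<in> (SIGMA s:{..n}. {b \<in> partitions_of L (n - s). b 0 \<le> s})"
      by (auto simp: partitions_of_def bounded_partitions_def antimono_def)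
    show "(case (a 0, \<lambda>k. a (Suc k)) of (s, b) \<Rightarrow> case_nat s b) = a"
      by (auto simp: fun_eq_iff split: nat.split)
  next
    fix x assume x: "x \<in> (SIGMA s:{..n}. {b \<in> partitions_of L (n - s). b 0 \<le> s})"
    then obtain s b where sb: "x = (s, b)" "s \<le> n" "antimono b" "\<forall>k\<ge>L. b k = 0" "(\<Sum>k<L. b k) = n - s" "b 0 \<le> s"
      by (auto simp: partitions_of_def bounded_partitions_def)
    have "antimono (case_nat s b)"
      unfolding antimono_iff_le_Suc using sb(3,6) by (auto split: nat.split simp: antimono_iff_le_Suc)
    moreover have "case_nat s b k = 0" if "k \<ge> Suc L" for k
      using that sb(4) by (cases k) auto
    ultimately show "(case x of (s, b) \<Rightarrow> case_nat s b) \<in> partitions_of (Suc L) n"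
      using sb by (simp add: partitions_of_def bounded_partitions_def sum.lessThan_Suc_shift del: sum.lessThan_Suc)
    show "((case x of (s, b) \<Rightarrow> case_nat s b) 0, \<lambda>k. (case x of (s, b) \<Rightarrow> case_nat s b) (Suc k)) = x"
      using sb by simp
    show "g ((case x of (s, b) \<Rightarrow> case_nat s b) 0) (\<lambda>k. (case x of (s, b) \<Rightarrow> case_nat s b) (Suc k)) =
        (case x of (s, b) \<Rightarrow> g s b)"
      using sb by simp
  qed
  finally show ?thesis ..
qed

context qparam
begin

lemma step_nth:
  "step y w f t $ n = (\<Sum>s\<le>n. if s \<le> t then (y / p ^ w) ^ s * p ^ s\<^sup>2 / qpoch p (t - s) * f s $ (n - s) else 0)"
proof -
  have "step y w f t $ n = (\<Sum>s\<le>t. if s \<le> n then (y / p ^ w) ^ s * p ^ s\<^sup>2 / qpoch p (t - s) * f s $ (n - s) else 0)"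
    unfolding step_def fps_sum_nth
    by (intro sum.cong refl) (simp add: mult.assoc fps_X_power_mult_nth)
  also have "\<dots> = (\<Sum>s\<in>{s\<in>{..t}. s \<le> n}. (y / p ^ w) ^ s * p ^ s\<^sup>2 / qpoch p (t - s) * f s $ (n - s))"
    by (rule sum.inter_filter[symmetric]) simp
  also have "{s\<in>{..t}. s \<le> n} = {s\<in>{..n}. s \<le> t}"
    by auto
  also have "(\<Sum>s\<in>{s\<in>{..n}. s \<le> t}. (y / p ^ w) ^ s * p ^ s\<^sup>2 / qpoch p (t - s) * f s $ (n - s)) =
      (\<Sum>s\<le>n. if s \<le> t then (y / p ^ w) ^ s * p ^ s\<^sup>2 / qpoch p (t - s) * f s $ (n - s) else 0)"
    by (rule sum.inter_filter) simp
  finally show ?thesis .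
qed

text \<open>Each column is either empty, after which both sides continue identically from
  \<open>A 0 = B 0\<close>, or contributes a factor X. Only a term of degree at least
  \<open>length ws\<close> reaches the bottom series at a nonzero height, and at degree exactly
  \<open>length ws\<close> it sees only the constant term.\<close>

lemma steps_trunc:
  assumes "\<And>t. A t $ 0 = B t $ 0" and "A 0 = B 0" and "n \<le> length ws"
  shows "steps y ws A t $ n = steps y ws B t $ n"
  using assms(3)
proof (induction ws arbitrary: n t)
  case (Cons w ws)
  have 0: "steps y ws A 0 = steps y ws B 0"
    by (induction ws) (simp_all add: assms)
  have eq: "steps y ws A s $ (n - s) = steps y ws B s $ (n - s)" for s
    using 0 Cons by (cases s) auto
  show ?case
    by (simp only: steps_Cons step_nth eq)
qed (simp add: assms)

lemma total_trunc:
  assumes "\<And>t. A t $ 0 = B t $ 0" and "A 0 = B 0" and "n \<le> length ws"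
  shows "total y ws A $ n = total y ws B $ n"
proof (cases ws)
  case (Cons w us)
  have 0: "steps y us A 0 = steps y us B 0"
    by (induction us) (simp_all add: assms)
  have eq: "steps y us A s $ (n - s) = steps y us B s $ (n - s)" for s
    using 0 assms Cons by (cases s) (auto intro: steps_trunc)
  show ?thesis
    by (simp only: Cons total.simps fps_sumX_nth fps_mult_left_const_nth eq)
qed simp

text \<open>The value |Hom(V, W)| / |Aut V| when \<open>a\<close> and \<open>W\<close> list the
  columns of the two modules and 1/p is the size of the field.\<close>

definition partition_weight :: "nat \<Rightarrow> (nat \<Rightarrow> nat) \<Rightarrow> (nat \<Rightarrow> nat) \<Rightarrow> 'a" where
  "partition_weight L W a = (\<Prod>k<L. (1 / p ^ W k) ^ a k * p ^ (a k)\<^sup>2 / qpoch p (a k - a (Suc k)))"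

lemma partition_weight_Suc:
  "partition_weight (Suc L) W a = (1 / p ^ W 0) ^ a 0 * p ^ (a 0)\<^sup>2 / qpoch p (a 0 - a (Suc 0)) *
     partition_weight L (\<lambda>k. W (Suc k)) (\<lambda>k. a (Suc k))"
  unfolding partition_weight_def by (rule prod.lessThan_Suc_shift)

text \<open>The denominators are offset by one column: the step to height s divides by the factor
  for its predecessor t. The bottom series 1 / (p;p)_t therefore supplies the factor for the last
  column, whose successor is 0.\<close>

lemma steps_nth_partitions:
  "steps 1 (map W [0..<L]) (\<lambda>t. fps_const (1 / qpoch p t)) t $ n =
     (\<Sum>a\<in>partitions_of L n. if a 0 \<le> t then partition_weight L W a / qpoch p (t - a 0) else 0)"
proof (induction L arbitrary: W t n)
  case 0
  have "partitions_of 0 n = (if n = 0 then {\<lambda>_. 0} else {})"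
    by (auto simp: partitions_of_def bounded_partitions_def antimono_def)
  then show ?case
    by (simp add: partition_weight_def)
next
  case (Suc L)
  have ws: "map W [0..<Suc L] = W 0 # map (\<lambda>k. W (Suc k)) [0..<L]"
    by (simp add: map_upt_Suc del: upt_Suc)
  let ?g = "\<lambda>s b. if s \<le> t then (1 / p ^ W 0) ^ s * p ^ s\<^sup>2 / qpoch p (s - b 0) *
      partition_weight L (\<lambda>k. W (Suc k)) b / qpoch p (t - s) else 0"
  have "(\<Sum>a\<in>partitions_of (Suc L) n. if a 0 \<le> t then partition_weight (Suc L) W a / qpoch p (t - a 0) else 0)
    = (\<Sum>a\<in>partitions_of (Suc L) n. ?g (a 0) (\<lambda>k. a (Suc k)))"
    by (simp add: partition_weight_Suc cong: if_cong)
  also have "\<dots> = (\<Sum>s\<le>n. \<Sum>b\<in>partitions_of L (n - s). if b 0 \<le> s then ?g s b else 0)"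
    by (rule sum_partitions_of_Suc)
  also have "\<dots> = steps 1 (map W [0..<Suc L]) (\<lambda>t. fps_const (1 / qpoch p t)) t $ n"
    unfolding ws steps_Cons step_nth Suc.IH
  proof (intro sum.cong refl)
    fix s
    show "(\<Sum>b\<in>partitions_of L (n - s). if b 0 \<le> s then ?g s b else 0) =
        (if s \<le> t then (1 / p ^ W 0) ^ s * p ^ s\<^sup>2 / qpoch p (t - s) *
          (\<Sum>b\<in>partitions_of L (n - s). if b 0 \<le> s then
            partition_weight L (\<lambda>k. W (Suc k)) b / qpoch p (s - b 0) else 0) else 0)"
      by (cases "s \<le> t") (auto simp: sum_distrib_left intro!: sum.cong sum.neutral)
  qed
  finally show ?case ..
qed

lemma hom_series_nth_partitions:
  assumes "n \<le> L" and "L \<ge> 1"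
  shows "hom_series (map W [0..<L]) $ n = (\<Sum>a\<in>partitions_of L n. partition_weight L W a)"
proof -
  obtain K where L: "L = Suc K"
    using \<open>L \<ge> 1\<close> by (cases L) auto
  have ws: "map W [0..<Suc K] = W 0 # map (\<lambda>k. W (Suc k)) [0..<K]"
    by (simp add: map_upt_Suc del: upt_Suc)
  let ?g = "\<lambda>s b. (1 / p ^ W 0) ^ s * p ^ s\<^sup>2 / qpoch p (s - b 0) * partition_weight K (\<lambda>k. W (Suc k)) b"
  \<comment> \<open>Up to degree L the bottom series \<open>qtail\<close> may be replaced by its
    constant term, since \<open>qtail 1 0\<close> is 1 on both sides.\<close>
  have "hom_series (map W [0..<L]) $ n = total 1 (map W [0..<L]) (\<lambda>t. fps_const (1 / qpoch p t)) $ n"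
    unfolding hom_series_def by (rule total_trunc) (use assms in \<open>simp_all add: qtail_nth_0\<close>)
  also have "\<dots> = (\<Sum>s\<le>n. \<Sum>b\<in>partitions_of K (n - s). if b 0 \<le> s then ?g s b else 0)"
    unfolding L ws total.simps fps_sumX_nth
    unfolding steps_nth_partitions fps_mult_left_const_nth sum_distrib_left
    by (intro sum.cong refl) simp
  also have "\<dots> = (\<Sum>a\<in>partitions_of (Suc K) n. ?g (a 0) (\<lambda>k. a (Suc k)))"
    by (rule sum_partitions_of_Suc[symmetric])
  finally show ?thesis
    by (simp add: L partition_weight_Suc)
qed

end

section \<open>Splitting the fermionic form into two partition sums\<close>

lemma power_int_sum:
  fixes z :: "'a::field"
  assumes "z \<noteq> 0"
  shows "z powi (\<Sum>x\<in>A. f x) = (\<Prod>x\<in>A. z powi f x)"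
  by (induction A rule: infinite_finite_induct) (simp_all add: power_int_add assms)

lemma abel_summation:
  fixes f s :: "nat \<Rightarrow> int"
  shows "(\<Sum>k<L. (\<Sum>l\<le>k. f l) * (s k - s (Suc k))) = (\<Sum>l<L. f l * s l) - (\<Sum>l<L. f l) * s L"
  by (induction L) (simp_all add: algebra_simps lessThan_Suc_atMost[symmetric])

context qparam
begin

lemma qparam_inverse: "qparam (inverse p)"
  using p_nonzero p_not_root by unfold_locales (simp_all add: power_inverse inverse_eq_1_iff)

lemma qpoch_inverse_nonzero [simp]: "qpoch (inverse p) n \<noteq> 0"
  by (rule qparam.qpoch_nonzero[OF qparam_inverse])

text \<open>A form of the q-binomial theorem, used at x = q^n. After multiplication by 1 - p^(m+1) =
  (1 - p^(m+1-s)) + p^(m+1-s) (1 - p^s), the first part gives the sum for m. In the second, 1 - p^s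
  = -p^s (1 - p^(-s)) cancels a factor of the inverse Pochhammer symbol and shifts s, giving -x
  p^(m+1) times the same sum.\<close>

lemma bracket_expansion:
  "(\<Prod>k=1..m. (1 - x * p ^ k) / (1 - p ^ k)) =
    (\<Sum>s\<le>m. x ^ s / (qpoch (inverse p) s * qpoch p (m - s)))"
proof (induction m)
  case (Suc m)
  let ?q = "qpoch (inverse p)" and ?S = "\<lambda>m. \<Sum>s\<le>m. x ^ s / (qpoch (inverse p) s * qpoch p (m - s))"
  have nz: "1 - p ^ Suc m \<noteq> 0"
    using p_not_root[of "Suc m"] by simp
  have "(1 - p ^ Suc m) * (x ^ s / (?q s * qpoch p (Suc m - s))) =
      (if s \<le> m then x ^ s / (?q s * qpoch p (m - s)) else 0) -
      (if s = 0 then 0 else p ^ Suc m * x * (x ^ (s - 1) / (?q (s - 1) * qpoch p (m - (s - 1)))))"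
    if s: "s \<le> Suc m" for s
  proof -
    have 1: "p ^ (Suc m - s) * (1 - p ^ s) * (x ^ s / (?q s * qpoch p (Suc m - s))) =
       - (if s = 0 then 0 else p ^ Suc m * x * (x ^ (s - 1) / (?q (s - 1) * qpoch p (m - (s - 1)))))"
    proof (cases s)
      case (Suc u)
      then obtain d where d: "m = u + d"
        using s le_Suc_ex[of u m] by auto
      have ne: "1 - inverse p ^ Suc u \<noteq> 0"
        using qparam.p_not_root[OF qparam_inverse, of "Suc u"] by simp
      have "(1 - p ^ s) = - (p ^ Suc u) * (1 - inverse p ^ Suc u)"
        using p_nonzero by (simp add: Suc algebra_simps flip: power_mult_distrib)
      moreover have "p ^ (Suc m - s) * p ^ Suc u = p ^ Suc m"
        by (simp add: Suc d power_add)
      moreover have "?q s = (1 - inverse p ^ Suc u) * ?q u"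
        by (simp add: Suc qpoch_Suc)
      moreover have "a * (- b * w) * (x ^ s / (w * v * r)) = - (a * b * x * (x ^ u / (v * r)))"
        if "w \<noteq> 0" "v \<noteq> 0" "r \<noteq> 0" for a b w v r
        using that by (simp add: Suc)
      ultimately show ?thesis
        using ne p_nonzero by (simp add: Suc)
    qed simp
    have 2: "(1 - p ^ (Suc m - s)) * (x ^ s / (?q s * qpoch p (Suc m - s))) =
        (if s \<le> m then x ^ s / (?q s * qpoch p (m - s)) else 0)"
    proof (cases "s \<le> m")
      case True
      then have "Suc m - s = Suc (m - s)"
        by simp
      moreover have "1 - p ^ Suc (m - s) \<noteq> 0"
        using p_not_root[of "Suc (m - s)"] by simp
      ultimately show ?thesis
        using True by (simp add: qpoch_Suc)
    next
      case False
      then show ?thesis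
        using s by simp
    qed
    have "p ^ (Suc m - s) * p ^ s = p ^ Suc m"
      using s by (simp flip: power_add)
    then have eq: "1 - p ^ Suc m = (1 - p ^ (Suc m - s)) + p ^ (Suc m - s) * (1 - p ^ s)"
      by (simp add: algebra_simps)
    show ?thesis
      unfolding eq distrib_right 1 2 by (rule diff_conv_add_uminus[symmetric])
  qed
  then have "(1 - p ^ Suc m) * ?S (Suc m) =
      (\<Sum>s\<le>Suc m. if s \<le> m then x ^ s / (?q s * qpoch p (m - s)) else 0) -
      (\<Sum>s\<le>Suc m. if s = 0 then 0 else p ^ Suc m * x * (x ^ (s - 1) / (?q (s - 1) * qpoch p (m - (s - 1)))))"
    by (simp add: sum_distrib_left sum_subtractf del: sum.atMost_Suc cong: if_cong)
  also have "(\<Sum>s\<le>Suc m. if s \<le> m then x ^ s / (?q s * qpoch p (m - s)) else 0) = ?S m"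
    by simp
  also have "(\<Sum>s\<le>Suc m. if s = 0 then 0 else p ^ Suc m * x * (x ^ (s - 1) / (?q (s - 1) * qpoch p (m - (s - 1))))) =
      p ^ Suc m * x * ?S m"
    by (subst sum.atMost_Suc_shift) (simp add: sum_distrib_left mult.assoc)
  finally have "(1 - p ^ Suc m) * ?S (Suc m) = (1 - x * p ^ Suc m) * ?S m"
    by (simp add: algebra_simps)
  then have "?S (Suc m) = ?S m * ((1 - x * p ^ Suc m) / (1 - p ^ Suc m))"
    using nz by (simp add: eq_divide_eq mult_ac)
  then show ?case
    using Suc.IH by simp
qed simp

end

section \<open>Differences of partitions and expansion of products\<close>

lemma bounded_partitions_add:
  "a \<in> bounded_partitions L \<Longrightarrow> b \<in> bounded_partitions L \<Longrightarrow> (\<lambda>k. a k + b k) \<in> bounded_partitions L"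
  by (auto simp: bounded_partitions_def antimono_def add_mono)

lemma bounded_partitions_Suc_le: "a \<in> bounded_partitions L \<Longrightarrow> a (Suc k) \<le> a k"
  by (simp add: bounded_partitions_def antimono_iff_le_Suc)

lemma bounded_partitions_zero: "a \<in> bounded_partitions L \<Longrightarrow> k \<ge> L \<Longrightarrow> a k = 0"
  by (simp add: bounded_partitions_def)

text \<open>For partitions \<open>a\<close> and \<open>b\<close> this says that \<open>b - a\<close> is a partition as well.\<close>

definition steps_le :: "(nat \<Rightarrow> nat) \<Rightarrow> (nat \<Rightarrow> nat) \<Rightarrow> bool" where
  "steps_le a b \<longleftrightarrow> (\<forall>k. a k - a (Suc k) \<le> b k - b (Suc k))"

lemma steps_le_imp_le:
  assumes "steps_le a b" "a \<in> bounded_partitions L" "b \<in> bounded_partitions L"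
  shows "a k \<le> b k"
proof (cases "k \<le> L")
  case True
  then show ?thesis
  proof (induction rule: inc_induct)
    case base
    then show ?case
      using assms by (simp add: bounded_partitions_def)
  next
    case (step k)
    have "a k - a (Suc k) \<le> b k - b (Suc k)"
      using assms(1) by (simp add: steps_le_def)
    then show ?case
      using step.IH bounded_partitions_Suc_le[OF assms(2), of k] bounded_partitions_Suc_le[OF assms(3), of k]
      by linarith
  qed
next
  case False
  then show ?thesis
    using assms by (simp add: bounded_partitions_def)
qed

lemma steps_le_diff:
  assumes "steps_le a b" "a \<in> bounded_partitions L" "b \<in> bounded_partitions L"
  shows "(\<lambda>k. b k - a k) \<in> bounded_partitions L"
proof -
  have "b (Suc k) - a (Suc k) \<le> b k - a k" for k
  proof -
    have "a k - a (Suc k) \<le> b k - b (Suc k)"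
      using assms(1) by (simp add: steps_le_def)
    then show ?thesis
      using bounded_partitions_Suc_le[OF assms(2), of k] bounded_partitions_Suc_le[OF assms(3), of k]
      by linarith
  qed
  then show ?thesis
    using assms(3) by (simp add: bounded_partitions_def antimono_iff_le_Suc)
qed

lemma steps_le_add:
  assumes "a \<in> bounded_partitions L" "b \<in> bounded_partitions L"
  shows "steps_le a (\<lambda>k. b k + a k)"
  unfolding steps_le_def
proof
  fix k
  show "a k - a (Suc k) \<le> b k + a k - (b (Suc k) + a (Suc k))"
    using bounded_partitions_Suc_le[OF assms(1), of k] bounded_partitions_Suc_le[OF assms(2), of k]
    by linarith
qed

definition families :: "nat \<Rightarrow> ('i \<Rightarrow> nat \<Rightarrow> nat) set" where
  "families L = {\<tau>. \<forall>i. \<tau> i \<in> bounded_partitions L}"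

text \<open>The summation indices chosen at all (j, k) are read as the successive differences of a
  family \<sigma>, which is recovered by summing over the tail l \<ge> k.\<close>

lemma prod_sum_families:
  fixes h :: "'i::finite \<Rightarrow> nat \<Rightarrow> nat \<Rightarrow> 'b::comm_semiring_1"
  assumes "\<tau> \<in> families L"
  shows "(\<Prod>k<L. \<Prod>j\<in>UNIV. \<Sum>s\<le>\<tau> j k - \<tau> j (Suc k). h j k s) =
    (\<Sum>\<sigma>\<in>{\<sigma> \<in> families L. \<forall>j. steps_le (\<sigma> j) (\<tau> j)}. \<Prod>k<L. \<Prod>j\<in>UNIV. h j k (\<sigma> j k - \<sigma> j (Suc k)))"
proof -
  let ?I = "{..<L} \<times> (UNIV :: 'i set)"
  let ?B = "\<lambda>x. {..\<tau> (snd x) (fst x) - \<tau> (snd x) (Suc (fst x))}"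
  have "(\<Prod>k<L. \<Prod>j\<in>UNIV. \<Sum>s\<le>\<tau> j k - \<tau> j (Suc k). h j k s) =
      (\<Prod>x\<in>?I. \<Sum>s\<in>?B x. h (snd x) (fst x) s)"
    by (simp add: prod.cartesian_product case_prod_beta)
  also have "\<dots> = (\<Sum>g\<in>PiE ?I ?B. \<Prod>x\<in>?I. h (snd x) (fst x) (g x))"
    by (rule prod_sum_PiE) auto
  also have "\<dots> = (\<Sum>\<sigma>\<in>{\<sigma> \<in> families L. \<forall>j. steps_le (\<sigma> j) (\<tau> j)}.
      \<Prod>x\<in>?I. h (snd x) (fst x) (\<sigma> (snd x) (fst x) - \<sigma> (snd x) (Suc (fst x))))"
  proof (rule sum.reindex_bij_witness[of _
        "\<lambda>\<sigma>. restrict (\<lambda>x. \<sigma> (snd x) (fst x) - \<sigma> (snd x) (Suc (fst x))) ?I"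
        "\<lambda>g j k. \<Sum>l\<in>{k..<L}. g (l, j)"])
    have step: "(\<Sum>l\<in>{k..<L}. g (l, j)) - (\<Sum>l\<in>{Suc k..<L}. g (l, j)) = (if k < L then g (k, j) else 0)"
      for g :: "nat \<times> 'i \<Rightarrow> nat" and j k
      by (auto simp: sum.atLeast_Suc_lessThan)
    {
      fix g assume g: "g \<in> PiE ?I ?B"
      show "restrict (\<lambda>x. (\<Sum>l\<in>{fst x..<L}. g (l, snd x)) - (\<Sum>l\<in>{Suc (fst x)..<L}. g (l, snd x))) ?I = g"
        using g unfolding step by (auto simp: fun_eq_iff PiE_def extensional_def)
      have "steps_le (\<lambda>k. \<Sum>l\<in>{k..<L}. g (l, j)) (\<tau> j)" for j
        unfolding steps_le_def step using g by (auto simp: PiE_def Pi_def)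
      moreover have "(\<lambda>k. \<Sum>l\<in>{k..<L}. g (l, j)) \<in> bounded_partitions L" for j
        by (auto simp: bounded_partitions_def antimono_def intro!: sum_mono2)
      ultimately show "(\<lambda>j k. \<Sum>l\<in>{k..<L}. g (l, j)) \<in> {\<sigma> \<in> families L. \<forall>j. steps_le (\<sigma> j) (\<tau> j)}"
        by (simp add: families_def)
      show "(\<Prod>x\<in>?I. h (snd x) (fst x) ((\<Sum>l\<in>{fst x..<L}. g (l, snd x)) - (\<Sum>l\<in>{Suc (fst x)..<L}. g (l, snd x)))) =
          (\<Prod>x\<in>?I. h (snd x) (fst x) (g x))"
        unfolding step by (intro prod.cong refl) auto
    next
      fix \<sigma> assume \<sigma>: "\<sigma> \<in> {\<sigma> \<in> families L. \<forall>j. steps_le (\<sigma> j) (\<tau> j)}"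
      then show "restrict (\<lambda>x. \<sigma> (snd x) (fst x) - \<sigma> (snd x) (Suc (fst x))) ?I \<in> PiE ?I ?B"
        by (auto simp: steps_le_def)
      have bp: "\<sigma> j \<in> bounded_partitions L" for j
        using \<sigma> by (simp add: families_def)
      have "(\<Sum>l\<in>{k..<L}. \<sigma> j l - \<sigma> j (Suc l)) = \<sigma> j k" for j k
      proof (cases "k \<le> L")
        case True
        then show ?thesis
        proof (induction rule: inc_induct)
          case base
          show ?case
            using bounded_partitions_zero[OF bp, of L j] by simp
        next
          case (step k)
          then show ?case
            using bounded_partitions_Suc_le[OF bp, of j k] by (simp add: sum.atLeast_Suc_lessThan)
        qed
      next
        case False
        then show ?thesis
          using bounded_partitions_zero[OF bp, of k j] by simp
      qed
      then show "(\<lambda>j k. \<Sum>l\<in>{k..<L}. restrict (\<lambda>x. \<sigma> (snd x) (fst x) - \<sigma> (snd x) (Suc (fst x))) ?I (l, j)) = \<sigma>"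
        by (simp add: fun_eq_iff)
    }
  qed
  also have "\<dots> = (\<Sum>\<sigma>\<in>{\<sigma> \<in> families L. \<forall>j. steps_le (\<sigma> j) (\<tau> j)}.
      \<Prod>k<L. \<Prod>j\<in>UNIV. h j k (\<sigma> j k - \<sigma> j (Suc k)))"
    by (simp add: prod.cartesian_product case_prod_beta)
  finally show ?thesis .
qed

section \<open>Antisymmetry at a vertex\<close>

text \<open>T occurs as an integer exponent, so it is a parameter of its own; its double is
  prescribed to avoid division.\<close>

locale graph_form =
  fixes e :: "'i::finite \<Rightarrow> 'i \<Rightarrow> nat" and T :: "('i \<Rightarrow> nat) \<Rightarrow> int"
  assumes e_sym: "e i j = e j i" and e_irrefl: "e i i = 0"
    and two_T: "2 * T \<beta> = (\<Sum>i\<in>UNIV. \<Sum>j\<in>UNIV. int (\<beta> i) * (if i = j then 2 else - int (e i j)) * int (\<beta> j))"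
begin

definition cartan :: "'i \<Rightarrow> 'i \<Rightarrow> int" where
  "cartan i j = (if i = j then 2 else - int (e i j))"

lemma cartan_sym: "cartan i j = cartan j i"
  by (simp add: cartan_def e_sym)

definition pairing :: "('i \<Rightarrow> nat) \<Rightarrow> ('i \<Rightarrow> nat) \<Rightarrow> int" where
  "pairing \<beta> \<gamma> = (\<Sum>i\<in>UNIV. \<Sum>j\<in>UNIV. int (\<beta> i) * cartan i j * int (\<gamma> j))"

lemma pairing_sym: "pairing \<beta> \<gamma> = pairing \<gamma> \<beta>"
  unfolding pairing_def by (subst sum.swap) (simp add: cartan_sym mult_ac)

lemma pairing_add_left: "pairing (\<lambda>j. \<beta> j + \<beta>' j) \<gamma> = pairing \<beta> \<gamma> + pairing \<beta>' \<gamma>"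
  by (simp add: pairing_def sum.distrib algebra_simps)

lemma pairing_add_right: "pairing \<gamma> (\<lambda>j. \<beta> j + \<beta>' j) = pairing \<gamma> \<beta> + pairing \<gamma> \<beta>'"
  using pairing_add_left by (simp add: pairing_sym[of \<gamma>])

lemma two_T_pairing: "2 * T \<beta> = pairing \<beta> \<beta>"
  by (simp add: two_T pairing_def cartan_def)

lemma T_add: "T (\<lambda>j. \<beta> j + \<gamma> j) = T \<beta> + T \<gamma> + pairing \<beta> \<gamma>"
proof -
  have "2 * T (\<lambda>j. \<beta> j + \<gamma> j) = 2 * (T \<beta> + T \<gamma> + pairing \<beta> \<gamma>)"
    unfolding distrib_left two_T_pairing pairing_add_left pairing_add_right
    by (simp add: pairing_sym[of \<gamma> \<beta>])
  then show ?thesis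
    by simp
qed

text \<open>As a function of one coordinate the form is a^2 - a w up to a constant, the exponent
  that occurs in \<open>step\<close>, with w coming from the neighbours.\<close>

lemma T_update:
  assumes "\<beta> i = 0"
  shows "T (\<beta>(i := a)) = T \<beta> + (int a)\<^sup>2 - int a * int (\<Sum>j\<in>UNIV. e i j * \<beta> j)"
proof -
  let ?\<delta> = "\<lambda>j. if j = i then a else 0"
  have pair: "pairing \<gamma> ?\<delta> = (\<Sum>j\<in>UNIV. int (\<gamma> j) * cartan j i) * int a" for \<gamma>
    unfolding pairing_def by (simp add: sum_distrib_right if_distrib cong: if_cong)
  have "(\<Sum>j\<in>UNIV. int (?\<delta> j) * cartan j i) = 2 * int a"
    by (simp add: if_distrib[of int] if_distrib[of "\<lambda>x. x * _"] cartan_def cong: if_cong)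
  then have "2 * T ?\<delta> = 2 * (int a)\<^sup>2"
    unfolding two_T_pairing pair by (simp add: power2_eq_square)
  moreover have "(\<Sum>j\<in>UNIV. int (\<beta> j) * cartan j i) = - int (\<Sum>j\<in>UNIV. e i j * \<beta> j)"
    unfolding of_nat_sum sum_negf[symmetric]
    by (intro sum.cong refl) (use assms in \<open>auto simp: cartan_def e_sym e_irrefl\<close>)
  moreover have "\<beta>(i := a) = (\<lambda>j. \<beta> j + ?\<delta> j)"
    using assms by (simp add: fun_eq_iff)
  ultimately show ?thesis
    using T_add[of \<beta> ?\<delta>] by (simp add: pair)
qed

text \<open>The summand of Hua's sum r_\<nu>(z) in the overview. The factor for \<sigma> is the same
  expression at \<open>inverse z\<close> with zero framing.\<close>

definition family_weight :: "'a::field \<Rightarrow> ('i \<Rightarrow> nat) \<Rightarrow> nat \<Rightarrow> ('i \<Rightarrow> nat \<Rightarrow> nat) \<Rightarrow> 'a" where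
  "family_weight z n L \<pi> =
     z powi ((\<Sum>k<L. T (\<lambda>j. \<pi> j k)) - (\<Sum>j\<in>UNIV. int (n j) * int (\<pi> j 0))) *
     (\<Prod>k<L. \<Prod>j\<in>UNIV. 1 / qpoch z (\<pi> j k - \<pi> j (Suc k)))"

definition bracket :: "'a::field \<Rightarrow> int \<Rightarrow> nat \<Rightarrow> 'a" where
  "bracket z x m = (\<Prod>k=1..m. (1 - z powi (x + int k)) / (1 - z ^ k))"

definition fermionic_term :: "'a::field \<Rightarrow> ('i \<Rightarrow> nat) \<Rightarrow> nat \<Rightarrow> ('i \<Rightarrow> nat \<Rightarrow> nat) \<Rightarrow> 'a" where
  "fermionic_term z n L \<tau> = z powi (- (\<Sum>j\<in>UNIV. int (n j) * int (\<tau> j 0))) *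
     (\<Prod>k<L. z powi T (\<lambda>j. \<tau> j k) *
       (\<Prod>j\<in>UNIV. bracket z (int (n j) - (\<Sum>l\<le>k. \<Sum>m\<in>UNIV. cartan j m * int (\<tau> m l)))
         (\<tau> j k - \<tau> j (Suc k))))"

lemma bracket_expand:
  assumes "qparam z"
  shows "bracket z x m = (\<Sum>s\<le>m. z powi (x * int s) * (1 / qpoch (inverse z) s) * (1 / qpoch z (m - s)))"
proof -
  have nz: "z \<noteq> 0"
    by (rule qparam.p_nonzero[OF assms])
  have "bracket z x m = (\<Prod>k=1..m. (1 - z powi x * z ^ k) / (1 - z ^ k))"
    by (simp add: bracket_def power_int_add nz)
  also have "\<dots> = (\<Sum>s\<le>m. (z powi x) ^ s / (qpoch (inverse z) s * qpoch z (m - s)))"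
    by (rule qparam.bracket_expansion[OF assms])
  finally show ?thesis
    by (simp add: power_int_mult)
qed

text \<open>The decoupling is a cancellation of exponents. Abel summation turns the powers from the
  brackets into (\<nu>, \<sigma>_1) - sum_k (\<sigma>_k, \<tau>_k). For \<tau> = \<pi> + \<sigma>,
  adding T(\<tau>_k) and -(\<nu>, \<tau>_1) leaves T(\<pi>_k) - T(\<sigma>_k) and -(\<nu>, \<pi>_1),
  with no mixed term.\<close>

lemma fermionic_term_expand:
  assumes z: "qparam z" and \<tau>: "\<tau> \<in> families L"
  shows "fermionic_term z n L \<tau> = (\<Sum>\<sigma>\<in>{\<sigma> \<in> families L. \<forall>j. steps_le (\<sigma> j) (\<tau> j)}.
    family_weight z n L (\<lambda>j k. \<tau> j k - \<sigma> j k) * family_weight (inverse z) (\<lambda>_. 0) L \<sigma>)"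
proof -
  have nz: "z \<noteq> 0"
    by (rule qparam.p_nonzero[OF z])
  let ?N = "\<lambda>j k. int (n j) - (\<Sum>l\<le>k. \<Sum>m\<in>UNIV. cartan j m * int (\<tau> m l))"
  let ?m = "\<lambda>j k. \<tau> j k - \<tau> j (Suc k)"
  let ?h = "\<lambda>j k s. z powi (?N j k * int s) * (1 / qpoch (inverse z) s) * (1 / qpoch z (?m j k - s))"
  let ?c = "z powi ((\<Sum>k<L. T (\<lambda>j. \<tau> j k)) - (\<Sum>j\<in>UNIV. int (n j) * int (\<tau> j 0)))"
  have "fermionic_term z n L \<tau> = ?c * (\<Prod>k<L. \<Prod>j\<in>UNIV. \<Sum>s\<le>?m j k. ?h j k s)"
    unfolding fermionic_term_def prod.distrib bracket_expand[OF z]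
    by (simp add: power_int_diff power_int_minus power_int_sum nz field_simps)
  also have "\<dots> = (\<Sum>\<sigma>\<in>{\<sigma> \<in> families L. \<forall>j. steps_le (\<sigma> j) (\<tau> j)}.
      ?c * (\<Prod>k<L. \<Prod>j\<in>UNIV. ?h j k (\<sigma> j k - \<sigma> j (Suc k))))"
    unfolding prod_sum_families[OF \<tau>] sum_distrib_left ..
  also have "\<dots> = (\<Sum>\<sigma>\<in>{\<sigma> \<in> families L. \<forall>j. steps_le (\<sigma> j) (\<tau> j)}.
      family_weight z n L (\<lambda>j k. \<tau> j k - \<sigma> j k) * family_weight (inverse z) (\<lambda>_. 0) L \<sigma>)"
  proof (intro sum.cong refl)
    fix \<sigma> assume "\<sigma> \<in> {\<sigma> \<in> families L. \<forall>j. steps_le (\<sigma> j) (\<tau> j)}"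
    then have \<sigma>: "\<sigma> \<in> families L" and le: "\<And>j. steps_le (\<sigma> j) (\<tau> j)"
      by auto
    have bp: "\<sigma> j \<in> bounded_partitions L" "\<tau> j \<in> bounded_partitions L" for j
      using \<sigma> \<tau> by (simp_all add: families_def)
    define \<pi> where "\<pi> = (\<lambda>j k. \<tau> j k - \<sigma> j k)"
    have \<tau>_eq: "\<tau> j k = \<pi> j k + \<sigma> j k" for j k
      using steps_le_imp_le[OF le bp, of j k] by (simp add: \<pi>_def)
    have \<pi>: "\<pi> j \<in> bounded_partitions L" for j
      unfolding \<pi>_def by (rule steps_le_diff[OF le bp])
    have diff: "?m j k - (\<sigma> j k - \<sigma> j (Suc k)) = \<pi> j k - \<pi> j (Suc k)" for j k
      unfolding \<tau>_eq using bounded_partitions_Suc_le[OF \<pi>, of j k] bounded_partitions_Suc_le[OF bp(1), of j k]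
      by linarith
    have int_step: "int (\<sigma> j k - \<sigma> j (Suc k)) = int (\<sigma> j k) - int (\<sigma> j (Suc k))" for j k
      using bounded_partitions_Suc_le[OF bp(1), of j k] by simp
    \<comment> \<open>The boundary terms of both telescoping and Abel summation vanish by
      this.\<close>
    have zero: "\<sigma> j L = 0" for j
      using bounded_partitions_zero[OF bp(1), of L j] by simp
    have "(\<Sum>k<L. \<Sum>j\<in>UNIV. ?N j k * int (\<sigma> j k - \<sigma> j (Suc k))) =
        (\<Sum>j\<in>UNIV. \<Sum>k<L. int (n j) * (int (\<sigma> j k) - int (\<sigma> j (Suc k))) -
          (\<Sum>l\<le>k. \<Sum>m\<in>UNIV. cartan j m * int (\<tau> m l)) * (int (\<sigma> j k) - int (\<sigma> j (Suc k))))"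
      unfolding int_step left_diff_distrib by (rule sum.swap)
    also have "\<dots> = (\<Sum>j\<in>UNIV. int (n j) * int (\<sigma> j 0) -
        (\<Sum>l<L. (\<Sum>m\<in>UNIV. cartan j m * int (\<tau> m l)) * int (\<sigma> j l)))"
    proof (intro sum.cong refl)
      fix j
      have "(\<Sum>k<L. int (n j) * (int (\<sigma> j k) - int (\<sigma> j (Suc k)))) = int (n j) * int (\<sigma> j 0)"
        unfolding sum_distrib_left[symmetric] sum_lessThan_telescope'[of "\<lambda>k. int (\<sigma> j k)"]
        by (simp add: zero)
      moreover have "(\<Sum>k<L. (\<Sum>l\<le>k. \<Sum>m\<in>UNIV. cartan j m * int (\<tau> m l)) * (int (\<sigma> j k) - int (\<sigma> j (Suc k)))) =
          (\<Sum>l<L. (\<Sum>m\<in>UNIV. cartan j m * int (\<tau> m l)) * int (\<sigma> j l))"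
        using abel_summation[where s = "\<lambda>k. int (\<sigma> j k)"] by (simp add: zero)
      ultimately show "(\<Sum>k<L. int (n j) * (int (\<sigma> j k) - int (\<sigma> j (Suc k))) -
          (\<Sum>l\<le>k. \<Sum>m\<in>UNIV. cartan j m * int (\<tau> m l)) * (int (\<sigma> j k) - int (\<sigma> j (Suc k)))) =
          int (n j) * int (\<sigma> j 0) - (\<Sum>l<L. (\<Sum>m\<in>UNIV. cartan j m * int (\<tau> m l)) * int (\<sigma> j l))"
        by (simp only: sum_subtractf)
    qed
    also have "\<dots> = (\<Sum>j\<in>UNIV. int (n j) * int (\<sigma> j 0)) -
        (\<Sum>l<L. \<Sum>j\<in>UNIV. (\<Sum>m\<in>UNIV. cartan j m * int (\<tau> m l)) * int (\<sigma> j l))"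
      unfolding sum_subtractf by (subst (2) sum.swap) (rule refl)
    also have "(\<Sum>l<L. \<Sum>j\<in>UNIV. (\<Sum>m\<in>UNIV. cartan j m * int (\<tau> m l)) * int (\<sigma> j l)) =
        (\<Sum>l<L. pairing (\<lambda>j. \<sigma> j l) (\<lambda>j. \<tau> j l))"
      by (simp add: pairing_def sum_distrib_left sum_distrib_right mult_ac)
    finally have expo: "(\<Sum>k<L. \<Sum>j\<in>UNIV. ?N j k * int (\<sigma> j k - \<sigma> j (Suc k))) =
      (\<Sum>j\<in>UNIV. int (n j) * int (\<sigma> j 0)) - (\<Sum>l<L. pairing (\<lambda>j. \<sigma> j l) (\<lambda>j. \<tau> j l))" .
    \<comment> \<open>Here T(\<pi> + \<sigma>) contributes (\<pi>, \<sigma>), which cancels against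
      (\<sigma>, \<pi> + \<sigma>) = (\<sigma>, \<pi>) + 2 T(\<sigma>).\<close>
    have "T (\<lambda>j. \<tau> j k) - pairing (\<lambda>j. \<sigma> j k) (\<lambda>j. \<tau> j k) = T (\<lambda>j. \<pi> j k) - T (\<lambda>j. \<sigma> j k)" for k
      unfolding \<tau>_eq T_add pairing_add_right two_T_pairing[symmetric]
      by (simp add: pairing_sym[of "\<lambda>j. \<sigma> j k" "\<lambda>j. \<pi> j k"])
    then have T_eq: "(\<Sum>k<L. T (\<lambda>j. \<tau> j k)) - (\<Sum>l<L. pairing (\<lambda>j. \<sigma> j l) (\<lambda>j. \<tau> j l)) =
        (\<Sum>k<L. T (\<lambda>j. \<pi> j k)) - (\<Sum>k<L. T (\<lambda>j. \<sigma> j k))"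
      by (simp add: sum_subtractf[symmetric])
    have n_eq: "(\<Sum>j\<in>UNIV. int (n j) * int (\<tau> j 0)) =
        (\<Sum>j\<in>UNIV. int (n j) * int (\<pi> j 0)) + (\<Sum>j\<in>UNIV. int (n j) * int (\<sigma> j 0))"
      unfolding \<tau>_eq by (simp add: sum.distrib distrib_left)
    have pw: "(\<Prod>k<L. \<Prod>j\<in>UNIV. z powi (?N j k * int (\<sigma> j k - \<sigma> j (Suc k)))) =
        z powi (\<Sum>k<L. \<Sum>j\<in>UNIV. ?N j k * int (\<sigma> j k - \<sigma> j (Suc k)))"
      by (simp add: power_int_sum nz)
    have "?c * (\<Prod>k<L. \<Prod>j\<in>UNIV. ?h j k (\<sigma> j k - \<sigma> j (Suc k))) =
      (?c * z powi (\<Sum>k<L. \<Sum>j\<in>UNIV. ?N j k * int (\<sigma> j k - \<sigma> j (Suc k)))) *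
      (\<Prod>k<L. \<Prod>j\<in>UNIV. 1 / qpoch (inverse z) (\<sigma> j k - \<sigma> j (Suc k))) *
      (\<Prod>k<L. \<Prod>j\<in>UNIV. 1 / qpoch z (\<pi> j k - \<pi> j (Suc k)))"
      unfolding diff prod.distrib pw by (simp only: mult.assoc)
    also have "?c * z powi (\<Sum>k<L. \<Sum>j\<in>UNIV. ?N j k * int (\<sigma> j k - \<sigma> j (Suc k))) =
        z powi (((\<Sum>k<L. T (\<lambda>j. \<pi> j k)) - (\<Sum>j\<in>UNIV. int (n j) * int (\<pi> j 0))) + - (\<Sum>k<L. T (\<lambda>j. \<sigma> j k)))"
      unfolding expo power_int_add[OF disjI1[OF nz], symmetric] n_eq using T_eq
      by (intro arg_cong[of _ _ "power_int z"]) linarith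
    also have "\<dots> = z powi ((\<Sum>k<L. T (\<lambda>j. \<pi> j k)) - (\<Sum>j\<in>UNIV. int (n j) * int (\<pi> j 0))) *
        inverse z powi (\<Sum>k<L. T (\<lambda>j. \<sigma> j k))"
      unfolding power_int_add[OF disjI1[OF nz]] power_int_minus power_int_inverse ..
    finally show "?c * (\<Prod>k<L. \<Prod>j\<in>UNIV. ?h j k (\<sigma> j k - \<sigma> j (Suc k))) =
        family_weight z n L (\<lambda>j k. \<tau> j k - \<sigma> j k) * family_weight (inverse z) (\<lambda>_. 0) L \<sigma>"
      unfolding family_weight_def \<pi>_def by (simp add: mult_ac)
  qed
  finally show ?thesis .
qed

text \<open>The columns of the partition formed by the parts of the \<open>\<pi>\<^sup>j\<close> for all neighbours \<open>j\<close> of \<open>i\<close> together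
  with \<open>n i\<close> parts equal to 1.\<close>

definition vertex_columns :: "('i \<Rightarrow> nat) \<Rightarrow> 'i \<Rightarrow> ('i \<Rightarrow> nat \<Rightarrow> nat) \<Rightarrow> nat \<Rightarrow> nat" where
  "vertex_columns n i \<pi> k = (if k = 0 then n i else 0) + (\<Sum>j\<in>UNIV. e i j * \<pi> j k)"

text \<open>By \<open>T_update\<close> the exponent grows by the sum of a_k^2 - a_k w_k, where the
  framing term joins the column of index 0.\<close>

lemma family_weight_update:
  assumes z: "qparam z" and "L \<ge> 1" and \<pi>: "\<pi> i = (\<lambda>_. 0)"
  shows "family_weight z n L (\<pi>(i := a)) =
    family_weight z n L \<pi> * qparam.partition_weight z L (vertex_columns n i \<pi>) a"
proof -
  have nz: "z \<noteq> 0"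
    by (rule qparam.p_nonzero[OF z])
  obtain K where L: "L = Suc K"
    using \<open>L \<ge> 1\<close> by (cases L) auto
  have T: "T (\<lambda>j. (\<pi>(i := a)) j k) = T (\<lambda>j. \<pi> j k) +
      ((int (a k))\<^sup>2 - int (a k) * int (\<Sum>j\<in>UNIV. e i j * \<pi> j k))" for k
    using T_update[of "\<lambda>j. \<pi> j k" i "a k"] \<pi> by (simp add: fun_upd_def if_distrib[of "\<lambda>f. f k"] cong: if_cong)
  have n: "(\<Sum>j\<in>UNIV. int (n j) * int ((\<pi>(i := a)) j 0)) =
      (\<Sum>j\<in>UNIV. int (n j) * int (\<pi> j 0)) + int (n i) * int (a 0)"
  proof -
    have "int (n j) * int ((\<pi>(i := a)) j 0) = int (n j) * int (\<pi> j 0) + (if j = i then int (n i) * int (a 0) else 0)" for j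
      using \<pi> by simp
    then show ?thesis
      by (simp add: sum.distrib)
  qed
  have cols: "(\<Sum>k<L. int (a k) * int (vertex_columns n i \<pi> k)) =
      int (n i) * int (a 0) + (\<Sum>k<L. int (a k) * int (\<Sum>j\<in>UNIV. e i j * \<pi> j k))"
    unfolding L vertex_columns_def
    by (simp add: sum.lessThan_Suc_shift distrib_left mult.commute del: sum.lessThan_Suc of_nat_sum)
  have expo: "(\<Sum>k<L. T (\<lambda>j. (\<pi>(i := a)) j k)) - (\<Sum>j\<in>UNIV. int (n j) * int ((\<pi>(i := a)) j 0)) =
      ((\<Sum>k<L. T (\<lambda>j. \<pi> j k)) - (\<Sum>j\<in>UNIV. int (n j) * int (\<pi> j 0))) +
      (\<Sum>k<L. (int (a k))\<^sup>2 - int (a k) * int (vertex_columns n i \<pi> k))"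
    unfolding T n sum.distrib sum_subtractf cols by simp
  have "z powi ((int (a k))\<^sup>2 - int (a k) * int (vertex_columns n i \<pi> k)) =
      (1 / z ^ vertex_columns n i \<pi> k) ^ a k * z ^ (a k)\<^sup>2" for k
    unfolding power_int_diff[OF disjI1[OF nz]]
    by (simp add: power_divide flip: of_nat_power of_nat_mult power_mult) (simp add: mult.commute)
  then have pw: "z powi (\<Sum>k<L. (int (a k))\<^sup>2 - int (a k) * int (vertex_columns n i \<pi> k)) =
      (\<Prod>k<L. (1 / z ^ vertex_columns n i \<pi> k) ^ a k * z ^ (a k)\<^sup>2)"
    by (simp add: power_int_sum nz)
  have q: "(\<Prod>j\<in>UNIV. 1 / qpoch z ((\<pi>(i := a)) j k - (\<pi>(i := a)) j (Suc k))) =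
      1 / qpoch z (a k - a (Suc k)) * (\<Prod>j\<in>UNIV. 1 / qpoch z (\<pi> j k - \<pi> j (Suc k)))" for k
  proof -
    have "(\<Prod>j\<in>UNIV. 1 / qpoch z ((\<pi>(i := a)) j k - (\<pi>(i := a)) j (Suc k))) =
        (\<Prod>j\<in>UNIV. (if j = i then 1 / qpoch z (a k - a (Suc k)) else 1) * (1 / qpoch z (\<pi> j k - \<pi> j (Suc k))))"
      using \<pi> by (intro prod.cong refl) simp
    then show ?thesis
      unfolding prod.distrib by simp
  qed
  show ?thesis
    unfolding family_weight_def expo power_int_add[OF disjI1[OF nz]] pw q
      qparam.partition_weight_def[OF z] prod.distrib
    by (simp add: divide_inverse prod.distrib mult_ac)
qed

end

section \<open>Families of given total size, and separating one vertex\<close>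

definition size_of :: "nat \<Rightarrow> ('i \<Rightarrow> nat \<Rightarrow> nat) \<Rightarrow> 'i \<Rightarrow> nat" where
  "size_of L \<tau> j = (\<Sum>k<L. \<tau> j k)"

definition families_of :: "nat \<Rightarrow> ('i \<Rightarrow> nat) \<Rightarrow> ('i \<Rightarrow> nat \<Rightarrow> nat) set" where
  "families_of L \<alpha> = {\<tau> \<in> families L. size_of L \<tau> = \<alpha>}"

definition family_pairs_of :: "nat \<Rightarrow> ('i \<Rightarrow> nat) \<Rightarrow> (('i \<Rightarrow> nat \<Rightarrow> nat) \<times> ('i \<Rightarrow> nat \<Rightarrow> nat)) set" where
  "family_pairs_of L \<alpha> =
    {(\<pi>, \<sigma>). \<pi> \<in> families L \<and> \<sigma> \<in> families L \<and> (\<forall>j. size_of L \<pi> j + size_of L \<sigma> j = \<alpha> j)}"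

text \<open>There is no size condition at i, so the set is the same for \<alpha> and its reflection,
  and their sums can be compared term by term.\<close>

definition family_pairs_off ::
  "nat \<Rightarrow> ('i \<Rightarrow> nat) \<Rightarrow> 'i \<Rightarrow> (('i \<Rightarrow> nat \<Rightarrow> nat) \<times> ('i \<Rightarrow> nat \<Rightarrow> nat)) set" where
  "family_pairs_off L \<alpha> i = {(\<pi>, \<sigma>). \<pi> \<in> families L \<and> \<sigma> \<in> families L \<and> \<pi> i = (\<lambda>_. 0) \<and> \<sigma> i = (\<lambda>_. 0) \<and>
    (\<forall>j. j \<noteq> i \<longrightarrow> size_of L \<pi> j + size_of L \<sigma> j = \<alpha> j)}"

lemma finite_families_le:
  fixes \<alpha> :: "'i::finite \<Rightarrow> nat"
  shows "finite {\<tau> \<in> families L. \<forall>j. size_of L \<tau> j \<le> \<alpha> j}"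
proof (rule finite_subset)
  show "{\<tau> \<in> families L. \<forall>j. size_of L \<tau> j \<le> \<alpha> j} \<subseteq> PiE UNIV (\<lambda>j. \<Union>m\<le>\<alpha> j. partitions_of L m)"
    by (auto simp: families_def partitions_of_def size_of_def)
  show "finite (PiE UNIV (\<lambda>j. \<Union>m\<le>\<alpha> j. partitions_of L m))"
    by (intro finite_PiE) (auto intro: finite_partitions_of)
qed

lemma finite_families_of: "finite (families_of L (\<alpha> :: 'i::finite \<Rightarrow> nat))"
  by (rule finite_subset[OF _ finite_families_le[of L \<alpha>]]) (auto simp: families_of_def)

lemma size_of_diff:
  assumes "\<sigma> \<in> families L" "\<tau> \<in> families L" "steps_le (\<sigma> j) (\<tau> j)"
  shows "size_of L (\<lambda>j k. \<tau> j k - \<sigma> j k) j + size_of L \<sigma> j = size_of L \<tau> j"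
proof -
  have "\<sigma> j k \<le> \<tau> j k" for k
    using assms steps_le_imp_le[OF assms(3), of L k] by (simp add: families_def)
  then show ?thesis
    unfolding size_of_def sum.distrib[symmetric] by simp
qed

text \<open>With \<pi> = \<tau> - \<sigma> the condition \<open>steps_le\<close> only says that
  \<pi> consists of partitions, so the two families become independent up to total size.\<close>

lemma sum_families_steps_le:
  fixes f :: "('i::finite \<Rightarrow> nat \<Rightarrow> nat) \<Rightarrow> ('i \<Rightarrow> nat \<Rightarrow> nat) \<Rightarrow> 'b::comm_monoid_add"
  shows "(\<Sum>\<tau>\<in>families_of L \<alpha>. \<Sum>\<sigma>\<in>{\<sigma> \<in> families L. \<forall>j. steps_le (\<sigma> j) (\<tau> j)}. f (\<lambda>j k. \<tau> j k - \<sigma> j k) \<sigma>) =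
    (\<Sum>(\<pi>, \<sigma>)\<in>family_pairs_of L \<alpha>. f \<pi> \<sigma>)"
proof -
  let ?D = "\<lambda>\<tau>. {\<sigma> \<in> families L. \<forall>j. steps_le (\<sigma> j) (\<tau> j)}"
  have "finite (?D \<tau>)" if "\<tau> \<in> families_of L \<alpha>" for \<tau>
  proof (rule finite_subset[OF _ finite_families_le[of L \<alpha>]])
    show "?D \<tau> \<subseteq> {\<tau> \<in> families L. \<forall>j. size_of L \<tau> j \<le> \<alpha> j}"
    proof
      fix \<sigma> assume "\<sigma> \<in> ?D \<tau>"
      then have \<sigma>: "\<sigma> \<in> families L" "\<And>j. steps_le (\<sigma> j) (\<tau> j)"
        by auto
      have "\<tau> \<in> families L" "size_of L \<tau> = \<alpha>"
        using that by (auto simp: families_of_def)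
      then have "size_of L \<sigma> j \<le> \<alpha> j" for j
        using size_of_diff[of \<sigma> L \<tau> j] \<sigma> by simp
      then show "\<sigma> \<in> {\<tau> \<in> families L. \<forall>j. size_of L \<tau> j \<le> \<alpha> j}"
        using \<sigma>(1) by simp
    qed
  qed
  then have "(\<Sum>\<tau>\<in>families_of L \<alpha>. \<Sum>\<sigma>\<in>?D \<tau>. f (\<lambda>j k. \<tau> j k - \<sigma> j k) \<sigma>) =
      (\<Sum>(\<tau>, \<sigma>)\<in>(SIGMA \<tau>:families_of L \<alpha>. ?D \<tau>). f (\<lambda>j k. \<tau> j k - \<sigma> j k) \<sigma>)"
    by (intro sum.Sigma) (auto simp: finite_families_of)
  also have "\<dots> = (\<Sum>(\<pi>, \<sigma>)\<in>family_pairs_of L \<alpha>. f \<pi> \<sigma>)"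
  proof (rule sum.reindex_bij_witness[of _ "\<lambda>(\<pi>, \<sigma>). (\<lambda>j k. \<pi> j k + \<sigma> j k, \<sigma>)" "\<lambda>(\<tau>, \<sigma>). (\<lambda>j k. \<tau> j k - \<sigma> j k, \<sigma>)"])
    fix x assume "x \<in> (SIGMA \<tau>:families_of L \<alpha>. ?D \<tau>)"
    then obtain \<tau> \<sigma> where x: "x = (\<tau>, \<sigma>)" and \<tau>: "\<tau> \<in> families L" "size_of L \<tau> = \<alpha>"
      and \<sigma>: "\<sigma> \<in> families L" and le: "\<And>j. steps_le (\<sigma> j) (\<tau> j)"
      by (auto simp: families_of_def)
    have bp: "\<sigma> j \<in> bounded_partitions L" "\<tau> j \<in> bounded_partitions L" for j
      using \<sigma> \<tau> by (simp_all add: families_def)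
    have "\<tau> j k - \<sigma> j k + \<sigma> j k = \<tau> j k" for j k
      using steps_le_imp_le[OF le bp, of j k] by simp
    then show "(case case x of (\<tau>, \<sigma>) \<Rightarrow> (\<lambda>j k. \<tau> j k - \<sigma> j k, \<sigma>) of (\<pi>, \<sigma>) \<Rightarrow> (\<lambda>j k. \<pi> j k + \<sigma> j k, \<sigma>)) = x"
      by (simp add: x)
    have "(\<lambda>j k. \<tau> j k - \<sigma> j k) \<in> families L"
      using steps_le_diff[OF le bp] by (simp add: families_def)
    then show "(case x of (\<tau>, \<sigma>) \<Rightarrow> (\<lambda>j k. \<tau> j k - \<sigma> j k, \<sigma>)) \<in> family_pairs_of L \<alpha>"
      using \<sigma> \<tau> le size_of_diff[of \<sigma> L \<tau>] by (simp add: x family_pairs_of_def)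
    show "(case case x of (\<tau>, \<sigma>) \<Rightarrow> (\<lambda>j k. \<tau> j k - \<sigma> j k, \<sigma>) of (\<pi>, \<sigma>) \<Rightarrow> f \<pi> \<sigma>) =
        (case x of (\<tau>, \<sigma>) \<Rightarrow> f (\<lambda>j k. \<tau> j k - \<sigma> j k) \<sigma>)"
      by (simp add: x)
  next
    fix x assume "x \<in> family_pairs_of L \<alpha>"
    then obtain \<pi> \<sigma> where x: "x = (\<pi>, \<sigma>)" "\<pi> \<in> families L" "\<sigma> \<in> families L"
      "\<And>j. size_of L \<pi> j + size_of L \<sigma> j = \<alpha> j"
      by (auto simp: family_pairs_of_def)
    show "(case case x of (\<pi>, \<sigma>) \<Rightarrow> (\<lambda>j k. \<pi> j k + \<sigma> j k, \<sigma>) of (\<tau>, \<sigma>) \<Rightarrow> (\<lambda>j k. \<tau> j k - \<sigma> j k, \<sigma>)) = x"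
      by (simp add: x)
    have "size_of L (\<lambda>j k. \<pi> j k + \<sigma> j k) = \<alpha>"
      using x(4) by (simp add: fun_eq_iff size_of_def sum.distrib)
    then show "(case x of (\<pi>, \<sigma>) \<Rightarrow> (\<lambda>j k. \<pi> j k + \<sigma> j k, \<sigma>)) \<in> (SIGMA \<tau>:families_of L \<alpha>. ?D \<tau>)"
      using x(2,3) by (auto simp: x(1) families_of_def families_def intro: bounded_partitions_add steps_le_add)
  qed
  finally show ?thesis .
qed

lemma size_of_update: "size_of L (\<pi>(i := a)) j = (if j = i then \<Sum>k<L. a k else size_of L \<pi> j)"
  by (simp add: size_of_def)

lemma families_update: "\<pi> \<in> families L \<Longrightarrow> a \<in> bounded_partitions L \<Longrightarrow> \<pi>(i := a) \<in> families L"
  by (simp add: families_def)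

lemma sum_family_pairs_split:
  fixes f :: "('i::finite \<Rightarrow> nat \<Rightarrow> nat) \<Rightarrow> ('i \<Rightarrow> nat \<Rightarrow> nat) \<Rightarrow> 'b::comm_monoid_add"
  shows "(\<Sum>(\<pi>, \<sigma>)\<in>family_pairs_of L \<alpha>. f \<pi> \<sigma>) = (\<Sum>(\<pi>, \<sigma>)\<in>family_pairs_off L \<alpha> i.
    \<Sum>m\<le>\<alpha> i. \<Sum>a\<in>partitions_of L m. \<Sum>b\<in>partitions_of L (\<alpha> i - m). f (\<pi>(i := a)) (\<sigma>(i := b)))"
proof -
  let ?C = "SIGMA m:{..\<alpha> i}. partitions_of L m \<times> partitions_of L (\<alpha> i - m)"
  have "(\<Sum>(\<pi>, \<sigma>)\<in>family_pairs_off L \<alpha> i.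
      \<Sum>m\<le>\<alpha> i. \<Sum>a\<in>partitions_of L m. \<Sum>b\<in>partitions_of L (\<alpha> i - m). f (\<pi>(i := a)) (\<sigma>(i := b))) =
    (\<Sum>x\<in>family_pairs_off L \<alpha> i. \<Sum>y\<in>?C. f ((fst x)(i := fst (snd y))) ((snd x)(i := snd (snd y))))"
    by (simp add: sum.Sigma finite_partitions_of case_prod_beta sum.cartesian_product)
  also have "\<dots> = (\<Sum>(x, y)\<in>family_pairs_off L \<alpha> i \<times> ?C. f ((fst x)(i := fst (snd y))) ((snd x)(i := snd (snd y))))"
    by (rule sum.cartesian_product)
  also have "\<dots> = (\<Sum>(\<pi>, \<sigma>)\<in>family_pairs_of L \<alpha>. f \<pi> \<sigma>)"
  proof (rule sum.reindex_bij_witness[of _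
      "\<lambda>(\<pi>, \<sigma>). ((\<pi>(i := \<lambda>_. 0), \<sigma>(i := \<lambda>_. 0)), (size_of L \<pi> i, (\<pi> i, \<sigma> i)))"
      "\<lambda>(x, y). ((fst x)(i := fst (snd y)), (snd x)(i := snd (snd y)))"])
    fix z assume "z \<in> family_pairs_off L \<alpha> i \<times> ?C"
    then obtain \<pi> \<sigma> m a b where z: "z = ((\<pi>, \<sigma>), (m, (a, b)))"
      and fam: "\<pi> \<in> families L" "\<sigma> \<in> families L" "\<pi> i = (\<lambda>_. 0)" "\<sigma> i = (\<lambda>_. 0)"
        "\<And>j. j \<noteq> i \<Longrightarrow> size_of L \<pi> j + size_of L \<sigma> j = \<alpha> j"
      and ab: "m \<le> \<alpha> i" "a \<in> bounded_partitions L" "b \<in> bounded_partitions L"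
        "(\<Sum>k<L. a k) = m" "(\<Sum>k<L. b k) = \<alpha> i - m"
      by (auto simp: family_pairs_off_def partitions_of_def)
    show "(case case z of (x, y) \<Rightarrow> ((fst x)(i := fst (snd y)), (snd x)(i := snd (snd y))) of
        (\<pi>, \<sigma>) \<Rightarrow> ((\<pi>(i := \<lambda>_. 0), \<sigma>(i := \<lambda>_. 0)), (size_of L \<pi> i, (\<pi> i, \<sigma> i)))) = z"
      using fam(3,4) ab(4) by (simp add: z size_of_update) (metis fun_upd_triv)
    show "(case z of (x, y) \<Rightarrow> ((fst x)(i := fst (snd y)), (snd x)(i := snd (snd y)))) \<in> family_pairs_of L \<alpha>"
      using fam ab by (simp add: z family_pairs_of_def families_update size_of_update)
    show "(case case z of (x, y) \<Rightarrow> ((fst x)(i := fst (snd y)), (snd x)(i := snd (snd y))) of (\<pi>, \<sigma>) \<Rightarrow> f \<pi> \<sigma>) =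
        (case z of (x, y) \<Rightarrow> f ((fst x)(i := fst (snd y))) ((snd x)(i := snd (snd y))))"
      by (simp add: z)
  next
    fix x assume "x \<in> family_pairs_of L \<alpha>"
    then obtain \<pi> \<sigma> where x: "x = (\<pi>, \<sigma>)" and fam: "\<pi> \<in> families L" "\<sigma> \<in> families L"
      and size: "\<And>j. size_of L \<pi> j + size_of L \<sigma> j = \<alpha> j"
      by (auto simp: family_pairs_of_def)
    show "(case case x of (\<pi>, \<sigma>) \<Rightarrow> ((\<pi>(i := \<lambda>_. 0), \<sigma>(i := \<lambda>_. 0)), (size_of L \<pi> i, (\<pi> i, \<sigma> i))) of
        (x, y) \<Rightarrow> ((fst x)(i := fst (snd y)), (snd x)(i := snd (snd y)))) = x"
      by (simp add: x)
    have zero: "(\<lambda>_. 0) \<in> bounded_partitions L"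
      by (simp add: bounded_partitions_def antimono_def)
    have "\<pi> i \<in> partitions_of L (size_of L \<pi> i)" "\<sigma> i \<in> partitions_of L (\<alpha> i - size_of L \<pi> i)"
      using fam size[of i] by (auto simp: partitions_of_def families_def size_of_def)
    moreover have "size_of L \<pi> i \<le> \<alpha> i"
      using size[of i] by simp
    ultimately show "(case x of (\<pi>, \<sigma>) \<Rightarrow> ((\<pi>(i := \<lambda>_. 0), \<sigma>(i := \<lambda>_. 0)), (size_of L \<pi> i, (\<pi> i, \<sigma> i)))) \<in>
        family_pairs_off L \<alpha> i \<times> ?C"
      using fam size zero
      by (auto simp: x family_pairs_off_def families_update size_of_update)
  qed
  finally show ?thesis ..
qed

section \<open>Reflection of one coordinate\<close>

context graph_form
begin

definition fermionic_sum :: "'a::field \<Rightarrow> ('i \<Rightarrow> nat) \<Rightarrow> nat \<Rightarrow> ('i \<Rightarrow> nat) \<Rightarrow> 'a" where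
  "fermionic_sum z n L \<alpha> = (\<Sum>\<tau>\<in>families_of L \<alpha>. fermionic_term z n L \<tau>)"

definition vertex_series :: "'a::field \<Rightarrow> ('i \<Rightarrow> nat) \<Rightarrow> nat \<Rightarrow> 'i \<Rightarrow> ('i \<Rightarrow> nat \<Rightarrow> nat) \<Rightarrow> 'a fps" where
  "vertex_series z n L i \<pi> = qparam.hom_series z (map (vertex_columns n i \<pi>) [0..<L])"

text \<open>Only the sum of the sizes of \<pi>^i and \<sigma>^i is fixed, so the inner sum is a
  Cauchy product. The bound \<open>\<alpha> i \<le> L\<close> lets
  \<open>hom_series_nth_partitions\<close> compute every coefficient in it.\<close>

lemma fermionic_sum_expand:
  fixes z :: "'a::field"
  assumes z: "qparam z" and "L \<ge> 1" and "\<alpha> i \<le> L"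
  shows "fermionic_sum z n L \<alpha> = (\<Sum>(\<pi>, \<sigma>)\<in>family_pairs_off L \<alpha> i.
    family_weight z n L \<pi> * family_weight (inverse z) (\<lambda>_. 0) L \<sigma> *
    (vertex_series z n L i \<pi> * vertex_series (inverse z) (\<lambda>_. 0) L i \<sigma>) $ \<alpha> i)"
proof -
  interpret z: qparam z by fact
  interpret z': qparam "inverse z" by (rule z.qparam_inverse)
  have "fermionic_sum z n L \<alpha> = (\<Sum>\<tau>\<in>families_of L \<alpha>. \<Sum>\<sigma>\<in>{\<sigma> \<in> families L. \<forall>j. steps_le (\<sigma> j) (\<tau> j)}.
      family_weight z n L (\<lambda>j k. \<tau> j k - \<sigma> j k) * family_weight (inverse z) (\<lambda>_. 0) L \<sigma>)"
    unfolding fermionic_sum_def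
    by (intro sum.cong refl fermionic_term_expand z) (simp add: families_of_def)
  also have "\<dots> = (\<Sum>(\<pi>, \<sigma>)\<in>family_pairs_of L \<alpha>. family_weight z n L \<pi> * family_weight (inverse z) (\<lambda>_. 0) L \<sigma>)"
    by (rule sum_families_steps_le)
  also have "\<dots> = (\<Sum>(\<pi>, \<sigma>)\<in>family_pairs_off L \<alpha> i.
      \<Sum>m\<le>\<alpha> i. \<Sum>a\<in>partitions_of L m. \<Sum>b\<in>partitions_of L (\<alpha> i - m).
      family_weight z n L (\<pi>(i := a)) * family_weight (inverse z) (\<lambda>_. 0) L (\<sigma>(i := b)))"
    by (rule sum_family_pairs_split)
  also have "\<dots> = (\<Sum>(\<pi>, \<sigma>)\<in>family_pairs_off L \<alpha> i.
    family_weight z n L \<pi> * family_weight (inverse z) (\<lambda>_. 0) L \<sigma> *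
    (vertex_series z n L i \<pi> * vertex_series (inverse z) (\<lambda>_. 0) L i \<sigma>) $ \<alpha> i)"
  proof (intro sum.cong refl, clarify)
    fix \<pi> \<sigma> assume "(\<pi>, \<sigma>) \<in> family_pairs_off L \<alpha> i"
    then have 0: "\<pi> i = (\<lambda>_. 0)" "\<sigma> i = (\<lambda>_. 0)"
      by (auto simp: family_pairs_off_def)
    let ?W = "vertex_columns n i \<pi>" and ?V = "vertex_columns (\<lambda>_. 0) i \<sigma>"
    let ?c = "family_weight z n L \<pi> * family_weight (inverse z) (\<lambda>_. 0) L \<sigma>"
    have "(\<Sum>m\<le>\<alpha> i. \<Sum>a\<in>partitions_of L m. \<Sum>b\<in>partitions_of L (\<alpha> i - m).
      family_weight z n L (\<pi>(i := a)) * family_weight (inverse z) (\<lambda>_. 0) L (\<sigma>(i := b))) =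
      (\<Sum>m\<le>\<alpha> i. \<Sum>a\<in>partitions_of L m. \<Sum>b\<in>partitions_of L (\<alpha> i - m).
      ?c * (z.partition_weight L ?W a * z'.partition_weight L ?V b))"
      unfolding family_weight_update[OF z \<open>L \<ge> 1\<close>, of \<pi> i, OF 0(1)]
        family_weight_update[OF z.qparam_inverse \<open>L \<ge> 1\<close>, of \<sigma> i, OF 0(2)]
      by (simp only: mult_ac)
    also have "\<dots> = (\<Sum>m\<le>\<alpha> i. ?c * ((\<Sum>a\<in>partitions_of L m. z.partition_weight L ?W a) *
        (\<Sum>b\<in>partitions_of L (\<alpha> i - m). z'.partition_weight L ?V b)))"
      unfolding sum_product unfolding sum_distrib_left ..
    also have "\<dots> = (\<Sum>m\<le>\<alpha> i. ?c * (vertex_series z n L i \<pi> $ m * vertex_series (inverse z) (\<lambda>_. 0) L i \<sigma> $ (\<alpha> i - m)))"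
      unfolding vertex_series_def using assms(2,3)
      by (intro sum.cong refl) (simp add: z.hom_series_nth_partitions z'.hom_series_nth_partitions)
    also have "\<dots> = ?c * (vertex_series z n L i \<pi> * vertex_series (inverse z) (\<lambda>_. 0) L i \<sigma>) $ \<alpha> i"
      by (simp only: fps_mult_nth sum_distrib_left atMost_atLeast0)
    finally show "(\<Sum>m\<le>\<alpha> i. \<Sum>a\<in>partitions_of L m. \<Sum>b\<in>partitions_of L (\<alpha> i - m).
      family_weight z n L (\<pi>(i := a)) * family_weight (inverse z) (\<lambda>_. 0) L (\<sigma>(i := b))) =
      ?c * (vertex_series z n L i \<pi> * vertex_series (inverse z) (\<lambda>_. 0) L i \<sigma>) $ \<alpha> i" .
  qed
  finally show ?thesis .
qed

lemma sorted_vertex_columns: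
  assumes "\<pi> \<in> families L"
  shows "sorted_wrt (\<ge>) (map (vertex_columns n i \<pi>) [0..<L])"
proof -
  have "vertex_columns n i \<pi> k' \<le> vertex_columns n i \<pi> k" if "k \<le> k'" for k k'
    unfolding vertex_columns_def
    by (intro add_mono sum_mono mult_left_mono)
      (use that assms in \<open>auto simp: families_def bounded_partitions_def antimono_def\<close>)
  then show ?thesis
    by (simp add: sorted_wrt_iff_nth_less)
qed

lemma sum_vertex_columns:
  assumes "L \<ge> 1"
  shows "sum_list (map (vertex_columns n i \<pi>) [0..<L]) = n i + (\<Sum>j\<in>UNIV. e i j * size_of L \<pi> j)"
proof -
  obtain K where L: "L = Suc K"
    using assms by (cases L) auto
  have "sum_list (map (vertex_columns n i \<pi>) [0..<L]) = (\<Sum>k<L. vertex_columns n i \<pi> k)"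
    by (simp add: sum_list_sum_nth atLeast0LessThan)
  also have "\<dots> = n i + (\<Sum>k<L. \<Sum>j\<in>UNIV. e i j * \<pi> j k)"
    unfolding vertex_columns_def sum.distrib by (simp add: L)
  also have "(\<Sum>k<L. \<Sum>j\<in>UNIV. e i j * \<pi> j k) = (\<Sum>j\<in>UNIV. e i j * size_of L \<pi> j)"
    unfolding size_of_def sum_distrib_left by (rule sum.swap)
  finally show ?thesis .
qed

text \<open>The two lists of columns have sums depending on \<pi> and \<sigma>, but their total
  involves only the sizes \<alpha>_j. Hence all summands share one centre; the coordinate at i does
  not enter, as \<open>e i i = 0\<close>.\<close>

lemma vertex_series_antisymmetric:
  fixes z :: "'a::field" and n :: "'i \<Rightarrow> nat"
  assumes z: "qparam z" and L: "L \<ge> 1" and mem: "(\<pi>, \<sigma>) \<in> family_pairs_off L \<alpha> i"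
  defines "d \<equiv> n i + (\<Sum>j\<in>UNIV. e i j * \<alpha> j)"
    and "G \<equiv> vertex_series z n L i \<pi> * vertex_series (inverse z) (\<lambda>_. 0) L i \<sigma>"
  shows "m \<le> Suc d \<Longrightarrow> G $ (Suc d - m) = - G $ m"
    and "m > Suc d \<Longrightarrow> G $ m = 0"
proof -
  let ?ws = "map (vertex_columns n i \<pi>) [0..<L]" and ?vs = "map (vertex_columns (\<lambda>_. 0) i \<sigma>) [0..<L]"
  have fam: "\<pi> \<in> families L" "\<sigma> \<in> families L"
    and size: "\<And>j. j \<noteq> i \<Longrightarrow> size_of L \<pi> j + size_of L \<sigma> j = \<alpha> j"
    using mem by (auto simp: family_pairs_off_def)
  have "e i j * size_of L \<pi> j + e i j * size_of L \<sigma> j = e i j * \<alpha> j" for j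
    using size[of j] e_irrefl[of i] by (cases "j = i") (simp_all flip: distrib_left)
  then have d: "d = sum_list ?ws + sum_list ?vs"
    by (simp add: d_def sum_vertex_columns[OF L] flip: sum.distrib)
  have ne: "?ws \<noteq> []" "?vs \<noteq> []"
    using L by auto
  note * = hom_series_mult_antisymmetric[OF z ne(1) sorted_vertex_columns[OF fam(1)] ne(2) sorted_vertex_columns[OF fam(2)],
      folded d, folded vertex_series_def, folded G_def]
  show "m \<le> Suc d \<Longrightarrow> G $ (Suc d - m) = - G $ m"
    by (rule *(1))
  show "m > Suc d \<Longrightarrow> G $ m = 0"
    by (rule *(2))
qed

lemma family_pairs_off_cong:
  assumes "\<And>j. j \<noteq> i \<Longrightarrow> \<alpha> j = \<alpha>' j"
  shows "family_pairs_off L \<alpha> i = family_pairs_off L \<alpha>' i"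
  using assms by (auto simp: family_pairs_off_def)

theorem fermionic_sum_antisymmetric:
  assumes z: "qparam z" and L: "L \<ge> 1" "\<alpha> i \<le> L" "\<alpha>' i \<le> L"
    and off: "\<And>j. j \<noteq> i \<Longrightarrow> \<alpha>' j = \<alpha> j"
    and d: "\<alpha> i + \<alpha>' i = Suc (n i + (\<Sum>j\<in>UNIV. e i j * \<alpha> j))"
  shows "fermionic_sum z n L \<alpha>' = - fermionic_sum z n L \<alpha>"
proof -
  have *: "\<alpha>' i = Suc (n i + (\<Sum>j\<in>UNIV. e i j * \<alpha> j)) - \<alpha> i" "\<alpha> i \<le> Suc (n i + (\<Sum>j\<in>UNIV. e i j * \<alpha> j))"
    using d by simp_all
  show ?thesis
    unfolding fermionic_sum_expand[of z L \<alpha> i, OF z L(1) L(2)]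
      fermionic_sum_expand[of z L \<alpha>' i, OF z L(1) L(3)] sum_negf[symmetric]
  proof (rule sum.cong)
    show "family_pairs_off L \<alpha>' i = family_pairs_off L \<alpha> i"
      by (rule family_pairs_off_cong) (rule off)
    fix x assume "x \<in> family_pairs_off L \<alpha> i"
    then show "(case x of (\<pi>, \<sigma>) \<Rightarrow> family_weight z n L \<pi> * family_weight (inverse z) (\<lambda>_. 0) L \<sigma> *
          (vertex_series z n L i \<pi> * vertex_series (inverse z) (\<lambda>_. 0) L i \<sigma>) $ \<alpha>' i) =
        - (case x of (\<pi>, \<sigma>) \<Rightarrow> family_weight z n L \<pi> * family_weight (inverse z) (\<lambda>_. 0) L \<sigma> *
          (vertex_series z n L i \<pi> * vertex_series (inverse z) (\<lambda>_. 0) L i \<sigma>) $ \<alpha> i)"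
      using vertex_series_antisymmetric(1)[where n = n and m = "\<alpha> i" and \<alpha> = \<alpha> and i = i, OF z L(1) _ *(2),
          where \<pi> = "fst x" and \<sigma> = "snd x"]
      by (simp add: case_prod_beta *(1))
  qed
qed

text \<open>The case in which the reflected coordinate is negative: the coefficient lies beyond the
  degree of each product of vertex series.\<close>

theorem fermionic_sum_vanishes:
  assumes z: "qparam z" and L: "L \<ge> 1" "\<alpha> i \<le> L"
    and d: "\<alpha> i > Suc (n i + (\<Sum>j\<in>UNIV. e i j * \<alpha> j))"
  shows "fermionic_sum z n L \<alpha> = 0"
  unfolding fermionic_sum_expand[of z L \<alpha> i, OF z L]
  by (intro sum.neutral) (use vertex_series_antisymmetric(2)[where n = n and m = "\<alpha> i" and \<alpha> = \<alpha> and i = i, OF z L(1) _ d] in auto)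

end

unbundle no fps_syntax and vec_syntax

section \<open>Nondegeneracy of the Cartan matrix\<close>

lemma A_edges_iff: "{a, b} \<in> A_edges n \<longleftrightarrow> (1 \<le> a \<and> a < n \<and> b = Suc a) \<or> (1 \<le> b \<and> b < n \<and> a = Suc b)"
  by (auto simp: A_edges_def doubleton_eq_iff)

lemma D_edges_iff: "{a, b} \<in> D_edges n \<longleftrightarrow>
    (1 \<le> a \<and> Suc a < n \<and> b = Suc a) \<or> (1 \<le> b \<and> Suc b < n \<and> a = Suc b) \<or>
    (a = n - 2 \<and> b = n) \<or> (b = n - 2 \<and> a = n)"
  by (auto simp: D_edges_def doubleton_eq_iff)

lemma E_edges_iff: "{a, b} \<in> E_edges n \<longleftrightarrow>
    (a, b) \<in> {(1, 3), (3, 1), (2, 4), (4, 2)} \<or>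
    (3 \<le> a \<and> a < n \<and> b = Suc a) \<or> (3 \<le> b \<and> b < n \<and> a = Suc b)"
  by (auto simp: E_edges_def doubleton_eq_iff)

lemma linear_recurrence:
  fixes z :: "nat \<Rightarrow> real"
  assumes "z 0 = 0" and "\<And>k. 1 \<le> k \<Longrightarrow> k < N \<Longrightarrow> 2 * z k = z (k - 1) + z (k + 1)" and "k \<le> N"
  shows "z k = of_nat k * z 1"
  using assms(3)
proof (induction k rule: less_induct)
  case (less k)
  consider "k = 0" | "k = 1" | m where "k = Suc (Suc m)"
    by (metis One_nat_def not0_implies_Suc)
  then show ?case
  proof cases
    case 3
    then have "z (Suc m) = of_nat (Suc m) * z 1" "z m = of_nat m * z 1"
      using less.IH[of "Suc m"] less.IH[of m] less.prems by linarith+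
    moreover have "2 * z (Suc m) = z m + z k"
      using assms(2)[of "Suc m"] less.prems 3 by simp
    ultimately show ?thesis
      using 3 by (simp add: algebra_simps)
  qed (use assms(1) in simp_all)
qed

text \<open>A kernel vector is linear along each chain of the diagram in types A and D, and the
  conditions at the ends and the branch vertex make it zero. Real entries allow linear arithmetic
  for type E; complex vectors are treated by real and imaginary parts.\<close>

lemma dynkin_nondegenerate:
  fixes y :: "nat \<Rightarrow> real"
  assumes "simply_laced_dynkin n E"
    and y: "\<And>k. k \<in> {1..n} \<Longrightarrow> 2 * y k = (\<Sum>m\<in>{1..n}. if {k, m} \<in> E then y m else 0)"
    and "k \<in> {1..n}"
  shows "y k = 0"
  using assms(1)
proof cases
  case A
  \<comment> \<open>Extension by 0 makes the equations at the two end vertices instances of the same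
    recurrence, with boundary values at 0 and n + 1.\<close>
  define z where "z = (\<lambda>k. if k \<in> {1..n} then y k else 0)"
  have "2 * z j = z (j - 1) + z (j + 1)" if "1 \<le> j" "j < Suc n" for j
  proof -
    have "(\<Sum>m\<in>{1..n}. if {j, m} \<in> E then y m else 0) =
        (\<Sum>m\<in>{1..n}. (if m = j - 1 then z m else 0) + (if m = j + 1 then z m else 0))"
      using that by (intro sum.cong refl) (auto simp: A A_edges_iff z_def)
    also have "\<dots> = z (j - 1) + z (j + 1)"
      using that by (simp add: sum.distrib z_def)
    finally show ?thesis
      using y[of j] that by (simp add: z_def)
  qed
  then have lin: "z j = of_nat j * z 1" if "j \<le> Suc n" for j
    using that by (intro linear_recurrence[where N = "Suc n"]) (simp_all add: z_def)
  have "of_nat (Suc n) * z 1 = 0"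
    using lin[of "Suc n"] by (simp add: z_def)
  then have "z 1 = 0"
    by (metis mult_eq_0_iff of_nat_neq_0)
  then have "z k = 0"
    using lin[of k] assms(3) by simp
  then show ?thesis
    using assms(3) by (simp add: z_def)
next
  case D
  define z where "z = (\<lambda>k. if k \<in> {1..n} then y k else 0)"
  obtain m where n: "n = Suc (Suc (Suc (Suc m)))"
    using \<open>n \<ge> 4\<close> by (metis add_2_eq_Suc le_Suc_ex numeral_Bit0 plus_nat.simps(2) add_Suc)
  have "2 * z j = z (j - 1) + z (j + 1)" if "1 \<le> j" "j < n - 2" for j
  proof -
    have "(\<Sum>m\<in>{1..n}. if {j, m} \<in> E then y m else 0) =
        (\<Sum>m\<in>{1..n}. (if m = j - 1 then z m else 0) + (if m = j + 1 then z m else 0))"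
      using that by (intro sum.cong refl) (auto simp: D D_edges_iff z_def)
    also have "\<dots> = z (j - 1) + z (j + 1)"
      using that by (simp add: sum.distrib z_def)
    finally show ?thesis
      using y[of j] that by (simp add: z_def)
  qed
  then have lin: "z j = of_nat j * z 1" if "j \<le> n - 2" for j
    using that by (intro linear_recurrence[where N = "n - 2"]) (simp_all add: z_def)
  have end1: "2 * z (n - 1) = z (n - 2)"
  proof -
    have "(\<Sum>m\<in>{1..n}. if {n - 1, m} \<in> E then y m else 0) = (\<Sum>m\<in>{1..n}. (if m = n - 2 then z m else 0))"
      by (intro sum.cong refl) (auto simp: D D_edges_iff z_def n)
    then show ?thesis
      using y[of "n - 1"] by (simp add: z_def n)
  qed
  have end2: "2 * z n = z (n - 2)"
  proof -
    have "(\<Sum>m\<in>{1..n}. if {n, m} \<in> E then y m else 0) = (\<Sum>m\<in>{1..n}. (if m = n - 2 then z m else 0))"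
      by (intro sum.cong refl) (auto simp: D D_edges_iff z_def n)
    then show ?thesis
      using y[of n] by (simp add: z_def n)
  qed
  have "2 * z (n - 2) = z (n - 3) + z (n - 1) + z n"
  proof -
    have "(\<Sum>m\<in>{1..n}. if {n - 2, m} \<in> E then y m else 0) =
        (\<Sum>m\<in>{1..n}. (if m = n - 3 then z m else 0) + (if m = n - 1 then z m else 0) + (if m = n then z m else 0))"
      by (intro sum.cong refl) (auto simp: D D_edges_iff z_def n)
    also have "\<dots> = z (n - 3) + z (n - 1) + z n"
      by (simp add: sum.distrib z_def n)
    finally show ?thesis
      using y[of "n - 2"] by (simp add: z_def n)
  qed
  \<comment> \<open>The two short legs carry half the branch value each, so the branch equation
    gives z(n-2) = z(n-3); a linear function with z(0) = 0 is then zero.\<close>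
  with end1 end2 have "2 * (2 * z (n - 2)) = 2 * z (n - 3) + z (n - 2) + z (n - 2)"
    by (simp add: algebra_simps)
  then have "z (n - 2) = z (n - 3)"
    by simp
  then have "z 1 = 0"
    using lin[of "n - 2"] lin[of "n - 3"] by (simp add: n algebra_simps)
  then have small: "z j = 0" if "j \<le> n - 2" for j
    using lin[OF that] by simp
  have "k \<le> n - 2 \<or> k = n - 1 \<or> k = n"
    using assms(3) by auto
  then have "z k = 0"
    using small end1 end2 by auto
  then show ?thesis
    using assms(3) by (simp add: z_def)
next
  case E
  \<comment> \<open>As a list sum, the right-hand side can be evaluated by rewriting for each
    concrete n.\<close>
  have eq: "2 * y j = (\<Sum>m\<leftarrow>[1..<Suc n]. if {j, m} \<in> E_edges n then y m else 0)" if "j \<in> {1..n}" for j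
    using y[OF that] by (simp add: E(1) interv_sum_list_conv_sum_set_nat atLeastLessThanSuc_atLeastAtMost del: upt_Suc)
  from E(2) consider "n = 6" | "n = 7" | "n = 8"
    by auto
  then show ?thesis
  proof cases
    case 1
    have 1: "2 * y 1 = y 3" "2 * y 2 = y 4" "2 * y 3 = y 1 + y 4" "2 * y 4 = y 2 + y 3 + y 5"
      "2 * y 5 = y 4 + y 6" "2 * y 6 = y 5"
      using eq[of 1] eq[of 2] eq[of 3] eq[of 4] eq[of 5] eq[of 6]
      by (simp_all add: E_edges_iff \<open>n = 6\<close> upt_rec eval_nat_numeral)
    then have "y 1 = 0 \<and> y 2 = 0 \<and> y 3 = 0 \<and> y 4 = 0 \<and> y 5 = 0 \<and> y 6 = 0"
      by linarith
    moreover have "k \<in> {1, 2, 3, 4, 5, 6}"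
      using assms(3) \<open>n = 6\<close> by auto
    ultimately show ?thesis
      by auto
  next
    case 2
    have 1: "2 * y 1 = y 3" "2 * y 2 = y 4" "2 * y 3 = y 1 + y 4" "2 * y 4 = y 2 + y 3 + y 5"
      "2 * y 5 = y 4 + y 6" "2 * y 6 = y 5 + y 7" "2 * y 7 = y 6"
      using eq[of 1] eq[of 2] eq[of 3] eq[of 4] eq[of 5] eq[of 6] eq[of 7]
      by (simp_all add: E_edges_iff \<open>n = 7\<close> upt_rec eval_nat_numeral)
    then have "y 1 = 0 \<and> y 2 = 0 \<and> y 3 = 0 \<and> y 4 = 0 \<and> y 5 = 0 \<and> y 6 = 0 \<and> y 7 = 0"
      by linarith
    moreover have "k \<in> {1, 2, 3, 4, 5, 6, 7}"
      using assms(3) \<open>n = 7\<close> by auto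
    ultimately show ?thesis
      by auto
  next
    case 3
    have 1: "2 * y 1 = y 3" "2 * y 2 = y 4" "2 * y 3 = y 1 + y 4" "2 * y 4 = y 2 + y 3 + y 5"
      "2 * y 5 = y 4 + y 6" "2 * y 6 = y 5 + y 7" "2 * y 7 = y 6 + y 8" "2 * y 8 = y 7"
      using eq[of 1] eq[of 2] eq[of 3] eq[of 4] eq[of 5] eq[of 6] eq[of 7] eq[of 8]
      by (simp_all add: E_edges_iff \<open>n = 8\<close> upt_rec eval_nat_numeral)
    then have "y 1 = 0 \<and> y 2 = 0 \<and> y 3 = 0 \<and> y 4 = 0 \<and> y 5 = 0 \<and> y 6 = 0 \<and> y 7 = 0 \<and> y 8 = 0"
      by linarith
    moreover have "k \<in> {1, 2, 3, 4, 5, 6, 7, 8}"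
      using assms(3) \<open>n = 8\<close> by auto
    ultimately show ?thesis
      by auto
  qed
qed

lemma simply_laced_dynkin_no_loop: "simply_laced_dynkin n E \<Longrightarrow> {k} \<notin> E"
  by (erule simply_laced_dynkin.cases)
     (auto simp: A_edges_def D_edges_def E_edges_def)

lemma edge_mult_sym: "edge_mult \<Gamma> i j = edge_mult \<Gamma> j i"
  by (simp add: edge_mult_def insert_commute)

lemma edge_mult_same:
  assumes "ADE_quiver \<Gamma>"
  shows "edge_mult \<Gamma> i i = 0"
proof -
  obtain n E f where "simply_laced_dynkin n E"
      "\<And>i j. edge_mult \<Gamma> i j = (if {f i, f j} \<in> E then 1 else 0)"
    using assms unfolding ADE_quiver_def by blast
  then show ?thesis
    using simply_laced_dynkin_no_loop by simp
qed

lemma cartan_matrix_sym: "cartan_matrix \<Gamma> i j = cartan_matrix \<Gamma> j i"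
  by (simp add: cartan_matrix_def edge_mult_sym)

lemma cartan_matrix_nondegenerate:
  fixes \<Gamma> :: "('i::finite, 'a) pre_digraph" and x :: "complex ^ 'i"
  assumes ADE: "ADE_quiver \<Gamma>" and x: "\<And>i. (\<Sum>j\<in>UNIV. of_int (cartan_matrix \<Gamma> i j) * x $ j) = 0"
  shows "x = 0"
proof -
  obtain n E f where E: "simply_laced_dynkin n E" and f: "bij_betw f UNIV {1..n}"
    and mult: "\<And>i j. edge_mult \<Gamma> i j = (if {f i, f j} \<in> E then 1 else 0)"
    using ADE unfolding ADE_quiver_def by blast
  define y where "y k = x $ inv f k" for k
  have inj: "inj f"
    using f by (simp add: bij_betw_def)
  have yf: "y (f i) = x $ i" for i
    by (simp add: y_def inv_f_f[OF inj])
  have key: "2 * y (f i) = (\<Sum>m\<in>{1..n}. if {f i, m} \<in> E then y m else 0)" for i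
  proof -
    have "(\<Sum>j\<in>UNIV. of_int (cartan_matrix \<Gamma> i j) * x $ j) =
        (\<Sum>j\<in>UNIV. (if j = i then 2 * x $ i else 0) - (if {f i, f j} \<in> E then x $ j else 0))"
      using edge_mult_same[OF ADE, of i]
      by (intro sum.cong refl) (auto simp: cartan_matrix_def mult split: if_splits)
    also have "\<dots> = 2 * x $ i - (\<Sum>j\<in>UNIV. if {f i, f j} \<in> E then x $ j else 0)"
      by (simp add: sum_subtractf)
    also have "(\<Sum>j\<in>UNIV. if {f i, f j} \<in> E then x $ j else 0) = (\<Sum>j\<in>UNIV. if {f i, f j} \<in> E then y (f j) else 0)"
      unfolding yf ..
    also have "\<dots> = (\<Sum>m\<in>{1..n}. if {f i, m} \<in> E then y m else 0)"
      by (rule sum.reindex_bij_betw[OF f])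
    finally show ?thesis
      using x[of i] by (simp add: yf)
  qed
  have y: "2 * y k = (\<Sum>m\<in>{1..n}. if {k, m} \<in> E then y m else 0)" if "k \<in> {1..n}" for k
  proof -
    have "k \<in> range f"
      using f \<open>k \<in> {1..n}\<close> by (metis bij_betw_imp_surj_on)
    then obtain i where "k = f i"
      by blast
    then show ?thesis
      using key by simp
  qed
  have "y k = 0" if "k \<in> {1..n}" for k
  proof (rule complex_eqI)
    have "2 * Re (y k) = (\<Sum>m\<in>{1..n}. if {k, m} \<in> E then Re (y m) else 0)" if "k \<in> {1..n}" for k
      using arg_cong[OF y[OF that], of Re] by (simp add: if_distrib[of Re] cong: if_cong)
    from dynkin_nondegenerate[OF E this \<open>k \<in> {1..n}\<close>] show "Re (y k) = Re 0"
      by simp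
    have "2 * Im (y k) = (\<Sum>m\<in>{1..n}. if {k, m} \<in> E then Im (y m) else 0)" if "k \<in> {1..n}" for k
      using arg_cong[OF y[OF that], of Im] by (simp add: if_distrib[of Im] cong: if_cong)
    from dynkin_nondegenerate[OF E this \<open>k \<in> {1..n}\<close>] show "Im (y k) = Im 0"
      by simp
  qed
  then have "x $ i = 0" for i
    using f yf[of i] by (metis UNIV_I bij_betwE)
  then show ?thesis
    by (simp add: vec_eq_iff)
qed

section \<open>The bilinear form, weights and \<rho>\<close>

lemma form_simple_root:
  "form \<Gamma> x (simple_root i) = (\<Sum>j\<in>UNIV. of_int (cartan_matrix \<Gamma> i j) * x $ j)"
proof -
  have "form \<Gamma> x (simple_root i) = (\<Sum>j\<in>UNIV. x $ j * of_int (cartan_matrix \<Gamma> j i))"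
    by (simp add: form_def simple_root_def if_distrib cong: if_cong)
  then show ?thesis
    by (simp add: cartan_matrix_sym[of \<Gamma> i] mult.commute)
qed

lemma int_of_of_int [simp]: "int_of (of_int k) = k"
  by (simp add: int_of_def)

lemma form_eq_weight_coord:
  "x \<in> weight_lattice \<Gamma> \<Longrightarrow> form \<Gamma> x (simple_root i) = of_int (weight_coord \<Gamma> x i)"
  by (auto simp: weight_lattice_def weight_coord_def elim!: Ints_cases dest!: spec[of _ i])

text \<open>The description of \<open>rho\<close> needs existence and uniqueness. The square Cartan
  matrix has trivial kernel, so it has a left inverse, which is also a right inverse.\<close>

lemma form_rho:
  fixes \<Gamma> :: "('i::finite, 'a) pre_digraph"
  assumes "ADE_quiver \<Gamma>"
  shows "form \<Gamma> (rho \<Gamma>) (simple_root i) = 1"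
proof -
  let ?P = "\<lambda>x. x \<in> weight_lattice \<Gamma> \<and> (\<forall>i. weight_coord \<Gamma> x i = 1)"
  have P_iff: "?P x \<longleftrightarrow> (\<forall>i. form \<Gamma> x (simple_root i) = 1)" for x
  proof
    assume "\<forall>i. form \<Gamma> x (simple_root i) = 1"
    then show "?P x"
      using int_of_of_int[of 1] by (simp add: weight_lattice_def weight_coord_def)
  qed (simp add: form_eq_weight_coord)
  define A :: "complex ^ 'i ^ 'i" where "A = (\<chi> i j. of_int (cartan_matrix \<Gamma> i j))"
  have A: "(A *v x) $ i = form \<Gamma> x (simple_root i)" for x i
    by (simp add: A_def matrix_vector_mult_def form_simple_root)
  have kernel: "x = 0" if "A *v x = 0" for x
    using cartan_matrix_nondegenerate[OF assms] that A form_simple_root by (metis zero_index)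
  have inj: "inj ((*v) A)"
  proof (rule injI)
    fix x x' assume "A *v x = A *v x'"
    then have "A *v (x - x') = 0"
      by (simp add: matrix_vector_mult_diff_distrib)
    then show "x = x'"
      using kernel by force
  qed
  then obtain B where "B ** A = mat 1"
    using matrix_left_invertible_injective by blast
  then have "A ** B = mat 1"
    by (simp add: matrix_left_right_inverse)
  then have "A *v (B *v (\<chi> i. 1)) = (\<chi> i. 1)"
    by (simp add: matrix_vector_mul_assoc)
  then have ex: "?P (B *v (\<chi> i. 1))"
    unfolding P_iff by (metis A vec_lambda_beta)
  have uniq: "x = x'" if "?P x" "?P x'" for x x'
  proof -
    have "A *v x = A *v x'"
      using that unfolding P_iff by (simp add: vec_eq_iff A)
    then show ?thesis
      using inj by (simp add: inj_eq)
  qed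
  have "?P (rho \<Gamma>)"
    unfolding rho_def by (rule theI[of ?P, OF ex]) (rule uniq[OF _ ex])
  then show ?thesis
    unfolding P_iff by blast
qed

section \<open>Simple reflections\<close>

lemma qparam_qvar: "qparam qvar"
proof
  have pow: "qvar ^ k = Fract (monom 1 k) 1" for k
    by (induction k) (simp_all add: qvar_def One_fract_def[symmetric] monom_Suc flip: One_fract_def)
  show "qvar \<noteq> 0"
    by (simp add: qvar_def Zero_fract_def eq_fract)
  show "qvar ^ k \<noteq> 1" if "k \<ge> 1" for k
  proof
    assume "qvar ^ k = 1"
    then have "monom (1::rat) k = 1"
      unfolding pow by (simp add: One_fract_def eq_fract)
    then have "degree (monom (1::rat) k) = 0"
      by simp
    then show False
      using that by (simp add: degree_monom_eq)
  qed
qed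

lemma of_root_nth [simp]: "of_root \<alpha> $ j = of_nat (\<alpha> $ j)"
  by (simp add: of_root_def simple_root_def if_distrib cong: if_cong)

lemma of_root_eq_iff: "of_root \<alpha> = of_root \<beta> \<longleftrightarrow> \<alpha> = \<beta>"
  by (simp add: vec_eq_iff)

lemma form_diff_left: "form \<Gamma> (x - y) (simple_root i) = form \<Gamma> x (simple_root i) - form \<Gamma> y (simple_root i)"
  by (simp add: form_simple_root algebra_simps sum_subtractf)

lemma form_add_left: "form \<Gamma> (x + y) (simple_root i) = form \<Gamma> x (simple_root i) + form \<Gamma> y (simple_root i)"
  by (simp add: form_simple_root algebra_simps sum.distrib)

lemma form_scale_left: "form \<Gamma> (c *s x) (simple_root i) = c * form \<Gamma> x (simple_root i)"
  by (simp add: form_simple_root sum_distrib_left mult_ac)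

lemma form_of_root_left:
  "form \<Gamma> (of_root \<beta>) (simple_root i) = of_int (\<Sum>j\<in>UNIV. cartan_matrix \<Gamma> i j * int (\<beta> $ j))"
  by (simp add: form_simple_root)

lemma form_simple_root_self: "form \<Gamma> (simple_root i) (simple_root i) = 2"
  unfolding form_simple_root by (simp add: simple_root_def cartan_matrix_def if_distrib cong: if_cong)

lemma form_of_root_right: "form \<Gamma> x (of_root \<beta>) = (\<Sum>j\<in>UNIV. form \<Gamma> x (simple_root j) * of_nat (\<beta> $ j))"
proof -
  have "form \<Gamma> x (of_root \<beta>) = (\<Sum>j\<in>UNIV. \<Sum>i\<in>UNIV. x $ i * of_int (cartan_matrix \<Gamma> i j) * of_nat (\<beta> $ j))"
    unfolding form_def by (subst sum.swap) simp
  then show ?thesis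
    by (simp add: form_simple_root sum_distrib_left sum_distrib_right cartan_matrix_sym mult_ac)
qed

text \<open>Off-diagonal terms occur in equal pairs. This makes the Tits form integral on Q, so
  \<open>int_of\<close> does not round it.\<close>

lemma even_sum_symmetric:
  fixes g :: "'b \<Rightarrow> 'b \<Rightarrow> int"
  assumes "finite A" and "\<And>i j. g i j = g j i" and "\<And>i. even (g i i)"
  shows "even (\<Sum>i\<in>A. \<Sum>j\<in>A. g i j)"
  using assms(1)
proof induction
  case (insert x A)
  have "(\<Sum>i\<in>A. g i x) = (\<Sum>j\<in>A. g x j)"
    by (intro sum.cong refl assms(2))
  then have "(\<Sum>i\<in>insert x A. \<Sum>j\<in>insert x A. g i j) = g x x + 2 * (\<Sum>j\<in>A. g x j) + (\<Sum>i\<in>A. \<Sum>j\<in>A. g i j)"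
    using insert.hyps by (simp add: sum.distrib)
  then show ?case
    using insert.IH assms(3) by simp
qed simp

lemma tits_form_of_root:
  fixes \<Gamma> :: "('i::finite, 'a) pre_digraph"
  shows "2 * int_of (tits_form \<Gamma> (of_root \<beta>)) =
      (\<Sum>i\<in>UNIV. \<Sum>j\<in>UNIV. int (\<beta> $ i) * cartan_matrix \<Gamma> i j * int (\<beta> $ j))"
proof -
  let ?S = "\<Sum>i\<in>UNIV. \<Sum>j\<in>UNIV. int (\<beta> $ i) * cartan_matrix \<Gamma> i j * int (\<beta> $ j)"
  have "even ?S"
    by (rule even_sum_symmetric) (simp_all add: cartan_matrix_sym mult_ac, simp add: cartan_matrix_def)
  then obtain t where t: "?S = 2 * t"
    by blast
  have "form \<Gamma> (of_root \<beta>) (of_root \<beta>) = of_int ?S"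
    by (simp add: form_def)
  then have "tits_form \<Gamma> (of_root \<beta>) = of_int t"
    by (simp add: tits_form_def t)
  then show ?thesis
    by (simp add: t)
qed

abbreviation tits :: "('i::finite, 'a) pre_digraph \<Rightarrow> ('i \<Rightarrow> nat) \<Rightarrow> int" where
  "tits \<Gamma> \<beta> \<equiv> int_of (tits_form \<Gamma> (of_root (vec_lambda \<beta>)))"

lemma graph_form_ADE:
  assumes "ADE_quiver \<Gamma>"
  shows "graph_form (edge_mult \<Gamma>) (tits \<Gamma>)"
proof
  show "edge_mult \<Gamma> i j = edge_mult \<Gamma> j i" for i j
    by (rule edge_mult_sym)
  show "edge_mult \<Gamma> i i = 0" for i
    by (rule edge_mult_same[OF assms])
  show "2 * tits \<Gamma> \<beta> = (\<Sum>i\<in>UNIV. \<Sum>j\<in>UNIV. int (\<beta> i) * (if i = j then 2 else - int (edge_mult \<Gamma> i j)) * int (\<beta> j))" for \<beta>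
    unfolding tits_form_of_root cartan_matrix_def by simp
qed

section \<open>From the fermionic form to the truncated sum\<close>

lemma families_partitions: "\<tau> \<in> families L \<Longrightarrow> \<tau> i \<in> partitions"
  by (auto simp: families_def bounded_partitions_def partitions_def)

lemma part_zero: "\<tau> \<in> families L \<Longrightarrow> k \<ge> L \<Longrightarrow> part \<tau> k = 0"
  by (simp add: families_def bounded_partitions_def part_def vec_eq_iff)

lemma total_size_families:
  assumes "\<tau> \<in> families L"
  shows "total_size \<tau> = vec_lambda (size_of L \<tau>)"
proof -
  have "total_size \<tau> = (\<Sum>k<L. part \<tau> k)"
    unfolding total_size_def
    by (rule Sum_any.expand_superset) (use part_zero[OF assms] in \<open>auto simp: not_le[symmetric]\<close>)
  then show ?thesis
    by (simp add: vec_eq_iff part_def size_of_def)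
qed

lemma partitions_imp_families:
  fixes \<tau> :: "'i::finite \<Rightarrow> nat \<Rightarrow> nat"
  assumes "\<And>i. \<tau> i \<in> partitions"
  obtains N where "\<tau> \<in> families N"
proof -
  have "\<forall>i. \<exists>N. \<forall>k\<ge>N. \<tau> i k = 0"
    using assms by (simp add: partitions_def)
  then obtain N where N: "\<And>i k. k \<ge> N i \<Longrightarrow> \<tau> i k = 0"
    by metis
  have "N i \<le> (\<Sum>i\<in>UNIV. N i)" for i
    by (rule member_le_sum) simp_all
  then have "\<tau> \<in> families (\<Sum>i\<in>UNIV. N i)"
    using N assms by (auto simp: families_def bounded_partitions_def partitions_def intro: order_trans)
  then show ?thesis
    by (rule that)
qed

text \<open>A nonzero entry at some index k \<ge> L would force k + 1 positive entries, so a size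
  above L.\<close>

lemma families_of_eq:
  fixes \<alpha> :: "'i::finite \<Rightarrow> nat"
  assumes L: "\<And>j. \<alpha> j \<le> L"
  shows "{\<tau>. (\<forall>i. \<tau> i \<in> partitions) \<and> of_root (total_size \<tau>) = of_root (vec_lambda \<alpha>)} = families_of L \<alpha>"
proof (intro subset_antisym subsetI)
  fix \<tau> assume "\<tau> \<in> families_of L \<alpha>"
  then have "\<tau> \<in> families L" "size_of L \<tau> = \<alpha>"
    by (auto simp: families_of_def)
  then show "\<tau> \<in> {\<tau>. (\<forall>i. \<tau> i \<in> partitions) \<and> of_root (total_size \<tau>) = of_root (vec_lambda \<alpha>)}"
    by (auto simp: total_size_families intro: families_partitions)
next
  fix \<tau> assume "\<tau> \<in> {\<tau>. (\<forall>i. \<tau> i \<in> partitions) \<and> of_root (total_size \<tau>) = of_root (vec_lambda \<alpha>)}"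
  then have part: "\<And>i. \<tau> i \<in> partitions" and tot: "total_size \<tau> = vec_lambda \<alpha>"
    by (simp_all add: of_root_eq_iff)
  obtain N where N: "\<tau> \<in> families N"
    using part by (rule partitions_imp_families)
  have size: "(\<Sum>k<N. \<tau> i k) = \<alpha> i" for i
    using tot unfolding total_size_families[OF N] by (simp add: vec_eq_iff size_of_def)
  have zero: "\<tau> i k = 0" if "k \<ge> L" for i k
  proof (rule ccontr)
    assume nz: "\<tau> i k \<noteq> 0"
    moreover have "\<tau> i \<in> bounded_partitions N"
      using N by (simp add: families_def)
    ultimately have "k < N"
      using bounded_partitions_zero by (meson not_le)
    have "antimono (\<tau> i)"
      using part[of i] by (simp add: partitions_def)
    then have "\<tau> i k \<le> \<tau> i l" if "l \<le> k" for l
      using that by (rule antimonoD)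
    then have "\<tau> i l \<ge> 1" if "l \<le> k" for l
      using that nz by (metis One_nat_def Suc_leI le_zero_eq neq0_conv)
    then have "(\<Sum>l\<le>k. 1) \<le> (\<Sum>l\<le>k. \<tau> i l)"
      by (intro sum_mono) simp
    also have "\<dots> \<le> (\<Sum>l<N. \<tau> i l)"
      by (rule sum_mono2) (use \<open>k < N\<close> in auto)
    finally show False
      using size[of i] L[of i] that by simp
  qed
  then have fam: "\<tau> \<in> families L"
    using part by (auto simp: families_def bounded_partitions_def partitions_def)
  moreover have "size_of L \<tau> = \<alpha>"
    using tot unfolding total_size_families[OF fam] by (simp add: vec_eq_iff fun_eq_iff)
  ultimately show "\<tau> \<in> families_of L \<alpha>"
    by (simp add: families_of_def)
qed

lemma dominant_coord:
  assumes "\<nu> \<in> dominant_weights \<Gamma>"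
  shows "form \<Gamma> \<nu> (simple_root i) = of_int (int (nat (weight_coord \<Gamma> \<nu> i)))"
    using assms form_eq_weight_coord[of \<nu> \<Gamma> i] by (auto simp: dominant_weights_def)

lemma weight_coord_diff_parts:
  assumes "\<nu> \<in> dominant_weights \<Gamma>"
  shows "weight_coord \<Gamma> (\<nu> - (\<Sum>l\<le>k. of_root (part \<tau> l))) j =
    int (nat (weight_coord \<Gamma> \<nu> j)) - (\<Sum>l\<le>k. \<Sum>m\<in>UNIV. cartan_matrix \<Gamma> j m * int (\<tau> m l))"
proof -
  have "form \<Gamma> (\<Sum>l\<le>k. of_root (part \<tau> l)) (simple_root j) =
      of_int (\<Sum>l\<le>k. \<Sum>m\<in>UNIV. cartan_matrix \<Gamma> j m * int (\<tau> m l))"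
    by (induction k) (simp_all add: form_add_left form_of_root_left part_def)
  then have "form \<Gamma> (\<nu> - (\<Sum>l\<le>k. of_root (part \<tau> l))) (simple_root j) =
    of_int (int (nat (weight_coord \<Gamma> \<nu> j)) - (\<Sum>l\<le>k. \<Sum>m\<in>UNIV. cartan_matrix \<Gamma> j m * int (\<tau> m l)))"
    unfolding form_diff_left dominant_coord[OF assms] by simp
  from arg_cong[OF this, of int_of] show ?thesis
    by (simp only: weight_coord_def[symmetric] int_of_of_int)
qed

lemma qbracket_0 [simp]: "qbracket x 0 = 1"
  by (simp add: qbracket_def)

text \<open>Any L dominating \<alpha> is allowed, so that two different weights can be compared with
  a common cutoff.\<close>

lemma fermionic_form_eq_sum:
  fixes \<Gamma> :: "('i::finite, 'a) pre_digraph"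
  assumes ADE: "ADE_quiver \<Gamma>" and \<nu>: "\<nu> \<in> dominant_weights \<Gamma>"
    and diff: "\<nu> - \<mu> = of_root (vec_lambda \<alpha>)" and L: "\<And>j. \<alpha> j \<le> L"
  shows "fermionic_form \<Gamma> \<nu> \<mu> =
    graph_form.fermionic_sum (edge_mult \<Gamma>) (tits \<Gamma>) qvar (\<lambda>j. nat (weight_coord \<Gamma> \<nu> j)) L \<alpha>"
proof -
  interpret graph_form "edge_mult \<Gamma>" "tits \<Gamma>"
    by (rule graph_form_ADE[OF ADE])
  have cartan_eq: "cartan i j = cartan_matrix \<Gamma> i j" for i j
    by (simp add: cartan_def cartan_matrix_def)
  show ?thesis
    unfolding fermionic_form_def diff families_of_eq[of \<alpha> L, OF L] fermionic_sum_def
  proof (intro sum.cong refl)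
    fix \<tau> assume "\<tau> \<in> families_of L \<alpha>"
    then have \<tau>: "\<tau> \<in> families L"
      by (simp add: families_of_def)
    have "form \<Gamma> \<nu> (of_root (part \<tau> 0)) = of_int (\<Sum>j\<in>UNIV. int (nat (weight_coord \<Gamma> \<nu> j)) * int (\<tau> j 0))"
      unfolding form_of_root_right dominant_coord[OF \<nu>] by (simp add: part_def)
    then have 1: "int_of (form \<Gamma> \<nu> (of_root (part \<tau> 0))) = (\<Sum>j\<in>UNIV. int (nat (weight_coord \<Gamma> \<nu> j)) * int (\<tau> j 0))"
      by (simp only: int_of_of_int)
    let ?f = "\<lambda>k. qvar powi int_of (tits_form \<Gamma> (of_root (part \<tau> k))) *
          weight_bracket \<Gamma> (\<nu> - (\<Sum>l\<le>k. of_root (part \<tau> l))) (part \<tau> k - part \<tau> (Suc k))"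
    have "?f k = 1" if "k \<ge> L" for k
    proof -
      have "of_root (0 :: nat ^ 'i) = 0"
        by (simp add: vec_eq_iff)
      moreover have "tits_form \<Gamma> 0 = 0"
        by (simp add: tits_form_def form_def)
      ultimately show ?thesis
        using that part_zero[OF \<tau>, of k] part_zero[OF \<tau>, of "Suc k"]
        by (simp add: weight_bracket_def int_of_def)
    qed
    then have "Prod_any ?f = (\<Prod>k<L. ?f k)"
      by (intro Prod_any.expand_superset) (auto simp: not_le[symmetric])
    also have "\<dots> = (\<Prod>k<L. qvar powi tits \<Gamma> (\<lambda>j. \<tau> j k) *
       (\<Prod>j\<in>UNIV. bracket qvar (int (nat (weight_coord \<Gamma> \<nu> j)) - (\<Sum>l\<le>k. \<Sum>m\<in>UNIV. cartan j m * int (\<tau> m l)))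
         (\<tau> j k - \<tau> j (Suc k))))"
      unfolding weight_bracket_def weight_coord_diff_parts[OF \<nu>] cartan_eq
      by (simp add: bracket_def qbracket_def part_def)
    finally show "qvar powi (- int_of (form \<Gamma> \<nu> (of_root (part \<tau> 0)))) * Prod_any ?f =
        fermionic_term qvar (\<lambda>j. nat (weight_coord \<Gamma> \<nu> j)) L \<tau>"
      unfolding fermionic_term_def 1 by simp
  qed
qed

lemma fermionic_form_eq_0:
  assumes "\<nexists>\<alpha>. \<nu> - \<mu> = of_root \<alpha>"
  shows "fermionic_form \<Gamma> \<nu> \<mu> = 0"
proof -
  have empty: "{\<tau>. (\<forall>i. \<tau> i \<in> partitions) \<and> of_root (total_size \<tau>) = \<nu> - \<mu>} = {}"
    using assms by (auto dest: sym)
  show ?thesis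
    unfolding fermionic_form_def empty by simp
qed

section \<open>The dot action and the sign\<close>

lemma dot_simple_reflection:
  assumes "ADE_quiver \<Gamma>" and "\<mu> \<in> weight_lattice \<Gamma>"
  shows "dot_action \<Gamma> (simple_reflection \<Gamma> i) \<mu> = \<mu> - of_int (weight_coord \<Gamma> \<mu> i + 1) *s simple_root i"
  unfolding dot_action_def simple_reflection_def form_add_left form_rho[OF assms(1)] form_eq_weight_coord[OF assms(2)]
  by simp

lemma dot_simple_reflection_weight_lattice:
  assumes "ADE_quiver \<Gamma>" and "\<mu> \<in> weight_lattice \<Gamma>"
  shows "dot_action \<Gamma> (simple_reflection \<Gamma> i) \<mu> \<in> weight_lattice \<Gamma>"
proof -
  have "form \<Gamma> (simple_root i) (simple_root j) \<in> \<int>" for j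
    unfolding form_simple_root by (auto simp: simple_root_def)
  then show ?thesis
    unfolding dot_simple_reflection[OF assms] using assms(2)
    by (auto simp: weight_lattice_def form_diff_left form_scale_left)
qed

lemma dot_simple_reflection_involution:
  "dot_action \<Gamma> (simple_reflection \<Gamma> i) (dot_action \<Gamma> (simple_reflection \<Gamma> i) \<mu>) = \<mu>"
proof -
  have "simple_reflection \<Gamma> i (simple_reflection \<Gamma> i x) = x" for x
    by (simp add: simple_reflection_def form_diff_left form_scale_left form_simple_root_self vec_eq_iff)
  then show ?thesis
    by (simp add: dot_action_def)
qed

text \<open>With \<alpha> the coordinates of \<nu> - \<mu>, the coordinate of \<mu> at i is d - 2
  \<alpha>_i. Subtracting (\<mu>_i + 1) times the simple root from \<mu> therefore replaces
  \<alpha>_i by d + 1 - \<alpha>_i and fixes the other coordinates.\<close>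

lemma fermionic_form_reflection_root:
  fixes \<Gamma> :: "('i::finite, 'a) pre_digraph"
  assumes ADE: "ADE_quiver \<Gamma>" and \<nu>: "\<nu> \<in> dominant_weights \<Gamma>" and \<mu>: "\<mu> \<in> weight_lattice \<Gamma>"
    and diff: "\<nu> - \<mu> = of_root \<beta>"
  shows "fermionic_form \<Gamma> \<nu> (dot_action \<Gamma> (simple_reflection \<Gamma> i) \<mu>) = - fermionic_form \<Gamma> \<nu> \<mu>"
proof -
  interpret graph_form "edge_mult \<Gamma>" "tits \<Gamma>"
    by (rule graph_form_ADE[OF ADE])
  define \<alpha> where "\<alpha> j = \<beta> $ j" for j
  have \<beta>: "\<beta> = vec_lambda \<alpha>"
    by (simp add: \<alpha>_def vec_eq_iff)
  define n where "n j = nat (weight_coord \<Gamma> \<nu> j)" for j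
  define d where "d = n i + (\<Sum>j\<in>UNIV. edge_mult \<Gamma> i j * \<alpha> j)"
  let ?\<mu> = "dot_action \<Gamma> (simple_reflection \<Gamma> i) \<mu>"
  have "(\<Sum>j\<in>UNIV. cartan_matrix \<Gamma> i j * int (\<alpha> j)) =
      (\<Sum>j\<in>UNIV. (if j = i then 2 * int (\<alpha> i) else 0) - int (edge_mult \<Gamma> i j * \<alpha> j))"
    using e_irrefl[of i] by (intro sum.cong refl) (auto simp: cartan_matrix_def)
  also have "\<dots> = 2 * int (\<alpha> i) - int (\<Sum>j\<in>UNIV. edge_mult \<Gamma> i j * \<alpha> j)"
    by (simp add: sum_subtractf)
  finally have pair: "(\<Sum>j\<in>UNIV. cartan_matrix \<Gamma> i j * int (\<alpha> j)) = 2 * int (\<alpha> i) - int (\<Sum>j\<in>UNIV. edge_mult \<Gamma> i j * \<alpha> j)" .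
  have \<mu>_eq: "\<mu> = \<nu> - of_root \<beta>"
    using diff by (simp add: algebra_simps)
  have "form \<Gamma> \<mu> (simple_root i) = of_int (int (n i) - (2 * int (\<alpha> i) - int (\<Sum>j\<in>UNIV. edge_mult \<Gamma> i j * \<alpha> j)))"
    unfolding \<mu>_eq form_diff_left dominant_coord[OF \<nu>] form_of_root_left \<beta> vec_lambda_beta pair n_def
    by simp
  from arg_cong[OF this, of int_of] have coord: "weight_coord \<Gamma> \<mu> i = int d - 2 * int (\<alpha> i)"
    unfolding weight_coord_def[symmetric] int_of_of_int by (simp add: d_def)
  have diff': "(\<nu> - ?\<mu>) $ j = (if j = i then of_int (int d + 1 - int (\<alpha> i)) else of_nat (\<alpha> j))" for j
  proof -
    have "\<nu> - ?\<mu> = of_root \<beta> + of_int (weight_coord \<Gamma> \<mu> i + 1) *s simple_root i"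
      unfolding dot_simple_reflection[OF ADE \<mu>] diff[symmetric] by simp
    then show ?thesis
      by (simp add: coord simple_root_def \<alpha>_def)
  qed
  show ?thesis
  proof (cases "\<alpha> i \<le> Suc d")
    case True
    define \<alpha>' where "\<alpha>' = \<alpha>(i := Suc d - \<alpha> i)"
    have "\<nu> - ?\<mu> = of_root (vec_lambda \<alpha>')"
      using True unfolding vec_eq_iff diff' by (auto simp: \<alpha>'_def of_nat_diff)
    moreover define L where "L = Suc ((\<Sum>j\<in>UNIV. \<alpha> j) + (\<Sum>j\<in>UNIV. \<alpha>' j))"
    have L: "\<alpha> j \<le> L" "\<alpha>' j \<le> L" for j
      unfolding L_def using member_le_sum[of j UNIV \<alpha>] member_le_sum[of j UNIV \<alpha>'] by simp_all
    ultimately have "fermionic_form \<Gamma> \<nu> ?\<mu> = fermionic_sum qvar n L \<alpha>'"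
      unfolding n_def by (intro fermionic_form_eq_sum[OF ADE \<nu>]) simp_all
    also have "\<dots> = - fermionic_sum qvar n L \<alpha>"
    proof (rule fermionic_sum_antisymmetric[OF qparam_qvar])
      show "\<alpha> i + \<alpha>' i = Suc (n i + (\<Sum>j\<in>UNIV. edge_mult \<Gamma> i j * \<alpha> j))"
        using True by (simp add: \<alpha>'_def d_def[symmetric])
      show "\<alpha>' j = \<alpha> j" if "j \<noteq> i" for j
        using that by (simp add: \<alpha>'_def)
      show "1 \<le> L"
        by (simp add: L_def)
    qed (rule L)+
    also have "fermionic_sum qvar n L \<alpha> = fermionic_form \<Gamma> \<nu> \<mu>"
      unfolding n_def by (intro fermionic_form_eq_sum[OF ADE \<nu>, symmetric]) (simp_all add: diff \<beta> L)
    finally show ?thesis .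
  next
    case False
    have "\<nexists>\<gamma>. \<nu> - ?\<mu> = of_root \<gamma>"
    proof
      assume "\<exists>\<gamma>. \<nu> - ?\<mu> = of_root \<gamma>"
      then obtain \<gamma> where "\<nu> - ?\<mu> = of_root \<gamma>"
        by blast
      then have "of_int (int d + 1 - int (\<alpha> i)) = (of_int (int (\<gamma> $ i)) :: complex)"
        using diff'[of i] by simp
      then have "int d + 1 - int (\<alpha> i) = int (\<gamma> $ i)"
        unfolding of_int_eq_iff .
      then show False
        using False by simp
    qed
    then have "fermionic_form \<Gamma> \<nu> ?\<mu> = 0"
      by (rule fermionic_form_eq_0)
    moreover define L where "L = Suc (\<Sum>j\<in>UNIV. \<alpha> j)"
    have L: "\<alpha> j \<le> L" for j
      unfolding L_def using member_le_sum[of j UNIV \<alpha>] by simp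
    have "fermionic_form \<Gamma> \<nu> \<mu> = fermionic_sum qvar n L \<alpha>"
      unfolding n_def by (intro fermionic_form_eq_sum[OF ADE \<nu>]) (simp_all add: diff \<beta> L)
    moreover have "fermionic_sum qvar n L \<alpha> = 0"
      by (rule fermionic_sum_vanishes[OF qparam_qvar, of L \<alpha> i])
        (use False L in \<open>simp_all add: L_def d_def[symmetric]\<close>)
    ultimately show ?thesis
      by simp
  qed
qed

text \<open>If only the reflected difference lies in Q_+, the previous lemma applies to the
  reflected weight, since the dot action of a simple reflection is an involution.\<close>

lemma fermionic_form_reflection:
  fixes \<Gamma> :: "('i::finite, 'a) pre_digraph"
  assumes ADE: "ADE_quiver \<Gamma>" and \<nu>: "\<nu> \<in> dominant_weights \<Gamma>" and \<mu>: "\<mu> \<in> weight_lattice \<Gamma>"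
  shows "fermionic_form \<Gamma> \<nu> (dot_action \<Gamma> (simple_reflection \<Gamma> i) \<mu>) = - fermionic_form \<Gamma> \<nu> \<mu>"
proof -
  let ?\<mu> = "dot_action \<Gamma> (simple_reflection \<Gamma> i) \<mu>"
  consider \<beta> where "\<nu> - \<mu> = of_root \<beta>" | \<beta> where "\<nu> - ?\<mu> = of_root \<beta>"
    | "\<nexists>\<beta>. \<nu> - \<mu> = of_root \<beta>" "\<nexists>\<beta>. \<nu> - ?\<mu> = of_root \<beta>"
    by blast
  then show ?thesis
  proof cases
    case 1
    then show ?thesis
      by (rule fermionic_form_reflection_root[OF assms])
  next
    case 2
    then have "fermionic_form \<Gamma> \<nu> (dot_action \<Gamma> (simple_reflection \<Gamma> i) ?\<mu>) = - fermionic_form \<Gamma> \<nu> ?\<mu>"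
      by (rule fermionic_form_reflection_root[OF ADE \<nu> dot_simple_reflection_weight_lattice[OF ADE \<mu>]])
    then show ?thesis
      by (simp add: dot_simple_reflection_involution)
  next
    case 3
    then show ?thesis
      by (simp add: fermionic_form_eq_0)
  qed
qed

lemma dot_action_comp: "dot_action \<Gamma> (f \<circ> g) x = dot_action \<Gamma> f (dot_action \<Gamma> g x)"
  by (simp add: dot_action_def)

theorem mainTheorem4:
  fixes \<Gamma> :: "('i::finite, 'a) pre_digraph"
    and \<nu> \<mu> :: "complex ^ 'i"
    and w :: "complex ^ 'i \<Rightarrow> complex ^ 'i"
  assumes "ADE_quiver \<Gamma>"
    and "\<nu> \<in> dominant_weights \<Gamma>"
    and "\<mu> \<in> weight_lattice \<Gamma>"
    and "w \<in> weyl_group \<Gamma>"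
  shows "fermionic_form \<Gamma> \<nu> (dot_action \<Gamma> w \<mu>) =
    (-1) ^ weyl_length \<Gamma> w * fermionic_form \<Gamma> \<nu> \<mu>"
proof -
  \<comment> \<open>The sign is computed for arbitrary words, together with the membership in the
    lattice that each further reflection requires. A shortest word is chosen only
    afterwards.\<close>
  have word: "dot_action \<Gamma> (reflection_word \<Gamma> is) \<mu> \<in> weight_lattice \<Gamma> \<and>
      fermionic_form \<Gamma> \<nu> (dot_action \<Gamma> (reflection_word \<Gamma> is) \<mu>) = (-1) ^ length is * fermionic_form \<Gamma> \<nu> \<mu>" for "is"
  proof (induction "is")
    case Nil
    then show ?case
      using assms(3) by (simp add: reflection_word_def dot_action_def)
  next
    case (Cons i "is")
    have eq: "reflection_word \<Gamma> (i # is) = simple_reflection \<Gamma> i \<circ> reflection_word \<Gamma> is"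
      by (simp add: reflection_word_def)
    show ?case
      unfolding eq dot_action_comp
      using Cons.IH fermionic_form_reflection[OF assms(1,2)] dot_simple_reflection_weight_lattice[OF assms(1)]
      by simp
  qed
  have "\<exists>l is. length is = l \<and> reflection_word \<Gamma> is = w"
    using assms(4) by (auto simp: weyl_group_def)
  from LeastI_ex[OF this] obtain "is" where "length is = weyl_length \<Gamma> w" "reflection_word \<Gamma> is = w"
    unfolding weyl_length_def by blast
  then show ?thesis
    using word[of "is"] by simp
qed

end
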